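(* Let $X$ be a projective variety over an algebraically closed field with an action by a geometrically reductive linear algebraic group $G$. Let $D$ be a complete curve in the stable space $X^{s}$ whose quotient by $G$ is a complete curve $C$, and say the map from $D$ to $C$ has degree $m$. Suppose the stabilizer is generically finite, of size $h$, and that either $D$ or $C$ is normal. Let $S_D\subseteq G$ be the finite subgroup of order $mh$ such that for all $x\in D$ and $g\in G$, $gx\in D$ if and only if $g\in S_D$. Then the map from $D$ to $C$ is ramified precisely at the points $x\in D$ where the stabilizer group is larger than $h$ and intersects $S_D$ in a larger subgroup than in the generic case.
   Context: Stability is in the sense of geometric invariant theory for a linearized action with respect to an ample line bundle. For $X\subseteq\mathbb{P}(V)$ with $G$ acting linearly on $V$, a point is stable if every one-parameter subgroup of $G$ acts on a lift of it to $V$ with both negative and positive weights. $X^s$ is the open set of stable points, with geometric quotient $X^s\to X^s//G$; "the quotient of $D$ by $G$" is the image $C$ of $D$ in $X^s//G$. The size $h$ is the order of the stabilizer in $G$ of a generic point of $D$. The existence of the group $S_D$ under these hypotheses is a result of the paper and may be assumed.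
   Formalization: Where C is not normal, ramification of D over C is measured over the normalization of C (ramification index greater than 1); with the usual definition of ramified the claim fails, e.g. for a smooth D mapping birationally onto a cuspidal C with trivial stabilizers. *)

theory Defs
  imports
    "HOL-Analysis.Abstract_Topology"
    "HOL-Algebra.Embedded_Algebras"
    "HOL-Algebra.Ideal"
    "HOL-Computational_Algebra.Polynomial"
    "Jordan_Normal_Form.Determinant"
begin

section \<open>Spaces with functions\<close>

text \<open>Varieties over the algebraically closed field \<open>'k\<close> are treated classically, as sets of
  closed points with a topology and a sheaf of \<open>'k\<close>-valued functions. Elements of
  \<open>fs_reg X U\<close>, for \<open>U\<close> open, are total functions of which only the values on \<open>U\<close> matter.\<close>

record ('p, 'k) fun_space =
  fs_top :: "'p topology"
  fs_reg :: "'p set \<Rightarrow> ('p \<Rightarrow> 'k) set"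

abbreviation pts :: "('p, 'k) fun_space \<Rightarrow> 'p set" where
  "pts X \<equiv> topspace (fs_top X)"

definition fs_morphism ::
    "('p, 'k) fun_space \<Rightarrow> ('q, 'k) fun_space \<Rightarrow> ('p \<Rightarrow> 'q) \<Rightarrow> bool" where
  "fs_morphism X Y f \<longleftrightarrow>
     continuous_map (fs_top X) (fs_top Y) f \<and>
     (\<forall>V. openin (fs_top Y) V \<longrightarrow> (\<forall>\<phi>\<in>fs_reg Y V. \<phi> \<circ> f \<in> fs_reg X {x \<in> pts X. f x \<in> V}))"

definition fs_isomorphic :: "('p, 'k) fun_space \<Rightarrow> ('q, 'k) fun_space \<Rightarrow> bool" where
  "fs_isomorphic X Y \<longleftrightarrow>
     (\<exists>f g. fs_morphism X Y f \<and> fs_morphism Y X g \<and>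
        (\<forall>x\<in>pts X. g (f x) = x) \<and> (\<forall>y\<in>pts Y. f (g y) = y))"

text \<open>The reduced structure induced on a locally closed subset.\<close>

definition induced :: "('p, 'k) fun_space \<Rightarrow> 'p set \<Rightarrow> ('p, 'k) fun_space" where
  "induced X Z =
     \<lparr> fs_top = subtopology (fs_top X) Z,
       fs_reg = (\<lambda>U. {f. \<forall>x\<in>U. \<exists>W g. openin (fs_top X) W \<and> x \<in> W \<and> g \<in> fs_reg X W \<and>
                                   (\<forall>z\<in>W \<inter> U. f z = g z)}) \<rparr>"

text \<open>The quotient along \<open>q\<close>: the quotient topology, with the regular functions those whose
  pullback is regular. When the fibres of \<open>q\<close> are the orbits of a group, these
  pullbacks are exactly the invariant regular functions, so that a geometric quotient, if it exists,
  is this space.\<close>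

lemma istopology_quotient:
  "istopology (\<lambda>V. V \<subseteq> q ` topspace T \<and> openin T {x \<in> topspace T. q x \<in> V})"
proof -
  have "{x \<in> topspace T. q x \<in> A \<inter> B} = {x \<in> topspace T. q x \<in> A} \<inter> {x \<in> topspace T. q x \<in> B}"
    for A B by blast
  moreover have "{x \<in> topspace T. q x \<in> \<Union>\<K>} = (\<Union>A\<in>\<K>. {x \<in> topspace T. q x \<in> A})" for \<K>
    by blast
  ultimately show ?thesis
    unfolding istopology_def by (auto intro!: openin_Union)
qed

definition quotient_space :: "('p, 'k) fun_space \<Rightarrow> ('p \<Rightarrow> 'q) \<Rightarrow> ('q, 'k) fun_space" where
  "quotient_space X q =
     \<lparr> fs_top = topology (\<lambda>V. V \<subseteq> q ` pts X \<and> openin (fs_top X) {x \<in> pts X. q x \<in> V}),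
       fs_reg = (\<lambda>V. {\<phi>. \<phi> \<circ> q \<in> fs_reg X {x \<in> pts X. q x \<in> V}}) \<rparr>"

lemma openin_quotient_space:
  "openin (fs_top (quotient_space X q)) V \<longleftrightarrow>
     V \<subseteq> q ` pts X \<and> openin (fs_top X) {x \<in> pts X. q x \<in> V}"
  by (simp add: quotient_space_def topology_inverse'[OF istopology_quotient])

lemma pts_quotient_space: "pts (quotient_space X q) = q ` pts X"
proof -
  have "{x \<in> pts X. q x \<in> q ` pts X} = pts X" by blast
  hence "openin (fs_top (quotient_space X q)) (q ` pts X)"
    by (simp add: openin_quotient_space)
  thus ?thesis
    by (meson openin_quotient_space openin_subset openin_topspace subset_antisym)
qed


section \<open>Affine and projective space\<close>

text \<open>The algebra of functions generated by \<open>B\<close> over the constants. For \<open>B\<close> the coordinate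
  functions this gives the polynomial functions.\<close>

inductive_set fun_algebra :: "('p \<Rightarrow> 'k::comm_ring_1) set \<Rightarrow> ('p \<Rightarrow> 'k) set"
  for B :: "('p \<Rightarrow> 'k) set" where
  const: "(\<lambda>_. c) \<in> fun_algebra B"
| gen: "f \<in> B \<Longrightarrow> f \<in> fun_algebra B"
| add: "f \<in> fun_algebra B \<Longrightarrow> g \<in> fun_algebra B \<Longrightarrow> (\<lambda>x. f x + g x) \<in> fun_algebra B"
| mult: "f \<in> fun_algebra B \<Longrightarrow> g \<in> fun_algebra B \<Longrightarrow> (\<lambda>x. f x * g x) \<in> fun_algebra B"

abbreviation poly_functions :: "nat \<Rightarrow> ('k::field vec \<Rightarrow> 'k) set" where
  "poly_functions n \<equiv> fun_algebra {\<lambda>v. v $ i | i. i < n}"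

definition affine_space :: "nat \<Rightarrow> ('k::field vec, 'k) fun_space" where
  "affine_space n =
     (let T = topology_generated_by {{v \<in> carrier_vec n. f v \<noteq> 0} | f. f \<in> poly_functions n}
      in \<lparr> fs_top = T,
           fs_reg = (\<lambda>U. {\<phi>. \<forall>x\<in>U. \<exists>W. openin T W \<and> x \<in> W \<and> W \<subseteq> U \<and>
                       (\<exists>f\<in>poly_functions n. \<exists>g\<in>poly_functions n.
                          \<forall>v\<in>W. g v \<noteq> 0 \<and> \<phi> v = f v / g v)}) \<rparr>)"

text \<open>\<open>hom_poly n d f\<close>: \<open>f\<close> is a homogeneous polynomial of degree \<open>d\<close> in \<open>n\<close> variables
  (possibly zero).\<close>

inductive hom_poly :: "nat \<Rightarrow> nat \<Rightarrow> ('k::field vec \<Rightarrow> 'k) \<Rightarrow> bool" for n where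
  const: "hom_poly n 0 (\<lambda>_. c)"
| zero: "hom_poly n d (\<lambda>_. 0)"
| coord_mult: "i < n \<Longrightarrow> hom_poly n d f \<Longrightarrow> hom_poly n (Suc d) (\<lambda>v. v $ i * f v)"
| add: "hom_poly n d f \<Longrightarrow> hom_poly n d g \<Longrightarrow> hom_poly n d (\<lambda>v. f v + g v)"

text \<open>A point of \<open>\<P>(k\<^sup>n)\<close> is the set of its lifts to \<open>k\<^sup>n\<close>, that is, a line without the
  origin.\<close>

definition proj_points :: "nat \<Rightarrow> 'k::field vec set set" where
  "proj_points n = {{c \<cdot>\<^sub>v v | c. c \<noteq> 0} | v. v \<in> carrier_vec n \<and> v \<noteq> 0\<^sub>v n}"

definition proj_space :: "nat \<Rightarrow> ('k::field vec set, 'k) fun_space" where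
  "proj_space n =
     (let T = topology_generated_by
                {{p \<in> proj_points n. \<forall>v\<in>p. f v \<noteq> 0} | d f. hom_poly n d f}
      in \<lparr> fs_top = T,
           fs_reg = (\<lambda>U. {\<phi>. \<forall>p\<in>U. \<exists>W. openin T W \<and> p \<in> W \<and> W \<subseteq> U \<and>
                       (\<exists>d f g. hom_poly n d f \<and> hom_poly n d g \<and>
                          (\<forall>q\<in>W. \<forall>v\<in>q. g v \<noteq> 0 \<and> \<phi> q = f v / g v))}) \<rparr>)"

lemma pts_proj_space: "pts (proj_space n) = (proj_points n :: 'k::field vec set set)"
proof -
  have "proj_points n \<in> {{p \<in> proj_points n. \<forall>v\<in>p. f v \<noteq> (0::'k)} | d f. hom_poly n d f}"
    by (rule CollectI, rule exI[of _ 0], rule exI[of _ "\<lambda>_. 1"]) (auto intro: hom_poly.const)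
  thus ?thesis
    by (auto simp: proj_space_def Let_def)
qed


section \<open>Varieties and complete curves\<close>

definition irreducible_in :: "'p topology \<Rightarrow> 'p set \<Rightarrow> bool" where
  "irreducible_in T Z \<longleftrightarrow> Z \<noteq> {} \<and> Z \<subseteq> topspace T \<and>
     (\<forall>A B. closedin T A \<and> closedin T B \<and> Z \<subseteq> A \<union> B \<longrightarrow> Z \<subseteq> A \<or> Z \<subseteq> B)"

text \<open>Krull dimension is at least \<open>l\<close>.\<close>

definition has_chain :: "'p topology \<Rightarrow> nat \<Rightarrow> bool" where
  "has_chain T l \<longleftrightarrow>
     (\<exists>Z. (\<forall>i\<le>l. closedin T (Z i) \<and> irreducible_in T (Z i)) \<and> (\<forall>i<l. Z i \<subset> Z (Suc i)))"

definition affine_variety :: "('p, 'k::field) fun_space \<Rightarrow> bool" where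
  "affine_variety X \<longleftrightarrow>
     (\<exists>N Z. closedin (fs_top (affine_space N)) Z \<and> fs_isomorphic X (induced (affine_space N) Z))"

definition prevariety :: "('p, 'k::field) fun_space \<Rightarrow> bool" where
  "prevariety X \<longleftrightarrow>
     (\<exists>\<U>. finite \<U> \<and> \<Union>\<U> = pts X \<and>
        (\<forall>U\<in>\<U>. openin (fs_top X) U \<and> affine_variety (induced X U)))"

text \<open>A prevariety is separated iff two morphisms into it agree on a closed set; by locality it
  is enough to consider morphisms from closed subsets of affine spaces.\<close>

definition separated :: "('p, 'k::field) fun_space \<Rightarrow> bool" where
  "separated X \<longleftrightarrow>
     (\<forall>N Z f g. closedin (fs_top (affine_space N)) Z \<and>
        fs_morphism (induced (affine_space N) Z) X f \<and>
        fs_morphism (induced (affine_space N) Z) X g \<longrightarrow>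
        closedin (fs_top (affine_space N)) {z \<in> Z. f z = g z})"

definition variety :: "('p, 'k::field) fun_space \<Rightarrow> bool" where
  "variety X \<longleftrightarrow> prevariety X \<and> separated X \<and> irreducible_in (fs_top X) (pts X)"

text \<open>The Zariski topology of the product of \<open>X\<close> with affine \<open>N\<close>-space, which is finer than the
  product topology.\<close>

definition prod_affine_top :: "('p, 'k::field) fun_space \<Rightarrow> nat \<Rightarrow> ('p \<times> 'k vec) topology" where
  "prod_affine_top X N =
     topology_generated_by
       {{(x, v). x \<in> U \<and> v \<in> carrier_vec N \<and> F (x, v) \<noteq> 0} | U F.
          openin (fs_top X) U \<and>
          F \<in> fun_algebra ({\<lambda>(x, v). f x | f. f \<in> fs_reg X U} \<union> {\<lambda>(x, v). v $ i | i. i < N})}"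

text \<open>Completeness: \<open>X \<times> Y \<rightarrow> Y\<close> is closed for every \<open>Y\<close>. Closedness is local on \<open>Y\<close> and passes to
  closed subsets of \<open>Y\<close>, so affine spaces \<open>Y\<close> suffice.\<close>

definition complete_space :: "('p, 'k::field) fun_space \<Rightarrow> bool" where
  "complete_space X \<longleftrightarrow>
     (\<forall>N Z. closedin (prod_affine_top X N) Z \<longrightarrow> closedin (fs_top (affine_space N)) (snd ` Z))"

definition complete_curve :: "('p, 'k::field) fun_space \<Rightarrow> bool" where
  "complete_curve X \<longleftrightarrow> variety X \<and> complete_space X \<and>
     has_chain (fs_top X) 1 \<and> \<not> has_chain (fs_top X) 2"

definition projective_variety :: "nat \<Rightarrow> 'k::field vec set set \<Rightarrow> bool" where
  "projective_variety n X \<longleftrightarrow>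
     closedin (fs_top (proj_space n)) X \<and> irreducible_in (fs_top (proj_space n)) X"


section \<open>Function fields, normality and ramification\<close>

text \<open>A rational function on an irreducible \<open>X\<close> is the class of all pairs \<open>(V, g)\<close>, with \<open>g\<close>
  regular on the nonempty open set \<open>V\<close>, that agree with a given one where both are defined.\<close>

definition rat_fun ::
    "('p, 'k) fun_space \<Rightarrow> 'p set \<Rightarrow> ('p \<Rightarrow> 'k) \<Rightarrow> ('p set \<times> ('p \<Rightarrow> 'k)) set" where
  "rat_fun X U f =
     {(V, g). openin (fs_top X) V \<and> V \<noteq> {} \<and> g \<in> fs_reg X V \<and> (\<forall>x\<in>U \<inter> V. f x = g x)}"

definition function_field ::
    "('p, 'k::field) fun_space \<Rightarrow> ('p set \<times> ('p \<Rightarrow> 'k)) set ring" where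
  "function_field X =
     \<lparr> carrier = {rat_fun X U f | U f. openin (fs_top X) U \<and> U \<noteq> {} \<and> f \<in> fs_reg X U},
       monoid.mult = (\<lambda>a b. {(W, h). openin (fs_top X) W \<and> W \<noteq> {} \<and> h \<in> fs_reg X W \<and>
          (\<exists>(U, f)\<in>a. \<exists>(V, g)\<in>b. \<forall>x\<in>W \<inter> U \<inter> V. h x = f x * g x)}),
       one = rat_fun X (pts X) (\<lambda>_. 1),
       zero = rat_fun X (pts X) (\<lambda>_. 0),
       add = (\<lambda>a b. {(W, h). openin (fs_top X) W \<and> W \<noteq> {} \<and> h \<in> fs_reg X W \<and>
          (\<exists>(U, f)\<in>a. \<exists>(V, g)\<in>b. \<forall>x\<in>W \<inter> U \<inter> V. h x = f x + g x)}) \<rparr>"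

text \<open>The local ring at \<open>x\<close> as a subring of the function field, and its maximal ideal.\<close>

definition local_ring :: "('p, 'k) fun_space \<Rightarrow> 'p \<Rightarrow> ('p set \<times> ('p \<Rightarrow> 'k)) set set" where
  "local_ring X x = {rat_fun X U f | U f. openin (fs_top X) U \<and> x \<in> U \<and> f \<in> fs_reg X U}"

definition max_ideal :: "('p, 'k::zero) fun_space \<Rightarrow> 'p \<Rightarrow> ('p set \<times> ('p \<Rightarrow> 'k)) set set" where
  "max_ideal X x =
     {rat_fun X U f | U f. openin (fs_top X) U \<and> x \<in> U \<and> f \<in> fs_reg X U \<and> f x = 0}"

definition integral_over :: "('a, 'b) ring_scheme \<Rightarrow> 'a set \<Rightarrow> 'a \<Rightarrow> bool" where
  "integral_over R A z \<longleftrightarrow>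
     (\<exists>N a. (\<forall>i<N. a i \<in> A) \<and>
        z [^]\<^bsub>R\<^esub> (N::nat) \<oplus>\<^bsub>R\<^esub> (\<Oplus>\<^bsub>R\<^esub>i\<in>{..<N}. a i \<otimes>\<^bsub>R\<^esub> z [^]\<^bsub>R\<^esub> i) = \<zero>\<^bsub>R\<^esub>)"

definition normalized_local_ring ::
    "('p, 'k::field) fun_space \<Rightarrow> 'p \<Rightarrow> ('p set \<times> ('p \<Rightarrow> 'k)) set set" where
  "normalized_local_ring X x =
     {z \<in> carrier (function_field X). integral_over (function_field X) (local_ring X x) z}"

definition normal_variety :: "('p, 'k::field) fun_space \<Rightarrow> bool" where
  "normal_variety X \<longleftrightarrow> (\<forall>x\<in>pts X. normalized_local_ring X x = local_ring X x)"

definition pullback ::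
    "('p, 'k) fun_space \<Rightarrow> ('p \<Rightarrow> 'q) \<Rightarrow>
     ('q set \<times> ('q \<Rightarrow> 'k)) set \<Rightarrow> ('p set \<times> ('p \<Rightarrow> 'k)) set" where
  "pullback X f a =
     {(W, h). openin (fs_top X) W \<and> W \<noteq> {} \<and> h \<in> fs_reg X W \<and>
        (\<exists>(V, g)\<in>a. \<forall>x\<in>W. f x \<in> V \<longrightarrow> h x = g (f x))}"

definition map_has_degree ::
    "('p, 'k::field) fun_space \<Rightarrow> ('q, 'k) fun_space \<Rightarrow> ('p \<Rightarrow> 'q) \<Rightarrow> nat \<Rightarrow> bool" where
  "map_has_degree X Y f m \<longleftrightarrow>
     ring.dimension (function_field X) m
       (pullback X f ` carrier (function_field Y)) (carrier (function_field X))"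

text \<open>Ramification of a dominant map \<open>f : X \<rightarrow> Y\<close> of curves, where \<open>X\<close> or \<open>Y\<close> is normal.
  If \<open>Y\<close> is normal then \<open>normalized_local_ring Y (f x)\<close> is the local ring of \<open>Y\<close> at \<open>f x\<close>, and the
  condition is the usual one that its maximal ideal does not generate the maximal ideal at \<open>x\<close>.
  If \<open>X\<close> is normal then \<open>f\<close> factors through the normalization of \<open>Y\<close>, and the condition
  is that the map from \<open>X\<close> to the normalization of \<open>Y\<close> has ramification index greater than 1 at \<open>x\<close>.
  (Residue field extensions are trivial, the ground field being algebraically closed.)
  With the local ring of a non-normal \<open>Y\<close> instead, the normalization map of a cuspidal curve would
  count as ramified over the cusp.\<close>

definition ramified_at ::
    "('p, 'k::field) fun_space \<Rightarrow> ('q, 'k) fun_space \<Rightarrow> ('p \<Rightarrow> 'q) \<Rightarrow> 'p \<Rightarrow> bool" where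
  "ramified_at X Y f x \<longleftrightarrow>
     Idl\<^bsub>(function_field X)\<lparr>carrier := local_ring X x\<rparr>\<^esub>
       (pullback X f ` normalized_local_ring Y (f x) \<inter> max_ideal X x)
     \<noteq> max_ideal X x"


section \<open>Linear algebraic groups and stability\<close>

definition GL :: "nat \<Rightarrow> 'k::field mat monoid" where
  "GL r = \<lparr> carrier = {A \<in> carrier_mat r r. det A \<noteq> 0}, monoid.mult = (*), one = 1\<^sub>m r \<rparr>"

definition GL_functions :: "nat \<Rightarrow> ('k::field mat \<Rightarrow> 'k) set" where
  "GL_functions r =
     fun_algebra ({\<lambda>A. A $$ (i, j) | i j. i < r \<and> j < r} \<union> {\<lambda>A. inverse (det A)})"

definition linear_algebraic_group :: "nat \<Rightarrow> 'k::field mat set \<Rightarrow> bool" where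
  "linear_algebraic_group r G \<longleftrightarrow> subgroup G (GL r) \<and>
     (\<exists>F \<subseteq> GL_functions r. G = {A \<in> carrier (GL r). \<forall>f\<in>F. f A = 0})"

definition rational_rep ::
    "nat \<Rightarrow> 'k::field mat set \<Rightarrow> nat \<Rightarrow> ('k mat \<Rightarrow> 'k mat) \<Rightarrow> bool" where
  "rational_rep r G N \<rho> \<longleftrightarrow> \<rho> \<in> hom ((GL r)\<lparr>carrier := G\<rparr>) (GL N) \<and>
     (\<forall>i<N. \<forall>j<N. \<exists>f\<in>GL_functions r. \<forall>g\<in>G. \<rho> g $$ (i, j) = f g)"

definition geometrically_reductive :: "nat \<Rightarrow> 'k::field mat set \<Rightarrow> bool" where
  "geometrically_reductive r G \<longleftrightarrow>
     (\<forall>N \<rho> w. rational_rep r G N \<rho> \<and> w \<in> carrier_vec N \<and> w \<noteq> 0\<^sub>v N \<and> (\<forall>g\<in>G. \<rho> g *\<^sub>v w = w) \<longrightarrow>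
        (\<exists>d F. d > 0 \<and> hom_poly N d F \<and>
           (\<forall>g\<in>G. \<forall>v\<in>carrier_vec N. F (\<rho> g *\<^sub>v v) = F v) \<and> F w \<noteq> 0))"

text \<open>Only the values of \<open>l\<close> at nonzero arguments matter.\<close>

definition one_parameter_subgroup ::
    "nat \<Rightarrow> 'k::field mat set \<Rightarrow> ('k \<Rightarrow> 'k mat) \<Rightarrow> bool" where
  "one_parameter_subgroup r G l \<longleftrightarrow>
     (\<forall>t. t \<noteq> 0 \<longrightarrow> l t \<in> G) \<and>
     (\<forall>s t. s \<noteq> 0 \<and> t \<noteq> 0 \<longrightarrow> l (s * t) = l s * l t) \<and>
     (\<forall>i<r. \<forall>j<r. \<exists>f\<in>fun_algebra {\<lambda>t. t, inverse}. \<forall>t. t \<noteq> 0 \<longrightarrow> l t $$ (i, j) = f t)"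

text \<open>\<open>v\<close> is the sum of the vectors \<open>c i\<close>, where \<open>c i\<close> has weight \<open>i\<close> under the
  one-parameter group \<open>a\<close> of matrices.\<close>

definition weight_decomposition ::
    "nat \<Rightarrow> ('k::field \<Rightarrow> 'k mat) \<Rightarrow> 'k vec \<Rightarrow> (int \<Rightarrow> 'k vec) \<Rightarrow> bool" where
  "weight_decomposition n a v c \<longleftrightarrow>
     (\<forall>i. c i \<in> carrier_vec n \<and> (\<forall>t. t \<noteq> 0 \<longrightarrow> a t *\<^sub>v c i = (t powi i) \<cdot>\<^sub>v c i)) \<and>
     finite {i. c i \<noteq> 0\<^sub>v n} \<and>
     (\<forall>j<n. v $ j = (\<Sum>i | c i \<noteq> 0\<^sub>v n. c i $ j))"

text \<open>The trivial one-parameter subgroup, all of whose weights are zero, has to be excluded.\<close>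

definition stable ::
    "nat \<Rightarrow> 'k::field mat set \<Rightarrow> nat \<Rightarrow> ('k mat \<Rightarrow> 'k mat) \<Rightarrow> 'k vec set \<Rightarrow> bool" where
  "stable r G n \<rho> x \<longleftrightarrow>
     (\<forall>l. one_parameter_subgroup r G l \<and> (\<exists>t. t \<noteq> 0 \<and> l t \<noteq> 1\<^sub>m r) \<longrightarrow>
        (\<forall>v\<in>x. \<exists>c. weight_decomposition n (\<lambda>t. \<rho> (l t)) v c \<and>
           (\<exists>i<0. c i \<noteq> 0\<^sub>v n) \<and> (\<exists>i>0. c i \<noteq> 0\<^sub>v n)))"

definition stable_locus ::
    "nat \<Rightarrow> 'k::field mat set \<Rightarrow> nat \<Rightarrow> ('k mat \<Rightarrow> 'k mat) \<Rightarrow> 'k vec set set \<Rightarrow> 'k vec set set"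
  where "stable_locus r G n \<rho> X = {x \<in> X. stable r G n \<rho> x}"

definition act :: "('k::field mat \<Rightarrow> 'k mat) \<Rightarrow> 'k mat \<Rightarrow> 'k vec set \<Rightarrow> 'k vec set" where
  "act \<rho> g x = (\<lambda>v. \<rho> g *\<^sub>v v) ` x"

definition orbit :: "'k::field mat set \<Rightarrow> ('k mat \<Rightarrow> 'k mat) \<Rightarrow> 'k vec set \<Rightarrow> 'k vec set set" where
  "orbit G \<rho> x = (\<lambda>g. act \<rho> g x) ` G"

definition stabilizer :: "'k::field mat set \<Rightarrow> ('k mat \<Rightarrow> 'k mat) \<Rightarrow> 'k vec set \<Rightarrow> 'k mat set" where
  "stabilizer G \<rho> x = {g \<in> G. act \<rho> g x = x}"

definition stable_quotient ::
    "nat \<Rightarrow> 'k::field mat set \<Rightarrow> nat \<Rightarrow> ('k mat \<Rightarrow> 'k mat) \<Rightarrow> 'k vec set set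
       \<Rightarrow> ('k vec set set, 'k) fun_space" where
  "stable_quotient r G n \<rho> X =
     quotient_space (induced (proj_space n) (stable_locus r G n \<rho> X)) (orbit G \<rho>)"

definition generically :: "('p, 'k) fun_space \<Rightarrow> ('p \<Rightarrow> bool) \<Rightarrow> bool" where
  "generically X P \<longleftrightarrow> (\<exists>U. openin (fs_top X) U \<and> U \<noteq> {} \<and> (\<forall>x\<in>U. P x))"

end

theory Submission
  imports Defs "HOL-Library.Function_Algebras"
begin

text \<open>
  Stabilizers of points of \<open>D\<close> lie in \<open>S\<close>, and generically they equal the kernel \<open>K\<close> of the action
  of \<open>S\<close> on \<open>D\<close>. So \<open>K\<close> has order \<open>h\<close>, and the claim is that \<open>D \<rightarrow> C\<close> is ramified at \<open>x\<close> iff the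
  stabilizer of \<open>x\<close> is larger than \<open>K\<close>. The degree hypothesis makes \<open>k(C)\<close> the field of
  \<open>S\<close>-invariants of \<open>k(D)\<close>.

  If \<open>g\<close> fixes \<open>x\<close> and the maximal ideal \<open>m\<close> at \<open>x\<close> is generated by invariants, then the ideal
  generated by all \<open>f \<circ> g - f\<close> is contained in its product with \<open>m\<close>, so it is zero by Nakayama
  and \<open>g\<close> acts trivially. Conversely, if the stabilizer of \<open>x\<close> is \<open>K\<close>, then traces of functions
  that vanish to second order on the rest of the orbit of \<open>x\<close> give invariants that generate \<open>m\<close>
  modulo \<open>m\<^sup>2\<close>, hence generate \<open>m\<close>. That such invariants are integral over the local ring of \<open>C\<close>
  follows from the completeness of \<open>D\<close> and the separatedness of \<open>C\<close>, tested on places of \<open>k(D)\<close>.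
\<close>

section \<open>Extension of homomorphisms to places\<close>

text \<open>Ramification is measured against the normalization of the local ring of
  \<open>C\<close>, so an invariant has to be shown integral over that ring, not regular on
  \<open>C\<close>. As \<open>C\<close> is known only through its quotient structure, integrality is
  obtained from a valuative criterion: if \<open>\<zeta>\<close> is not integral, evaluation at the
  point of \<open>C\<close> extends to a place that sends \<open>1/\<zeta>\<close> to 0. Taking
  residues in \<open>k\<close> itself, which is algebraically closed, lets a place be a partial map
  to \<open>k\<close> without an ordered value group. The maximal ideal is treated through affine
  coordinates and never through a uniformizer, since the local ring of \<open>D\<close> may fail to
  be a discrete valuation ring. Rational functions stay total functions, compared on the filter
  generated by the nonempty open sets; identities in the function field thereby become pointwise
  identities that hold generically.\<close>

text \<open>A nonzero element of least degree divides all others, so if it were nonconstant, a root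
  of it would be common to all. This Nullstellensatz in one variable later turns an obstruction at
  every possible value into a polynomial relation.\<close>

lemma ideal_without_root:
  fixes J :: "'k::alg_closed_field poly set"
  assumes add: "\<And>p q. p \<in> J \<Longrightarrow> q \<in> J \<Longrightarrow> p + q \<in> J"
    and mult: "\<And>p q. p \<in> J \<Longrightarrow> q * p \<in> J"
    and noroot: "\<And>a. \<exists>p\<in>J. poly p a \<noteq> 0"
  shows "1 \<in> J"
proof -
  obtain p0 where "p0 \<in> J" "poly p0 0 \<noteq> 0" using noroot by blast
  hence "p0 \<in> J \<and> p0 \<noteq> 0" by auto
  then obtain p where p: "p \<in> J" "p \<noteq> 0"
    and min: "\<And>q. q \<in> J \<Longrightarrow> q \<noteq> 0 \<Longrightarrow> degree p \<le> degree q"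
    using ex_has_least_nat[of "\<lambda>p. p \<in> J \<and> p \<noteq> 0" p0 degree] by blast
  have dvd: "p dvd q" if "q \<in> J" for q
  proof -
    have "q mod p = q + (- (q div p)) * p"
      by (simp add: minus_div_mult_eq_mod[symmetric])
    hence "q mod p \<in> J" using add[OF that mult[OF p(1)]] by metis
    hence "q mod p = 0" using min[of "q mod p"] degree_mod_less[OF p(2), of q] by fastforce
    thus ?thesis by auto
  qed
  have "degree p = 0"
  proof (rule ccontr)
    assume "degree p \<noteq> 0"
    then obtain a where a: "poly p a = 0" using alg_closed_imp_poly_has_root by blast
    obtain q where "q \<in> J" "poly q a \<noteq> 0" using noroot by blast
    with a dvd[of q] show False by (auto elim!: dvdE)
  qed
  then obtain c where c: "p = [:c:]" "c \<noteq> 0" using p(2) by (metis degree_eq_zeroE pCons_eq_0_iff)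
  have "[:1/c:] * p \<in> J" using mult p(1) by blast
  thus ?thesis using c by (simp add: one_pCons)
qed

text \<open>\<open>E / P\<close> is a field, and \<open>v\<close> is an auxiliary value, unrelated to \<open>P\<close>, carried along with the
  elements of \<open>E\<close>. A valid \<open>\<Gamma>\<close> is then the graph of a ring homomorphism to \<open>'k\<close> from a subring of
  \<open>E / P\<close>.\<close>

locale residue_setting =
  fixes E P :: "'a::comm_ring_1 set" and v :: "'a \<Rightarrow> 'k::alg_closed_field"
  assumes E_1: "1 \<in> E"
    and E_diff: "x \<in> E \<Longrightarrow> y \<in> E \<Longrightarrow> x - y \<in> E"
    and E_mult: "x \<in> E \<Longrightarrow> y \<in> E \<Longrightarrow> x * y \<in> E"
    and P_sub: "P \<subseteq> E"
    and P_0: "0 \<in> P"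
    and P_add: "x \<in> P \<Longrightarrow> y \<in> P \<Longrightarrow> x + y \<in> P"
    and P_mult: "x \<in> E \<Longrightarrow> y \<in> P \<Longrightarrow> x * y \<in> P"
    and P_inv: "x \<in> E \<Longrightarrow> x \<notin> P \<Longrightarrow> \<exists>y\<in>E. x * y - 1 \<in> P"
    and v_1: "v 1 = 1"
    and v_add: "v (x + y) = v x + v y"
    and v_mult: "v (x * y) = v x * v y"
    and v_lift: "x \<in> E \<Longrightarrow> \<exists>x'\<in>E. x' - x \<in> P \<and> v x' = c"
begin

definition valid :: "'a set \<Rightarrow> bool" where
  "valid \<Gamma> \<longleftrightarrow> 1 \<in> \<Gamma> \<and> (\<forall>x\<in>\<Gamma>. \<forall>y\<in>\<Gamma>. x - y \<in> \<Gamma> \<and> x * y \<in> \<Gamma>) \<and> \<Gamma> \<subseteq> E \<and> (\<forall>x\<in>\<Gamma> \<inter> P. v x = 0)"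

definition polys :: "'a set \<Rightarrow> 'a poly set" where
  "polys \<Gamma> = {p. \<forall>i. coeff p i \<in> \<Gamma>}"

section \<open>Arithmetic of residues, valid subrings and polynomials modulo
  \<open>P\<close>\<close>

lemma v_0: "v 0 = 0"
  using v_add[of 0 0] by (metis add.right_neutral add_cancel_right_right)

lemma v_diff: "v (x - y) = v x - v y"
  using v_add[of "x - y" y] by simp

lemma v_sum: "v (\<Sum>i\<in>A. f i) = (\<Sum>i\<in>A. v (f i))"
  by (induction A rule: infinite_finite_induct) (auto simp: v_0 v_add)

lemma v_poly: "v (poly p x) = poly (map_poly v p) (v x)"
  by (induction p) (auto simp: v_0 v_add v_mult map_poly_pCons)

lemma validD:
  assumes "valid \<Gamma>"
  shows "1 \<in> \<Gamma>" "0 \<in> \<Gamma>" "\<Gamma> \<subseteq> E" "x \<in> \<Gamma> \<Longrightarrow> x \<in> P \<Longrightarrow> v x = 0"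
    "x \<in> \<Gamma> \<Longrightarrow> y \<in> \<Gamma> \<Longrightarrow> x - y \<in> \<Gamma>" "x \<in> \<Gamma> \<Longrightarrow> y \<in> \<Gamma> \<Longrightarrow> x * y \<in> \<Gamma>"
    "x \<in> \<Gamma> \<Longrightarrow> - x \<in> \<Gamma>" "x \<in> \<Gamma> \<Longrightarrow> y \<in> \<Gamma> \<Longrightarrow> x + y \<in> \<Gamma>"
proof -
  have d: "x - y \<in> \<Gamma>" if "x \<in> \<Gamma>" "y \<in> \<Gamma>" for x y using assms that by (auto simp: valid_def)
  have one: "1 \<in> \<Gamma>" using assms by (auto simp: valid_def)
  have z: "0 \<in> \<Gamma>" using d[OF one one] by simp
  have n: "- x \<in> \<Gamma>" if "x \<in> \<Gamma>" for x using d[OF z that] by simp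
  have "x + y \<in> \<Gamma>" if "x \<in> \<Gamma>" "y \<in> \<Gamma>" for x y using d[OF that(1) n[OF that(2)]] by simp
  thus "x \<in> \<Gamma> \<Longrightarrow> y \<in> \<Gamma> \<Longrightarrow> x + y \<in> \<Gamma>" by blast
  show "1 \<in> \<Gamma>" "0 \<in> \<Gamma>" "\<Gamma> \<subseteq> E" "x \<in> \<Gamma> \<Longrightarrow> x \<in> P \<Longrightarrow> v x = 0"
    "x \<in> \<Gamma> \<Longrightarrow> y \<in> \<Gamma> \<Longrightarrow> x - y \<in> \<Gamma>" "x \<in> \<Gamma> \<Longrightarrow> y \<in> \<Gamma> \<Longrightarrow> x * y \<in> \<Gamma>"
    "x \<in> \<Gamma> \<Longrightarrow> - x \<in> \<Gamma>"
    using assms one z n by (auto simp: valid_def)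
qed

lemma valid_sum:
  assumes "valid \<Gamma>" "\<And>i. i \<in> A \<Longrightarrow> f i \<in> \<Gamma>"
  shows "(\<Sum>i\<in>A. f i) \<in> \<Gamma>"
  using assms(2) by (induction A rule: infinite_finite_induct) (auto simp: validD[OF assms(1)])

lemma E_0: "0 \<in> E"
  using E_diff[OF E_1 E_1] by simp

lemma E_add: "x \<in> E \<Longrightarrow> y \<in> E \<Longrightarrow> x + y \<in> E"
  using E_diff[of x "0 - y"] E_diff[OF E_0] by simp

lemma E_power: "x \<in> E \<Longrightarrow> x ^ n \<in> E"
  by (induction n) (auto simp: E_1 E_mult)

lemma P_uminus: "x \<in> P \<Longrightarrow> - x \<in> P"
  using P_mult[of "0 - 1" x] E_diff[OF E_0 E_1] by simp

lemma P_diff: "x \<in> P \<Longrightarrow> y \<in> P \<Longrightarrow> x - y \<in> P"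
  using P_add[of x "- y"] P_uminus[of y] by simp

lemma P_cong: "x - y \<in> P \<Longrightarrow> x \<in> P \<longleftrightarrow> y \<in> P"
  using P_diff[of x "x - y"] P_add[of "x - y" y] by auto

lemma P_cong_power: "x \<in> E \<Longrightarrow> y \<in> E \<Longrightarrow> x - y \<in> P \<Longrightarrow> x ^ n - y ^ n \<in> P"
proof (induction n)
  case (Suc n)
  have "x ^ Suc n - y ^ Suc n = x * (x ^ n - y ^ n) + y ^ n * (x - y)"
    by (simp add: algebra_simps)
  thus ?case using Suc by (auto intro!: P_add P_mult E_power)
qed (simp add: P_0)

lemma P_sum: "(\<And>i. i \<in> A \<Longrightarrow> f i \<in> P) \<Longrightarrow> (\<Sum>i\<in>A. f i) \<in> P"
  by (induction A rule: infinite_finite_induct) (auto simp: P_0 P_add)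

lemma polysD: "p \<in> polys \<Gamma> \<Longrightarrow> coeff p i \<in> \<Gamma>"
  by (simp add: polys_def)

lemma polys_pCons: "pCons a p \<in> polys \<Gamma> \<longleftrightarrow> a \<in> \<Gamma> \<and> p \<in> polys \<Gamma>"
  unfolding polys_def by (force simp: coeff_pCons split: nat.splits)

lemma polys_mono: "\<Gamma> \<subseteq> \<Delta> \<Longrightarrow> polys \<Gamma> \<subseteq> polys \<Delta>"
  by (auto simp: polys_def)

lemma poly_in_E: "p \<in> polys E \<Longrightarrow> x \<in> E \<Longrightarrow> poly p x \<in> E"
  by (induction p) (auto simp: polys_pCons E_add E_mult E_0)

lemma poly_cong: "p \<in> polys E \<Longrightarrow> x \<in> E \<Longrightarrow> y \<in> E \<Longrightarrow> x - y \<in> P \<Longrightarrow> poly p x - poly p y \<in> P"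
proof (induction p)
  case (pCons a p)
  have "poly (pCons a p) x - poly (pCons a p) y = x * (poly p x - poly p y) + poly p y * (x - y)"
    by (simp add: algebra_simps)
  moreover have "p \<in> polys E" using pCons.prems by (simp add: polys_pCons)
  ultimately show ?case using pCons by (auto intro!: P_add P_mult poly_in_E)
qed (simp add: P_0)

lemma polys_ring:
  assumes "valid \<Gamma>" "p \<in> polys \<Gamma>" "q \<in> polys \<Gamma>"
  shows "p + q \<in> polys \<Gamma>" "p - q \<in> polys \<Gamma>" "p * q \<in> polys \<Gamma>"
  using assms(2,3)
  by (auto simp: polys_def coeff_mult intro!: valid_sum[OF assms(1)] validD[OF assms(1)])

lemma polys_monom: "valid \<Gamma> \<Longrightarrow> a \<in> \<Gamma> \<Longrightarrow> monom a n \<in> polys \<Gamma>"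
  by (auto simp: polys_def validD)

lemma polys_const: "valid \<Gamma> \<Longrightarrow> a \<in> \<Gamma> \<Longrightarrow> [:a:] \<in> polys \<Gamma>"
  using polys_monom[of \<Gamma> a 0] by (simp add: monom_0)

text \<open>This is the ring \<open>\<Gamma>[x]\<close> inside \<open>E\<close>. The condition on
  \<open>p\<close> is precisely that the residue of a value \<open>p(x)\<close> depends only on its
  class modulo \<open>P\<close>.\<close>

lemma valid_extension:
  assumes "valid \<Gamma>" "x \<in> E"
    and "\<And>p. p \<in> polys \<Gamma> \<Longrightarrow> poly p x \<in> P \<Longrightarrow> v (poly p x) = 0"
  shows "valid ((\<lambda>p. poly p x) ` polys \<Gamma>)" "\<Gamma> \<subseteq> (\<lambda>p. poly p x) ` polys \<Gamma>"
    "x \<in> (\<lambda>p. poly p x) ` polys \<Gamma>"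
proof -
  note v = validD[OF assms(1)]
  have c: "a \<in> (\<lambda>p. poly p x) ` polys \<Gamma>" if "a \<in> \<Gamma>" for a
    using polys_const[OF assms(1) that] by (intro image_eqI[of _ _ "[:a:]"]) auto
  thus "\<Gamma> \<subseteq> (\<lambda>p. poly p x) ` polys \<Gamma>" by blast
  have "[:0, 1:] \<in> polys \<Gamma>" using v by (auto simp: polys_pCons) (simp add: polys_def)
  thus "x \<in> (\<lambda>p. poly p x) ` polys \<Gamma>" by (intro image_eqI[of _ _ "[:0,1:]"]) auto
  have "polys \<Gamma> \<subseteq> polys E" using v by (intro polys_mono)
  moreover have "poly p x - poly q x \<in> (\<lambda>p. poly p x) ` polys \<Gamma> \<and>
     poly p x * poly q x \<in> (\<lambda>p. poly p x) ` polys \<Gamma>" if "p \<in> polys \<Gamma>" "q \<in> polys \<Gamma>" for p q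
    using polys_ring[OF assms(1) that]
    by (metis (no_types, lifting) image_eqI poly_diff poly_mult)
  ultimately show "valid ((\<lambda>p. poly p x) ` polys \<Gamma>)"
    unfolding valid_def using assms(2,3) c[OF v(1)] by (auto intro: poly_in_E)
qed

text \<open>Multiplying \<open>q(y)\<close> by \<open>x^n\<close> and using \<open>x y = 1\<close>
  modulo \<open>P\<close> reverses the coefficients. The number \<open>n\<close> only has to bound
  the degree; a larger one pads the reversed polynomial with low zeros.\<close>

lemma reversed_relation:
  assumes "valid \<Gamma>" "q \<in> polys \<Gamma>" "degree q \<le> n" "x \<in> E" "y \<in> E" "x * y - 1 \<in> P" "poly q y \<in> P"
  defines "q' \<equiv> (\<Sum>i\<le>n. monom (coeff q i) (n - i))"
  shows "q' \<in> polys \<Gamma>" "poly q' x \<in> P" "coeff q' i = (if i \<le> n then coeff q (n - i) else 0)"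
proof -
  note v = validD[OF assms(1)]
  have cE: "coeff q i \<in> E" for i using v(3) polysD[OF assms(2)] by blast
  show c: "coeff q' i = (if i \<le> n then coeff q (n - i) else 0)" for i
  proof -
    have "coeff q' i = (\<Sum>j\<le>n. if j = n - i \<and> i \<le> n then coeff q j else 0)"
      unfolding q'_def coeff_sum by (intro sum.cong) auto
    also have "\<dots> = (if i \<le> n then coeff q (n - i) else 0)"
      by (cases "i \<le> n") auto
    finally show ?thesis .
  qed
  show "q' \<in> polys \<Gamma>" using c v polysD[OF assms(2)] by (auto simp: polys_def)
  have "poly q y = (\<Sum>i\<le>n. coeff q i * y ^ i)"
    unfolding poly_altdef using assms(3) by (intro sum.mono_neutral_left) (auto simp: coeff_eq_0)
  moreover have "x ^ n * (c * y ^ i) = c * x ^ (n - i) * (x * y) ^ i" if "i \<le> n" for c i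
    using that power_add[of x "n - i" i] by (simp add: power_mult_distrib mult_ac)
  ultimately have "x ^ n * poly q y = (\<Sum>i\<le>n. coeff q i * x ^ (n - i) * (x * y) ^ i)"
    by (simp add: sum_distrib_left)
  hence "x ^ n * poly q y - poly q' x = (\<Sum>i\<le>n. (coeff q i * x ^ (n - i)) * ((x * y) ^ i - 1 ^ i))"
    by (simp add: q'_def poly_sum poly_monom algebra_simps sum_subtractf)
  also have "\<dots> \<in> P"
    using assms cE by (intro P_sum P_mult E_mult E_power P_cong_power E_1) auto
  finally have "x ^ n * poly q y - poly q' x \<in> P" .
  moreover have "x ^ n * poly q y \<in> P" using assms by (intro P_mult E_power) auto
  ultimately show "poly q' x \<in> P" using P_cong by blast
qed

text \<open>\<open>map_poly v p = 1\<close> says that the constant coefficient has residue 1 and all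
  others residue 0, so \<open>p(x)\<close> in \<open>P\<close> exhibits 1 in the ideal that the
  elements of residue 0 generate in \<open>\<Gamma>[x]\<close>. This cannot happen for both
  \<open>x\<close> and its inverse, because the longer of the two relations can always be shortened
  by the other.\<close>

lemma no_relations_both:
  assumes "valid \<Gamma>"
  shows "p \<in> polys \<Gamma> \<Longrightarrow> degree p \<le> n \<Longrightarrow> poly p x \<in> P \<Longrightarrow> map_poly v p = 1 \<Longrightarrow>
    q \<in> polys \<Gamma> \<Longrightarrow> degree q \<le> m \<Longrightarrow> poly q y \<in> P \<Longrightarrow> map_poly v q = 1 \<Longrightarrow>
    x \<in> E \<Longrightarrow> y \<in> E \<Longrightarrow> x * y - 1 \<in> P \<Longrightarrow> False"
proof (induction "n + m" arbitrary: n m p q x y rule: less_induct)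
  case less
  \<comment> \<open>Stated for the longer relation in \<open>x\<close>, with all variables free, so
    that it also serves with the roles of \<open>x\<close> and \<open>y\<close> exchanged.\<close>
  have main: False if less': "\<And>n' p'. n' < n \<Longrightarrow> p' \<in> polys \<Gamma> \<Longrightarrow> degree p' \<le> n' \<Longrightarrow>
        poly p' x \<in> P \<Longrightarrow> map_poly v p' = 1 \<Longrightarrow> False"
      and nm: "m \<le> n" and p: "p \<in> polys \<Gamma>" "degree p \<le> n" "poly p x \<in> P" "map_poly v p = 1"
      and q: "q \<in> polys \<Gamma>" "degree q \<le> m" "poly q y \<in> P" "map_poly v q = 1"
      and xy: "x \<in> E" "y \<in> E" "x * y - 1 \<in> P"
    for p q n m x y
  proof -
    have vp: "v (coeff p i) = (if i = 0 then 1 else 0)" for i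
      using p(4) coeff_map_poly[of v p i, OF v_0] by (auto simp: coeff_1)
    have vq: "v (coeff q i) = (if i = 0 then 1 else 0)" for i
      using q(4) coeff_map_poly[of v q i, OF v_0] by (auto simp: coeff_1)
    show False
    proof (cases "n = 0")
      case True
      then obtain a where a: "p = [:a:]" using p(2) by (metis degree_eq_zeroE le_zero_eq)
      thus False using p(3) polysD[OF p(1), of 0] validD(4)[OF assms, of a] vp[of 0] by simp
    next
      case False
      define q' where "q' = (\<Sum>i\<le>n. monom (coeff q i) (n - i))"
      have "degree q \<le> n" using q(2) nm by simp
      note q' = reversed_relation[OF assms q(1) this xy q(3), folded q'_def]
      \<comment> \<open>The coefficient of \<open>q'\<close> at \<open>n\<close> is
        \<open>coeff q 0\<close>, so the terms of degree \<open>n\<close> cancel. Since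
        \<open>coeff p n\<close> has residue 0 and \<open>coeff q 0\<close> has residue 1, the
        residues of \<open>p\<close> survive in \<open>r\<close>.\<close>
      define r where "r = [:coeff q 0:] * p - [:coeff p n:] * q'"
      have r: "coeff r i = coeff q 0 * coeff p i - coeff p n * coeff q' i" for i
        by (simp add: r_def)
      have "r \<in> polys \<Gamma>" unfolding r_def
        by (intro polys_ring[OF assms] polys_const[OF assms] p(1) q'(1) polysD[OF p(1)] polysD[OF q(1)])
      moreover have "degree r \<le> n - 1"
      proof (rule degree_le, intro allI impI)
        fix i assume "n - 1 < i"
        hence "i = n \<or> i > n" by auto
        moreover have "coeff p i = 0" if "i > n" using that p(2) by (simp add: coeff_eq_0)
        ultimately show "coeff r i = 0" unfolding r q'(3) by (auto simp: mult.commute)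
      qed
      moreover have "poly r x \<in> P"
        unfolding r_def using p(3) q'(2) polysD[OF p(1)] polysD[OF q(1)] validD(3)[OF assms]
        by (auto intro!: P_diff P_mult)
      moreover have "map_poly v r = 1"
        by (rule poly_eqI) (auto simp: coeff_map_poly v_0 r v_diff v_mult vp vq False coeff_1)
      moreover have "n - 1 < n" using False by simp
      ultimately show False using less' by blast
    qed
  qed
  have yx: "y * x - 1 \<in> P" using less.prems(11) by (simp add: mult.commute)
  show False
  proof (cases "m \<le> n")
    case True
    show False
    proof (rule main[OF _ True less.prems])
      fix n' p' assume "n' < n" "p' \<in> polys \<Gamma>" "degree p' \<le> n'" "poly p' x \<in> P" "map_poly v p' = 1"
      thus False using less.hyps[OF _ _ _ _ _ less.prems(5-11)] by (meson add_less_mono1)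
    qed
  next
    case False
    show False
    proof (rule main[OF _ _ less.prems(5-8) less.prems(1-4) less.prems(10,9) yx])
      fix n' p' assume "n' < m" "p' \<in> polys \<Gamma>" "degree p' \<le> n'" "poly p' y \<in> P" "map_poly v p' = 1"
      thus False using less.hyps[OF _ less.prems(1-4) _ _ _ _ less.prems(9-11)] by (meson add_less_mono add_strict_left_mono)
    qed (use False in auto)
  qed
qed

text \<open>Chevalley's extension theorem.\<close>

theorem place_exists:
  assumes "valid \<Gamma>0" and const: "\<And>c. \<exists>x\<in>\<Gamma>0. v x = c"
  obtains \<Gamma> where "valid \<Gamma>" "\<Gamma>0 \<subseteq> \<Gamma>"
    "\<And>x y. x \<in> \<Gamma> \<Longrightarrow> v x \<noteq> 0 \<Longrightarrow> y \<in> E \<Longrightarrow> x * y - 1 \<in> P \<Longrightarrow> \<exists>y'\<in>\<Gamma>. y' - y \<in> P"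
    "\<And>x y. x \<in> E \<Longrightarrow> y \<in> E \<Longrightarrow> x * y - 1 \<in> P \<Longrightarrow> (\<exists>x'\<in>\<Gamma>. x' - x \<in> P) \<or> (\<exists>y'\<in>\<Gamma>. y' - y \<in> P)"
proof -
  define \<A> where "\<A> = {\<Gamma>. valid \<Gamma> \<and> \<Gamma>0 \<subseteq> \<Gamma>}"
  have "\<exists>M\<in>\<A>. \<forall>X\<in>\<A>. M \<subseteq> X \<longrightarrow> X = M"
  proof (rule subset_Zorn_nonempty)
    show "\<A> \<noteq> {}" using assms by (auto simp: \<A>_def)
    fix \<C> assume C: "\<C> \<noteq> {}" "subset.chain \<A> \<C>"
    have v: "valid X" "\<Gamma>0 \<subseteq> X" if "X \<in> \<C>" for X
      using C that by (auto simp: \<A>_def subset_chain_def)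
    have ch: "\<exists>Z\<in>\<C>. X \<subseteq> Z \<and> Y \<subseteq> Z" if "X \<in> \<C>" "Y \<in> \<C>" for X Y
      using C that unfolding subset_chain_def by (metis order_refl)
    have "x - y \<in> \<Union>\<C> \<and> x * y \<in> \<Union>\<C>" if xy: "x \<in> \<Union>\<C>" "y \<in> \<Union>\<C>" for x y
    proof -
      obtain X Y where "X \<in> \<C>" "Y \<in> \<C>" "x \<in> X" "y \<in> Y" using xy by blast
      then obtain Z where Z: "Z \<in> \<C>" "x \<in> Z" "y \<in> Z" using ch[of X Y] by blast
      have "x - y \<in> Z" "x * y \<in> Z" using Z validD(5,6)[OF v(1)[OF Z(1)]] by auto
      thus ?thesis using Z(1) by blast
    qed
    moreover have "1 \<in> \<Union>\<C>" using C(1) validD(1)[OF v(1)] by blast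
    moreover have "\<Union>\<C> \<subseteq> E" using validD(3)[OF v(1)] by blast
    moreover have "\<Gamma>0 \<subseteq> \<Union>\<C>" using C(1) v(2) by blast
    moreover have "\<forall>x\<in>\<Union>\<C> \<inter> P. v x = 0" using validD(4)[OF v(1)] by blast
    ultimately show "\<Union>\<C> \<in> \<A>" by (auto simp: \<A>_def valid_def)
  qed
  then obtain \<Gamma> where "\<Gamma> \<in> \<A>" and max': "\<forall>X\<in>\<A>. \<Gamma> \<subseteq> X \<longrightarrow> X = \<Gamma>" by (elim bexE)
  hence \<Gamma>: "valid \<Gamma>" "\<Gamma>0 \<subseteq> \<Gamma>" by (auto simp: \<A>_def)
  have max: "\<Delta> = \<Gamma>" if "valid \<Delta>" "\<Gamma> \<subseteq> \<Delta>" for \<Delta>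
    using max' that \<Gamma>(2) by (auto simp: \<A>_def)
  note val = validD[OF \<Gamma>(1)]
  \<comment> \<open>Adjoining any representative of \<open>x\<close> would enlarge
    \<open>\<Gamma>\<close>, so by maximality each of them violates the extension condition.
    Representatives exist with every auxiliary value \<open>a\<close>; hence the reduced relations
    have no common root, and their ideal contains 1.\<close>
  have relation: "\<exists>p\<in>polys \<Gamma>. poly p x \<in> P \<and> map_poly v p = 1"
    if x: "x \<in> E" "\<not> (\<exists>x'\<in>\<Gamma>. x' - x \<in> P)" for x
  proof -
    define J where "J = {map_poly v p | p. p \<in> polys \<Gamma> \<and> poly p x \<in> P}"
    have "1 \<in> J"
    proof (rule ideal_without_root)
      fix p q assume "p \<in> J" "q \<in> J"
      then obtain p' q' where pq: "p = map_poly v p'" "p' \<in> polys \<Gamma>" "poly p' x \<in> P"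
        "q = map_poly v q'" "q' \<in> polys \<Gamma>" "poly q' x \<in> P" by (auto simp: J_def)
      have "p + q = map_poly v (p' + q')"
        by (rule poly_eqI) (simp add: pq coeff_map_poly v_0 v_add)
      moreover have "p' + q' \<in> polys \<Gamma>" "poly (p' + q') x \<in> P"
        using pq polys_ring(1)[OF \<Gamma>(1)] P_add by auto
      ultimately show "p + q \<in> J" unfolding J_def by blast
    next
      fix p q assume "p \<in> J"
      then obtain p' where p: "p = map_poly v p'" "p' \<in> polys \<Gamma>" "poly p' x \<in> P"
        by (auto simp: J_def)
      obtain l where l: "\<And>c. l c \<in> \<Gamma> \<and> v (l c) = c" using const \<Gamma>(2) by (metis in_mono)
      \<comment> \<open>The coefficient rule for \<open>map_poly\<close> needs a lift that sends 0
        to 0, which an arbitrary choice \<open>l\<close> does not guarantee.\<close>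
      define l0 where "l0 c = (if c = 0 then 0 else l c)" for c
      have l0: "l0 c \<in> \<Gamma>" "v (l0 c) = c" "l0 0 = 0" for c using l val by (auto simp: l0_def v_0)
      define q' where "q' = map_poly l0 q"
      have q': "q' \<in> polys \<Gamma>" by (auto simp: q'_def polys_def coeff_map_poly l0)
      have "q * p = map_poly v (q' * p')"
        by (rule poly_eqI) (simp add: p q'_def coeff_map_poly v_0 coeff_mult v_sum v_mult l0)
      moreover have "poly (q' * p') x \<in> P"
        using p(3) poly_in_E[OF subsetD[OF polys_mono[OF val(3)] q'] x(1)] by (simp add: P_mult)
      ultimately show "q * p \<in> J" unfolding J_def using polys_ring(3)[OF \<Gamma>(1) q' p(2)] by blast
    next
      fix a
      obtain x' where x': "x' \<in> E" "x' - x \<in> P" "v x' = a" using v_lift[OF x(1)] by blast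
      hence "x' \<notin> \<Gamma>" using x(2) by blast
      have "\<exists>p\<in>polys \<Gamma>. poly p x' \<in> P \<and> v (poly p x') \<noteq> 0"
      proof (rule ccontr)
        assume "\<not> ?thesis"
        hence "\<And>p. p \<in> polys \<Gamma> \<Longrightarrow> poly p x' \<in> P \<Longrightarrow> v (poly p x') = 0" by blast
        note ext = valid_extension[OF \<Gamma>(1) x'(1) this]
        show False using ext(3) max[OF ext(1,2)] \<open>x' \<notin> \<Gamma>\<close> by simp
      qed
      then obtain p where p: "p \<in> polys \<Gamma>" "poly p x' \<in> P" "v (poly p x') \<noteq> 0" by blast
      have "p \<in> polys E" using p(1) polys_mono[OF val(3)] by blast
      from poly_cong[OF this x'(1) x(1) x'(2)] have "poly p x \<in> P" using P_cong p(2) by blast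
      thus "\<exists>p\<in>J. poly p a \<noteq> 0" using p x'(3) unfolding J_def v_poly by blast
    qed
    thus ?thesis by (auto simp: J_def)
  qed
  show ?thesis
  proof (rule that[OF \<Gamma>])
    fix x y assume x: "x \<in> \<Gamma>" "v x \<noteq> 0" and y: "y \<in> E" "x * y - 1 \<in> P"
    show "\<exists>y'\<in>\<Gamma>. y' - y \<in> P"
    proof (rule ccontr)
      assume "\<not> ?thesis"
      then obtain q where q: "q \<in> polys \<Gamma>" "poly q y \<in> P" "map_poly v q = 1"
        using relation[OF y(1)] by blast
      have vq: "v (coeff q i) = (if i = 0 then 1 else 0)" for i
        using q(3) coeff_map_poly[of v q i, OF v_0] by (auto simp: coeff_1)
      \<comment> \<open>Reversal moves the coefficient of residue 1 to the top, so
        \<open>poly q' x\<close> has residue \<open>(v x)^n\<close>, which is nonzero. But it lies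
        in both \<open>\<Gamma>\<close> and \<open>P\<close>, so its residue must be 0.\<close>
      define n q' where "n = degree q" and "q' = (\<Sum>i\<le>n. monom (coeff q i) (n - i))"
      have xE: "x \<in> E" using x val by blast
      have "degree q \<le> n" by (simp add: n_def)
      note q' = reversed_relation[OF \<Gamma>(1) q(1) this xE y q(2), folded q'_def]
      have "x ^ i \<in> \<Gamma>" for i by (induction i) (auto simp: val x(1))
      hence "poly q' x \<in> \<Gamma>" unfolding poly_altdef
        by (intro valid_sum[OF \<Gamma>(1)] val(6) polysD[OF q'(1)])
      hence "v (poly q' x) = 0" using q'(2) val(4) by blast
      moreover have "map_poly v q' = monom 1 n"
        by (rule poly_eqI) (auto simp: coeff_map_poly v_0 q'(3) vq)
      ultimately show False using x(2) by (simp add: v_poly poly_monom)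
    qed
  next
    fix x y assume xy: "x \<in> E" "y \<in> E" "x * y - 1 \<in> P"
    show "(\<exists>x'\<in>\<Gamma>. x' - x \<in> P) \<or> (\<exists>y'\<in>\<Gamma>. y' - y \<in> P)"
    proof (rule ccontr)
      assume "\<not> ?thesis"
      then obtain p q where p: "p \<in> polys \<Gamma>" "poly p x \<in> P" "map_poly v p = 1"
        and q: "q \<in> polys \<Gamma>" "poly q y \<in> P" "map_poly v q = 1"
        using relation[OF xy(1)] relation[OF xy(2)] by blast
      show False
        by (rule no_relations_both[OF \<Gamma>(1) p(1) order_refl p(2,3) q(1) order_refl q(2,3) xy])
    qed
  qed
qed

end

section \<open>Sheaves of functions\<close>

text \<open>In \<open>reg_local\<close> the set \<open>W\<close> need not lie inside
  \<open>U\<close>. Restriction to smaller open sets and independence of the values outside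
  \<open>U\<close> are thereby included.\<close>

locale function_sheaf =
  fixes X :: "('p, 'k::field) fun_space"
  assumes reg_const: "openin (fs_top X) U \<Longrightarrow> (\<lambda>_. c) \<in> fs_reg X U"
    and reg_add: "openin (fs_top X) U \<Longrightarrow> f \<in> fs_reg X U \<Longrightarrow> g \<in> fs_reg X U \<Longrightarrow>
      (\<lambda>x. f x + g x) \<in> fs_reg X U"
    and reg_mult: "openin (fs_top X) U \<Longrightarrow> f \<in> fs_reg X U \<Longrightarrow> g \<in> fs_reg X U \<Longrightarrow>
      (\<lambda>x. f x * g x) \<in> fs_reg X U"
    and open_nonzero: "openin (fs_top X) U \<Longrightarrow> f \<in> fs_reg X U \<Longrightarrow> openin (fs_top X) {x \<in> U. f x \<noteq> 0}"
    and reg_inverse: "openin (fs_top X) U \<Longrightarrow> f \<in> fs_reg X U \<Longrightarrow>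
      (\<lambda>x. inverse (f x)) \<in> fs_reg X {x \<in> U. f x \<noteq> 0}"
    and reg_local: "openin (fs_top X) U \<Longrightarrow>
      (\<And>x. x \<in> U \<Longrightarrow> \<exists>W g. openin (fs_top X) W \<and> x \<in> W \<and> g \<in> fs_reg X W \<and> (\<forall>z\<in>W \<inter> U. f z = g z)) \<Longrightarrow>
      f \<in> fs_reg X U"
begin

lemma reg_restrict:
  "f \<in> fs_reg X U \<Longrightarrow> openin (fs_top X) U \<Longrightarrow> openin (fs_top X) V \<Longrightarrow> V \<subseteq> U \<Longrightarrow>
    (\<And>x. x \<in> V \<Longrightarrow> g x = f x) \<Longrightarrow> g \<in> fs_reg X V"
  by (rule reg_local) auto

end

lemma fs_top_induced [simp]: "fs_top (induced X Z) = subtopology (fs_top X) Z"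
  by (simp add: induced_def)

lemma reg_inducedE:
  assumes "f \<in> fs_reg (induced X Z) U" "x \<in> U"
  obtains W g where "openin (fs_top X) W" "x \<in> W" "g \<in> fs_reg X W" "\<And>z. z \<in> W \<Longrightarrow> z \<in> U \<Longrightarrow> f z = g z"
  using assms by (auto simp: induced_def)

lemma reg_inducedI:
  assumes "\<And>x. x \<in> U \<Longrightarrow>
    \<exists>W g. openin (fs_top X) W \<and> x \<in> W \<and> g \<in> fs_reg X W \<and> (\<forall>z\<in>W \<inter> U. f z = g z)"
  shows "f \<in> fs_reg (induced X Z) U"
  using assms by (auto simp: induced_def)

text \<open>All operations are carried out on local extensions to \<open>X\<close>, after shrinking
  to a common open set.\<close>

lemma function_sheaf_induced:
  assumes "function_sheaf X"
  shows "function_sheaf (induced X Z)"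
proof -
  interpret function_sheaf X by fact
  show ?thesis
  proof
    fix U c assume "openin (fs_top (induced X Z)) U"
    then obtain V where "openin (fs_top X) V" "U = V \<inter> Z" by (auto simp: openin_subtopology)
    thus "(\<lambda>_. c) \<in> fs_reg (induced X Z) U"
      by (intro reg_inducedI exI[of _ V] exI[of _ "\<lambda>_. c"]) (auto intro: reg_const)
  next
    fix U f g assume "f \<in> fs_reg (induced X Z) U" "g \<in> fs_reg (induced X Z) U"
    note fg = this
    have *: "\<exists>W f' g'. openin (fs_top X) W \<and> x \<in> W \<and> f' \<in> fs_reg X W \<and> g' \<in> fs_reg X W \<and>
        (\<forall>z\<in>W \<inter> U. f z = f' z \<and> g z = g' z)" if x: "x \<in> U" for x
    proof -
      obtain W f' where W: "openin (fs_top X) W" "x \<in> W" "f' \<in> fs_reg X W"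
          "\<And>z. z \<in> W \<Longrightarrow> z \<in> U \<Longrightarrow> f z = f' z" using reg_inducedE[OF fg(1) x] by blast
      obtain V g' where V: "openin (fs_top X) V" "x \<in> V" "g' \<in> fs_reg X V"
          "\<And>z. z \<in> V \<Longrightarrow> z \<in> U \<Longrightarrow> g z = g' z" using reg_inducedE[OF fg(2) x] by blast
      have "f' \<in> fs_reg X (W \<inter> V)" "g' \<in> fs_reg X (W \<inter> V)"
        by (rule reg_restrict[OF W(3,1)], use W V in auto) (rule reg_restrict[OF V(3,1)], use W V in auto)
      thus ?thesis using W V by (intro exI[of _ "W \<inter> V"] exI[of _ f'] exI[of _ g']) auto
    qed
    show "(\<lambda>x. f x + g x) \<in> fs_reg (induced X Z) U"
    proof (rule reg_inducedI)
      fix x assume "x \<in> U"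
      from *[OF this] obtain W f' g' where "openin (fs_top X) W" "x \<in> W" "f' \<in> fs_reg X W" "g' \<in> fs_reg X W"
        "\<forall>z\<in>W \<inter> U. f z = f' z \<and> g z = g' z" by blast
      thus "\<exists>W h. openin (fs_top X) W \<and> x \<in> W \<and> h \<in> fs_reg X W \<and> (\<forall>z\<in>W \<inter> U. f z + g z = h z)"
        by (intro exI[of _ W] exI[of _ "\<lambda>x. f' x + g' x"]) (auto intro: reg_add)
    qed
    show "(\<lambda>x. f x * g x) \<in> fs_reg (induced X Z) U"
    proof (rule reg_inducedI)
      fix x assume "x \<in> U"
      from *[OF this] obtain W f' g' where "openin (fs_top X) W" "x \<in> W" "f' \<in> fs_reg X W" "g' \<in> fs_reg X W"
        "\<forall>z\<in>W \<inter> U. f z = f' z \<and> g z = g' z" by blast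
      thus "\<exists>W h. openin (fs_top X) W \<and> x \<in> W \<and> h \<in> fs_reg X W \<and> (\<forall>z\<in>W \<inter> U. f z * g z = h z)"
        by (intro exI[of _ W] exI[of _ "\<lambda>x. f' x * g' x"]) (auto intro: reg_mult)
    qed
  next
    fix U f assume U: "openin (fs_top (induced X Z)) U" and f: "f \<in> fs_reg (induced X Z) U"
    obtain V where V: "openin (fs_top X) V" "U = V \<inter> Z" using U by (auto simp: openin_subtopology)
    have *: "\<exists>W f'. openin (fs_top X) W \<and> W \<subseteq> V \<and> x \<in> W \<and> f' \<in> fs_reg X W \<and> (\<forall>z\<in>W \<inter> U. f z = f' z)"
      if x: "x \<in> U" for x
    proof -
      obtain W f' where W: "openin (fs_top X) W" "x \<in> W" "f' \<in> fs_reg X W"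
          "\<And>z. z \<in> W \<Longrightarrow> z \<in> U \<Longrightarrow> f z = f' z" using reg_inducedE[OF f x] by blast
      have "f' \<in> fs_reg X (W \<inter> V)" by (rule reg_restrict[OF W(3,1)]) (use W V in auto)
      thus ?thesis using W V x by (intro exI[of _ "W \<inter> V"] exI[of _ f']) auto
    qed
    show "openin (fs_top (induced X Z)) {x \<in> U. f x \<noteq> 0}"
    proof (subst openin_subopen, safe)
      fix x assume x: "x \<in> U" "f x \<noteq> 0"
      from *[OF x(1)] obtain W f' where W: "openin (fs_top X) W" "W \<subseteq> V" "x \<in> W" "f' \<in> fs_reg X W"
        "\<forall>z\<in>W \<inter> U. f z = f' z" by (elim exE conjE)
      have "openin (fs_top (induced X Z)) ({z \<in> W. f' z \<noteq> 0} \<inter> Z)"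
        using open_nonzero[OF W(1,4)] by (auto simp: openin_subtopology)
      thus "\<exists>T. openin (fs_top (induced X Z)) T \<and> x \<in> T \<and> T \<subseteq> {x \<in> U. f x \<noteq> 0}"
        using W V x by (intro exI[of _ "{z \<in> W. f' z \<noteq> 0} \<inter> Z"]) auto
    qed
    show "(\<lambda>x. inverse (f x)) \<in> fs_reg (induced X Z) {x \<in> U. f x \<noteq> 0}"
    proof (rule reg_inducedI)
      fix x assume "x \<in> {x \<in> U. f x \<noteq> 0}"
      hence x: "x \<in> U" "f x \<noteq> 0" by auto
      from *[OF x(1)] obtain W f' where W: "openin (fs_top X) W" "W \<subseteq> V" "x \<in> W" "f' \<in> fs_reg X W"
        "\<forall>z\<in>W \<inter> U. f z = f' z" by (elim exE conjE)
      let ?W = "{z \<in> W. f' z \<noteq> 0}"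
      have "\<forall>z\<in>?W \<inter> {x \<in> U. f x \<noteq> 0}. inverse (f z) = inverse (f' z)" using W(5) by simp
      moreover have "x \<in> ?W" using W(3,5) x by auto
      ultimately show "\<exists>W g. openin (fs_top X) W \<and> x \<in> W \<and> g \<in> fs_reg X W \<and>
          (\<forall>z\<in>W \<inter> {x \<in> U. f x \<noteq> 0}. inverse (f z) = g z)"
        by (intro exI[of _ ?W] exI[of _ "\<lambda>z. inverse (f' z)"] conjI open_nonzero[OF W(1,4)]
            reg_inverse[OF W(1,4)])
    qed
  next
    fix U f
    assume U: "openin (fs_top (induced X Z)) U"
      and loc: "\<And>x. x \<in> U \<Longrightarrow> \<exists>W g. openin (fs_top (induced X Z)) W \<and> x \<in> W \<and>
          g \<in> fs_reg (induced X Z) W \<and> (\<forall>z\<in>W \<inter> U. f z = g z)"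
    show "f \<in> fs_reg (induced X Z) U"
    proof (rule reg_inducedI)
      fix x assume x: "x \<in> U"
      obtain W g where W: "openin (fs_top (induced X Z)) W" "x \<in> W" "g \<in> fs_reg (induced X Z) W"
        "\<forall>z\<in>W \<inter> U. f z = g z" using loc[OF x] by blast
      obtain W' where W': "openin (fs_top X) W'" "W = W' \<inter> Z" using W by (auto simp: openin_subtopology)
      obtain V h where V: "openin (fs_top X) V" "x \<in> V" "h \<in> fs_reg X V" "\<And>z. z \<in> V \<Longrightarrow> z \<in> W \<Longrightarrow> g z = h z"
        using reg_inducedE[OF W(3,2)] by blast
      have "h \<in> fs_reg X (V \<inter> W')" by (rule reg_restrict[OF V(3,1)]) (use V W' in auto)
      moreover have "U \<subseteq> Z" using U by (auto simp: openin_subtopology)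
      ultimately show "\<exists>W g. openin (fs_top X) W \<and> x \<in> W \<and> g \<in> fs_reg X W \<and> (\<forall>z\<in>W \<inter> U. f z = g z)"
        using V W W' by (intro exI[of _ "V \<inter> W'"] exI[of _ h]) auto
    qed
  qed
qed

lemma reg_quotient_space:
  "f \<in> fs_reg (quotient_space X q) V \<longleftrightarrow> f \<circ> q \<in> fs_reg X {x \<in> pts X. q x \<in> V}"
  by (simp add: quotient_space_def)

text \<open>Topology and functions of the quotient are both defined by pullback, so each property is
  the same property upstairs for the preimage of an open set.\<close>

lemma function_sheaf_quotient_space:
  assumes "function_sheaf X"
  shows "function_sheaf (quotient_space X q)"
proof -
  interpret function_sheaf X by fact
  note simps = openin_quotient_space reg_quotient_space comp_def
  show ?thesis
  proof
    fix U f assume U: "openin (fs_top (quotient_space X q)) U" and f: "f \<in> fs_reg (quotient_space X q) U"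
    have eq: "{x \<in> pts X. q x \<in> {y \<in> U. f y \<noteq> 0}} = {x \<in> {x \<in> pts X. q x \<in> U}. f (q x) \<noteq> 0}" by auto
    show "openin (fs_top (quotient_space X q)) {x \<in> U. f x \<noteq> 0}"
      using U f open_nonzero[of "{x \<in> pts X. q x \<in> U}" "f \<circ> q"]
      unfolding openin_quotient_space eq reg_quotient_space by (auto simp: comp_def)
    show "(\<lambda>x. inverse (f x)) \<in> fs_reg (quotient_space X q) {x \<in> U. f x \<noteq> 0}"
      using U f reg_inverse[of "{x \<in> pts X. q x \<in> U}" "f \<circ> q"]
      unfolding openin_quotient_space reg_quotient_space eq by (auto simp: comp_def)
  next
    fix U f
    assume U: "openin (fs_top (quotient_space X q)) U"
      and loc: "\<And>x. x \<in> U \<Longrightarrow> \<exists>W g. openin (fs_top (quotient_space X q)) W \<and> x \<in> W \<and>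
          g \<in> fs_reg (quotient_space X q) W \<and> (\<forall>z\<in>W \<inter> U. f z = g z)"
    show "f \<in> fs_reg (quotient_space X q) U"
      unfolding reg_quotient_space
    proof (rule reg_local)
      show "openin (fs_top X) {x \<in> pts X. q x \<in> U}" using U by (simp add: openin_quotient_space)
      fix x assume x: "x \<in> {x \<in> pts X. q x \<in> U}"
      then obtain W g where W: "openin (fs_top (quotient_space X q)) W" "q x \<in> W"
          "g \<in> fs_reg (quotient_space X q) W" "\<forall>z\<in>W \<inter> U. f z = g z" using loc by blast
      thus "\<exists>W g. openin (fs_top X) W \<and> x \<in> W \<and> g \<in> fs_reg X W \<and>
          (\<forall>z\<in>W \<inter> {x \<in> pts X. q x \<in> U}. (f \<circ> q) z = g z)"
        using x by (intro exI[of _ "{x \<in> pts X. q x \<in> W}"] exI[of _ "g \<circ> q"]) (auto simp: simps)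
    qed
  qed (auto simp: simps intro: reg_const reg_add reg_mult)
qed

section \<open>Homogeneous polynomials and projective space\<close>

lemma hom_poly_cmult: "hom_poly n d g \<Longrightarrow> hom_poly n d (\<lambda>v. c * g v)"
proof (induction rule: hom_poly.induct)
  case (coord_mult i d f)
  thus ?case using hom_poly.coord_mult[of i n d "\<lambda>v. c * f v"] by (simp add: mult.left_commute)
qed (auto intro: hom_poly.intros simp: distrib_left)

lemma hom_poly_mult: "hom_poly n d f \<Longrightarrow> hom_poly n e g \<Longrightarrow> hom_poly n (d + e) (\<lambda>v. f v * g v)"
proof (induction rule: hom_poly.induct)
  case (coord_mult i d f)
  thus ?case using hom_poly.coord_mult[of i n "d + e" "\<lambda>v. f v * g v"] by (simp add: mult.assoc)
qed (auto intro: hom_poly.intros hom_poly_cmult simp: distrib_right)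

lemma hom_poly_sum: "(\<And>i. i \<in> A \<Longrightarrow> hom_poly n d (f i)) \<Longrightarrow> hom_poly n d (\<lambda>v. \<Sum>i\<in>A. f i v)"
  by (induction A rule: infinite_finite_induct) (auto intro: hom_poly.intros)

lemma hom_poly_coord: "i < n \<Longrightarrow> hom_poly n 1 (\<lambda>v. v $ i)"
  using hom_poly.coord_mult[OF _ hom_poly.const[of n 1]] by simp

lemma hom_poly_linear: "hom_poly n 1 (\<lambda>v. \<Sum>i<n. c i * v $ i)"
  by (intro hom_poly_sum hom_poly_cmult hom_poly_coord) auto

lemma hom_poly_in_poly_functions: "hom_poly n d f \<Longrightarrow> f \<in> poly_functions n"
proof (induction rule: hom_poly.induct)
  case (coord_mult i d f)
  thus ?case by (intro fun_algebra.mult[OF fun_algebra.gen]) auto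
qed (auto intro: fun_algebra.const fun_algebra.add)

lemma hom_poly_smult:
  "hom_poly n d f \<Longrightarrow> v \<in> carrier_vec n \<Longrightarrow> f (c \<cdot>\<^sub>v v) = c ^ d * f v"
  by (induction rule: hom_poly.induct) (auto simp: algebra_simps)

lemma proj_pointE:
  assumes "p \<in> proj_points n" "v \<in> p"
  shows "v \<in> carrier_vec n" "v \<noteq> 0\<^sub>v n" "p = {c \<cdot>\<^sub>v v | c. c \<noteq> 0}"
proof -
  obtain w a where w: "w \<in> carrier_vec n" "w \<noteq> 0\<^sub>v n" "p = {c \<cdot>\<^sub>v w | c. c \<noteq> 0}" and a: "v = a \<cdot>\<^sub>v w" "a \<noteq> 0"
    using assms by (auto simp: proj_points_def)
  show "v \<in> carrier_vec n" using w(1) a(1) by simp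
  have wa: "w = (1/a) \<cdot>\<^sub>v v" unfolding a(1) using a(2) by (simp add: smult_smult_assoc)
  show "v \<noteq> 0\<^sub>v n"
  proof
    assume "v = 0\<^sub>v n"
    with wa have "w = 0\<^sub>v n" by (intro eq_vecI) auto
    with w(2) show False ..
  qed
  show "p = {c \<cdot>\<^sub>v v | c. c \<noteq> 0}"
    unfolding w(3)
  proof (intro subset_antisym subsetI)
    fix u assume "u \<in> {c \<cdot>\<^sub>v w | c. c \<noteq> 0}"
    then obtain b where "u = b \<cdot>\<^sub>v w" "b \<noteq> 0" by blast
    hence "u = (b / a) \<cdot>\<^sub>v v \<and> b / a \<noteq> 0" using a by (simp add: smult_smult_assoc)
    thus "u \<in> {c \<cdot>\<^sub>v v | c. c \<noteq> 0}" by blast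
  next
    fix u assume "u \<in> {c \<cdot>\<^sub>v v | c. c \<noteq> 0}"
    then obtain b where "u = b \<cdot>\<^sub>v v" "b \<noteq> 0" by blast
    hence "u = (b * a) \<cdot>\<^sub>v w \<and> b * a \<noteq> 0" using a by (simp add: smult_smult_assoc)
    thus "u \<in> {c \<cdot>\<^sub>v w | c. c \<noteq> 0}" by blast
  qed
qed

lemma proj_point_nonempty: "p \<in> proj_points n \<Longrightarrow> \<exists>v. v \<in> (p :: 'k::field vec set)"
proof -
  assume "p \<in> proj_points n"
  then obtain w where "p = {c \<cdot>\<^sub>v w | c. c \<noteq> 0}" unfolding proj_points_def by blast
  moreover have "(1::'k) \<noteq> 0" by simp
  ultimately have "1 \<cdot>\<^sub>v w \<in> p" by blast
  thus ?thesis ..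
qed

lemma proj_point_eqI:
  assumes "p \<in> proj_points n" "q \<in> proj_points n" "v \<in> p" "v \<in> q"
  shows "p = q"
  using proj_pointE(3)[OF assms(1,3)] proj_pointE(3)[OF assms(2,4)] by simp

lemma hom_poly_ratio:
  assumes "hom_poly n d f" "hom_poly n d g" "p \<in> proj_points n" "v \<in> p" "w \<in> p"
  shows "f v / g v = f w / g w" "f v = 0 \<longleftrightarrow> f w = 0"
proof -
  from assms(5) obtain c where "w = c \<cdot>\<^sub>v v" "c \<noteq> 0"
    by (subst (asm) proj_pointE(3)[OF assms(3,4)]) blast
  thus "f v / g v = f w / g w" "f v = 0 \<longleftrightarrow> f w = 0"
    using hom_poly_smult[OF assms(1)] hom_poly_smult[OF assms(2)] proj_pointE(1)[OF assms(3,4)] by auto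
qed

lemma openin_proj_nonzero:
  "hom_poly n d f \<Longrightarrow> openin (fs_top (proj_space n)) {p \<in> proj_points n. \<forall>v\<in>p. f v \<noteq> 0}"
  unfolding proj_space_def Let_def by (auto intro!: topology_generated_by_Basis)

lemma reg_proj_space:
  "\<phi> \<in> fs_reg (proj_space n) U \<longleftrightarrow>
     (\<forall>p\<in>U. \<exists>W. openin (fs_top (proj_space n)) W \<and> p \<in> W \<and> W \<subseteq> U \<and>
        (\<exists>d f g. hom_poly n d f \<and> hom_poly n d g \<and> (\<forall>q\<in>W. \<forall>v\<in>q. g v \<noteq> 0 \<and> \<phi> q = f v / g v)))"
  unfolding proj_space_def Let_def by simp

lemma reg_proj_spaceE:
  assumes "\<phi> \<in> fs_reg (proj_space n) U" "p \<in> U"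
  obtains W d f g where "openin (fs_top (proj_space n)) W" "p \<in> W" "W \<subseteq> U" "hom_poly n d f"
    "hom_poly n d g" "\<And>q v. q \<in> W \<Longrightarrow> v \<in> q \<Longrightarrow> g v \<noteq> 0 \<and> \<phi> q = f v / g v"
proof -
  from bspec[OF assms(1)[unfolded reg_proj_space] assms(2)]
  obtain W d f g where "openin (fs_top (proj_space n)) W" "p \<in> W" "W \<subseteq> U" "hom_poly n d f"
    "hom_poly n d g" "\<forall>q\<in>W. \<forall>v\<in>q. g v \<noteq> 0 \<and> \<phi> q = f v / g v"
    by (elim exE conjE)
  thus ?thesis by (intro that[of W d f g]) auto
qed

lemma function_sheaf_proj_space: "function_sheaf (proj_space n :: ('k::field vec set, 'k) fun_space)"
proof
  let ?T = "fs_top (proj_space n) :: 'k vec set topology"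
  have sub: "W \<subseteq> proj_points n" if "openin ?T W" for W
    using openin_subset[OF that] by (simp add: pts_proj_space)
  show "(\<lambda>_. c) \<in> fs_reg (proj_space n) U" if "openin ?T U" for U c
    unfolding reg_proj_space
  proof
    fix p assume "p \<in> U"
    have "\<exists>d f g. hom_poly n d f \<and> hom_poly n d g \<and> (\<forall>q\<in>U. \<forall>v\<in>q. g v \<noteq> 0 \<and> c = f v / g v)"
      by (rule exI[of _ 0], rule exI[of _ "\<lambda>_. c"], rule exI[of _ "\<lambda>_. 1"])
        (auto intro: hom_poly.const)
    thus "\<exists>W. openin ?T W \<and> p \<in> W \<and> W \<subseteq> U \<and>
        (\<exists>d f g. hom_poly n d f \<and> hom_poly n d g \<and> (\<forall>q\<in>W. \<forall>v\<in>q. g v \<noteq> 0 \<and> c = f v / g v))"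
      using that \<open>p \<in> U\<close> by blast
  qed
  fix U and \<phi> :: "'k vec set \<Rightarrow> 'k" assume U: "openin ?T U" and \<phi>: "\<phi> \<in> fs_reg (proj_space n) U"
  show "(\<lambda>x. \<phi> x + \<psi> x) \<in> fs_reg (proj_space n) U" "(\<lambda>x. \<phi> x * \<psi> x) \<in> fs_reg (proj_space n) U"
    if \<psi>: "\<psi> \<in> fs_reg (proj_space n) U" for \<psi>
  proof -
    have *: "(\<exists>W. openin ?T W \<and> p \<in> W \<and> W \<subseteq> U \<and> (\<exists>d f g. hom_poly n d f \<and> hom_poly n d g \<and>
            (\<forall>q\<in>W. \<forall>v\<in>q. g v \<noteq> 0 \<and> \<phi> q + \<psi> q = f v / g v))) \<and>
          (\<exists>W. openin ?T W \<and> p \<in> W \<and> W \<subseteq> U \<and> (\<exists>d f g. hom_poly n d f \<and> hom_poly n d g \<and>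
            (\<forall>q\<in>W. \<forall>v\<in>q. g v \<noteq> 0 \<and> \<phi> q * \<psi> q = f v / g v)))" if p: "p \<in> U" for p
    proof -
      obtain W d f g where W: "openin ?T W" "p \<in> W" "W \<subseteq> U" "hom_poly n d f" "hom_poly n d g"
        "\<And>q v. q \<in> W \<Longrightarrow> v \<in> q \<Longrightarrow> g v \<noteq> 0 \<and> \<phi> q = f v / g v"
        using reg_proj_spaceE[OF \<phi> p] by blast
      obtain V e f' g' where V: "openin ?T V" "p \<in> V" "V \<subseteq> U" "hom_poly n e f'" "hom_poly n e g'"
        "\<And>q v. q \<in> V \<Longrightarrow> v \<in> q \<Longrightarrow> g' v \<noteq> 0 \<and> \<psi> q = f' v / g' v"
        using reg_proj_spaceE[OF \<psi> p] by blast
      have o: "openin ?T (W \<inter> V)" "p \<in> W \<inter> V" "W \<inter> V \<subseteq> U" using W V by auto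
      have h: "hom_poly n (d + e) (\<lambda>v. g v * g' v)" "hom_poly n (d + e) (\<lambda>v. f v * f' v)"
        "hom_poly n (d + e) (\<lambda>v. f v * g' v + g v * f' v)"
        using W V by (auto intro: hom_poly_mult hom_poly.add)
      have "\<forall>q\<in>W \<inter> V. \<forall>v\<in>q. g v * g' v \<noteq> 0 \<and> \<phi> q + \<psi> q = (f v * g' v + g v * f' v) / (g v * g' v)"
        using W(6) V(6) by (auto simp: field_simps)
      moreover have "\<forall>q\<in>W \<inter> V. \<forall>v\<in>q. g v * g' v \<noteq> 0 \<and> \<phi> q * \<psi> q = (f v * f' v) / (g v * g' v)"
        using W(6) V(6) by auto
      ultimately show ?thesis using o h by blast
    qed
    show "(\<lambda>x. \<phi> x + \<psi> x) \<in> fs_reg (proj_space n) U"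
      unfolding reg_proj_space by (intro ballI conjunct1[OF *])
    show "(\<lambda>x. \<phi> x * \<psi> x) \<in> fs_reg (proj_space n) U"
      unfolding reg_proj_space by (intro ballI conjunct2[OF *])
  qed
  have *: "\<exists>W. openin ?T W \<and> p \<in> W \<and> W \<subseteq> {x \<in> U. \<phi> x \<noteq> 0} \<and> (\<exists>d f g. hom_poly n d f \<and> hom_poly n d g \<and>
      (\<forall>q\<in>W. \<forall>v\<in>q. g v \<noteq> 0 \<and> inverse (\<phi> q) = f v / g v))" if p: "p \<in> U" "\<phi> p \<noteq> 0" for p
  proof -
    obtain W d f g where W: "openin ?T W" "p \<in> W" "W \<subseteq> U" "hom_poly n d f" "hom_poly n d g"
      "\<And>q v. q \<in> W \<Longrightarrow> v \<in> q \<Longrightarrow> g v \<noteq> 0 \<and> \<phi> q = f v / g v"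
      using reg_proj_spaceE[OF \<phi> p(1)] by blast
    define V where "V = W \<inter> {p \<in> proj_points n. \<forall>v\<in>p. f v \<noteq> 0}"
    have "openin ?T V" "p \<in> V" "V \<subseteq> W"
      unfolding V_def using W p(2) sub[OF W(1)] openin_proj_nonzero[OF W(4)] by auto
    moreover have "V \<subseteq> {x \<in> U. \<phi> x \<noteq> 0}" unfolding V_def using W(3,6) proj_point_nonempty by fastforce
    moreover have "\<forall>q\<in>V. \<forall>v\<in>q. f v \<noteq> 0 \<and> inverse (\<phi> q) = g v / f v"
      unfolding V_def using W(6) by auto
    ultimately show ?thesis using W(4,5) by blast
  qed
  show "openin ?T {x \<in> U. \<phi> x \<noteq> 0}"
  proof (subst openin_subopen, rule ballI)
    fix p assume "p \<in> {x \<in> U. \<phi> x \<noteq> 0}"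
    with *[of p] show "\<exists>T. openin ?T T \<and> p \<in> T \<and> T \<subseteq> {x \<in> U. \<phi> x \<noteq> 0}" by blast
  qed
  show "(\<lambda>x. inverse (\<phi> x)) \<in> fs_reg (proj_space n) {x \<in> U. \<phi> x \<noteq> 0}"
    unfolding reg_proj_space
  proof (rule ballI)
    fix p assume "p \<in> {x \<in> U. \<phi> x \<noteq> 0}"
    hence "p \<in> U" "\<phi> p \<noteq> 0" by auto
    from *[OF this] show "\<exists>W. openin ?T W \<and> p \<in> W \<and> W \<subseteq> {x \<in> U. \<phi> x \<noteq> 0} \<and>
      (\<exists>d f g. hom_poly n d f \<and> hom_poly n d g \<and>
        (\<forall>q\<in>W. \<forall>v\<in>q. g v \<noteq> 0 \<and> inverse (\<phi> q) = f v / g v))" .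
  qed
next
  let ?T = "fs_top (proj_space n) :: 'k vec set topology"
  fix U and \<phi> :: "'k vec set \<Rightarrow> 'k" assume U: "openin ?T U"
    and loc: "\<And>x. x \<in> U \<Longrightarrow> \<exists>W g. openin ?T W \<and> x \<in> W \<and> g \<in> fs_reg (proj_space n) W \<and> (\<forall>z\<in>W \<inter> U. \<phi> z = g z)"
  show "\<phi> \<in> fs_reg (proj_space n) U"
    unfolding reg_proj_space
  proof
    fix p assume p: "p \<in> U"
    obtain W \<psi> where W: "openin ?T W" "p \<in> W" "\<psi> \<in> fs_reg (proj_space n) W" "\<forall>z\<in>W \<inter> U. \<phi> z = \<psi> z"
      using loc[OF p] by blast
    obtain V d f g where V: "openin ?T V" "p \<in> V" "V \<subseteq> W" "hom_poly n d f" "hom_poly n d g"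
      "\<And>q v. q \<in> V \<Longrightarrow> v \<in> q \<Longrightarrow> g v \<noteq> 0 \<and> \<psi> q = f v / g v"
      using reg_proj_spaceE[OF W(3,2)] by blast
    have "\<forall>q\<in>V \<inter> U. \<forall>v\<in>q. g v \<noteq> 0 \<and> \<phi> q = f v / g v" using V W by auto
    thus "\<exists>W. openin ?T W \<and> p \<in> W \<and> W \<subseteq> U \<and> (\<exists>d f g. hom_poly n d f \<and> hom_poly n d g \<and>
        (\<forall>q\<in>W. \<forall>v\<in>q. g v \<noteq> 0 \<and> \<phi> q = f v / g v))"
      using U V p by (intro exI[of _ "V \<inter> U"]) blast
  qed
qed

section \<open>Function fields\<close>

definition rationals :: "('p, 'k) fun_space \<Rightarrow> ('p \<Rightarrow> 'k) set" where
  "rationals X = {f. \<exists>U. openin (fs_top X) U \<and> U \<noteq> {} \<and> f \<in> fs_reg X U}"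

definition germs :: "('p, 'k) fun_space \<Rightarrow> 'p \<Rightarrow> ('p \<Rightarrow> 'k) set" where
  "germs X x = {f. \<exists>U. openin (fs_top X) U \<and> x \<in> U \<and> f \<in> fs_reg X U}"

text \<open>The class of a function without reference to a domain. It agrees with
  \<open>rat_fun\<close> for every admissible domain, which reduces arithmetic in the function field
  to pointwise arithmetic.\<close>

definition cls :: "('p, 'k) fun_space \<Rightarrow> ('p \<Rightarrow> 'k) \<Rightarrow> ('p set \<times> ('p \<Rightarrow> 'k)) set" where
  "cls X f = {(V, g). openin (fs_top X) V \<and> V \<noteq> {} \<and> g \<in> fs_reg X V \<and> generically X (\<lambda>x. f x = g x)}"

text \<open>A filter, so that generic identities can be combined by \<open>eventually_elim\<close>.
  It has the intended meaning once irreducibility makes any two nonempty open sets meet;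
  \<open>eventually_gen\<close> records this.\<close>

definition gen :: "('p, 'k) fun_space \<Rightarrow> 'p filter" where
  "gen X = Abs_filter (generically X)"

lemma germs_rationals: "f \<in> germs X x \<Longrightarrow> f \<in> rationals X"
  by (auto simp: germs_def rationals_def)

locale irreducible_sheaf = function_sheaf X for X :: "('p, 'k::field) fun_space" +
  assumes irreducible: "irreducible_in (fs_top X) (pts X)"
begin

lemma pts_nonempty: "pts X \<noteq> {}"
  using irreducible by (simp add: irreducible_in_def)

lemma open_inter_nonempty:
  assumes "openin (fs_top X) U" "U \<noteq> {}" "openin (fs_top X) V" "V \<noteq> {}"
  shows "U \<inter> V \<noteq> {}"
proof
  assume UV: "U \<inter> V = {}"
  have "closedin (fs_top X) (pts X - U)" "closedin (fs_top X) (pts X - V)" using assms by auto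
  moreover have "pts X \<subseteq> (pts X - U) \<union> (pts X - V)" using UV by auto
  ultimately have "pts X \<subseteq> pts X - U \<or> pts X \<subseteq> pts X - V"
    using irreducible by (simp add: irreducible_in_def)
  moreover have "U \<subseteq> pts X" "V \<subseteq> pts X" using assms openin_subset by auto
  ultimately show False using assms by blast
qed

lemma eventually_gen: "eventually P (gen X) \<longleftrightarrow> generically X P"
  unfolding gen_def
proof (rule eventually_Abs_filter, rule is_filter.intro)
  show "generically X (\<lambda>_. True)" unfolding generically_def using pts_nonempty by blast
  show "generically X (\<lambda>x. P x \<and> Q x)" if P: "generically X P" and Q: "generically X Q" for P Q
  proof -
    obtain U V where "openin (fs_top X) U" "U \<noteq> {}" "\<forall>x\<in>U. P x" "openin (fs_top X) V" "V \<noteq> {}" "\<forall>x\<in>V. Q x"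
      using P Q unfolding generically_def by blast
    thus ?thesis unfolding generically_def
      by (intro exI[of _ "U \<inter> V"]) (use open_inter_nonempty[of U V] in auto)
  qed
  show "generically X Q" if "\<forall>x. P x \<longrightarrow> Q x" "generically X P" for P Q
    using that by (auto simp: generically_def)
qed

lemma gen_nontrivial: "gen X \<noteq> bot"
  using eventually_gen[of "\<lambda>_. False"] by (auto simp: trivial_limit_def generically_def)

lemma eventually_gen_const [simp]: "(\<forall>\<^sub>F x in gen X. P) \<longleftrightarrow> P"
  using gen_nontrivial by (simp add: eventually_const_iff)

lemma eventually_genI:
  "openin (fs_top X) U \<Longrightarrow> U \<noteq> {} \<Longrightarrow> (\<And>x. x \<in> U \<Longrightarrow> P x) \<Longrightarrow> eventually P (gen X)"
  unfolding eventually_gen generically_def by blast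

lemma eventually_genE:
  assumes "eventually P (gen X)"
  obtains U where "openin (fs_top X) U" "U \<noteq> {}" "\<And>x. x \<in> U \<Longrightarrow> P x"
  using assms unfolding eventually_gen generically_def by blast

lemma eventually_pts: "\<forall>\<^sub>F x in gen X. x \<in> pts X"
  using pts_nonempty by (intro eventually_genI[of "pts X"]) auto

lemma eventually_nonzero:
  "openin (fs_top X) U \<Longrightarrow> f \<in> fs_reg X U \<Longrightarrow> x \<in> U \<Longrightarrow> f x \<noteq> 0 \<Longrightarrow> \<forall>\<^sub>F x in gen X. f x \<noteq> 0"
  by (rule eventually_genI[OF open_nonzero[of U f]]) auto

lemma reg_uminus: "openin (fs_top X) U \<Longrightarrow> f \<in> fs_reg X U \<Longrightarrow> (\<lambda>x. - f x) \<in> fs_reg X U"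
  using reg_mult[OF _ reg_const[of U "-1"], of f] by simp

text \<open>The points where the difference is nonzero form an open set, and a nonempty open set
  would contradict generic equality. Regular functions are thus determined by their generic
  values.\<close>

lemma reg_identity:
  assumes "openin (fs_top X) U" "f \<in> fs_reg X U" "g \<in> fs_reg X U" "\<forall>\<^sub>F x in gen X. f x = g x" "x \<in> U"
  shows "f x = g x"
proof (rule ccontr)
  assume "f x \<noteq> g x"
  moreover have "(\<lambda>x. f x + - g x) \<in> fs_reg X U" using assms by (intro reg_add reg_uminus)
  ultimately have "\<forall>\<^sub>F x in gen X. f x + - g x \<noteq> 0"
    using assms by (intro eventually_nonzero[of U _ x]) auto
  with assms(4) have "\<forall>\<^sub>F x in gen X. False" by eventually_elim simp
  thus False by simp
qed

lemma rationals_cong: "\<forall>\<^sub>F x in gen X. f x = g x \<Longrightarrow> g \<in> rationals X \<Longrightarrow> f \<in> rationals X"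
proof -
  assume fg: "\<forall>\<^sub>F x in gen X. f x = g x" and "g \<in> rationals X"
  then obtain U where U: "openin (fs_top X) U" "U \<noteq> {}" "g \<in> fs_reg X U"
    unfolding rationals_def by blast
  obtain V where V: "openin (fs_top X) V" "V \<noteq> {}" "\<And>x. x \<in> V \<Longrightarrow> f x = g x"
    using eventually_genE[OF fg] by blast
  have "f \<in> fs_reg X (U \<inter> V)"
    by (rule reg_restrict[OF U(3,1)]) (use U V in auto)
  thus ?thesis using U V open_inter_nonempty[of U V] by (auto simp: rationals_def)
qed

lemma rationals_common:
  assumes "f \<in> rationals X" "g \<in> rationals X"
  obtains U where "openin (fs_top X) U" "U \<noteq> {}" "f \<in> fs_reg X U" "g \<in> fs_reg X U"
proof -
  obtain U V where U: "openin (fs_top X) U" "U \<noteq> {}" "f \<in> fs_reg X U"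
    and V: "openin (fs_top X) V" "V \<noteq> {}" "g \<in> fs_reg X V" using assms by (auto simp: rationals_def)
  have "f \<in> fs_reg X (U \<inter> V)" by (rule reg_restrict[OF U(3,1)]) (use U V in auto)
  moreover have "g \<in> fs_reg X (U \<inter> V)" by (rule reg_restrict[OF V(3,1)]) (use U V in auto)
  ultimately show ?thesis using U V open_inter_nonempty[of U V] by (intro that[of "U \<inter> V"]) auto
qed

lemma rationals_const: "(\<lambda>_. c) \<in> rationals X"
  using reg_const[of "pts X"] pts_nonempty by (auto simp: rationals_def)

lemma rationals_add: "f \<in> rationals X \<Longrightarrow> g \<in> rationals X \<Longrightarrow> (\<lambda>x. f x + g x) \<in> rationals X"
  by (erule (1) rationals_common) (auto simp: rationals_def intro: reg_add)

lemma rationals_mult: "f \<in> rationals X \<Longrightarrow> g \<in> rationals X \<Longrightarrow> (\<lambda>x. f x * g x) \<in> rationals X"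
  by (erule (1) rationals_common) (auto simp: rationals_def intro: reg_mult)

lemma rationals_uminus: "f \<in> rationals X \<Longrightarrow> (\<lambda>x. - f x) \<in> rationals X"
  using rationals_mult[OF rationals_const[of "-1"], of f] by simp

lemma rationals_diff: "f \<in> rationals X \<Longrightarrow> g \<in> rationals X \<Longrightarrow> (\<lambda>x. f x - g x) \<in> rationals X"
  using rationals_add[OF _ rationals_uminus, of f g] by simp

text \<open>This dichotomy is what makes rational functions modulo generic equality a field.\<close>

lemma rationals_zero_or_nonzero:
  assumes "f \<in> rationals X"
  shows "(\<forall>\<^sub>F x in gen X. f x = 0) \<or> (\<forall>\<^sub>F x in gen X. f x \<noteq> 0)"
proof -
  obtain U where U: "openin (fs_top X) U" "U \<noteq> {}" "f \<in> fs_reg X U" using assms by (auto simp: rationals_def)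
  show ?thesis
  proof (cases "\<forall>x\<in>U. f x = 0")
    case True
    thus ?thesis using U by (intro disjI1 eventually_genI[of U]) auto
  next
    case False
    thus ?thesis using U eventually_nonzero by blast
  qed
qed

lemma rationals_inverse:
  assumes "f \<in> rationals X"
  shows "(\<lambda>x. inverse (f x)) \<in> rationals X"
proof -
  obtain U where U: "openin (fs_top X) U" "U \<noteq> {}" "f \<in> fs_reg X U" using assms by (auto simp: rationals_def)
  show ?thesis
  proof (cases "\<exists>x\<in>U. f x \<noteq> 0")
    case True
    thus ?thesis using open_nonzero[OF U(1,3)] reg_inverse[OF U(1,3)] unfolding rationals_def by blast
  next
    case False
    hence "\<forall>\<^sub>F x in gen X. inverse (f x) = 0" using U by (intro eventually_genI[of U]) auto
    thus ?thesis using rationals_const by (rule rationals_cong)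
  qed
qed

lemma rationals_divide: "f \<in> rationals X \<Longrightarrow> g \<in> rationals X \<Longrightarrow> (\<lambda>x. f x / g x) \<in> rationals X"
  using rationals_mult[OF _ rationals_inverse, of f g] by (simp add: divide_inverse)

lemma rationals_sum: "(\<And>i. i \<in> A \<Longrightarrow> f i \<in> rationals X) \<Longrightarrow> (\<lambda>x. \<Sum>i\<in>A. f i x) \<in> rationals X"
  by (induction A rule: infinite_finite_induct) (auto intro: rationals_const rationals_add)

lemma rationals_power: "f \<in> rationals X \<Longrightarrow> (\<lambda>x. f x ^ n) \<in> rationals X"
  by (induction n) (auto intro: rationals_const rationals_mult)

section \<open>Germs at a point\<close>

lemma germs_common:
  assumes "f \<in> germs X x" "g \<in> germs X x"
  obtains U where "openin (fs_top X) U" "x \<in> U" "f \<in> fs_reg X U" "g \<in> fs_reg X U"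
proof -
  obtain U V where U: "openin (fs_top X) U" "x \<in> U" "f \<in> fs_reg X U"
    and V: "openin (fs_top X) V" "x \<in> V" "g \<in> fs_reg X V" using assms by (auto simp: germs_def)
  have "f \<in> fs_reg X (U \<inter> V)" by (rule reg_restrict[OF U(3,1)]) (use U V in auto)
  moreover have "g \<in> fs_reg X (U \<inter> V)" by (rule reg_restrict[OF V(3,1)]) (use U V in auto)
  ultimately show ?thesis using U V by (intro that[of "U \<inter> V"]) auto
qed

lemma germs_cong:
  assumes "g \<in> germs X x" "openin (fs_top X) V" "x \<in> V" "\<And>z. z \<in> V \<Longrightarrow> f z = g z"
  shows "f \<in> germs X x"
proof -
  obtain U where U: "openin (fs_top X) U" "x \<in> U" "g \<in> fs_reg X U" using assms by (auto simp: germs_def)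
  have "f \<in> fs_reg X (U \<inter> V)" by (rule reg_restrict[OF U(3,1)]) (use U assms in auto)
  thus ?thesis using U assms by (auto simp: germs_def)
qed

lemma germs_const: "x \<in> pts X \<Longrightarrow> (\<lambda>_. c) \<in> germs X x"
  using reg_const[of "pts X"] by (auto simp: germs_def)

lemma germs_add: "f \<in> germs X x \<Longrightarrow> g \<in> germs X x \<Longrightarrow> (\<lambda>x. f x + g x) \<in> germs X x"
  by (erule (1) germs_common) (auto simp: germs_def intro: reg_add)

lemma germs_mult: "f \<in> germs X x \<Longrightarrow> g \<in> germs X x \<Longrightarrow> (\<lambda>x. f x * g x) \<in> germs X x"
  by (erule (1) germs_common) (auto simp: germs_def intro: reg_mult)

lemma germs_pts: "f \<in> germs X x \<Longrightarrow> x \<in> pts X"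
  by (auto simp: germs_def dest: openin_subset)

lemma germs_uminus: "f \<in> germs X x \<Longrightarrow> (\<lambda>x. - f x) \<in> germs X x"
  using germs_mult[OF germs_const[OF germs_pts, of f x "-1"], of f] by simp

lemma germs_diff: "f \<in> germs X x \<Longrightarrow> g \<in> germs X x \<Longrightarrow> (\<lambda>x. f x - g x) \<in> germs X x"
  using germs_add[OF _ germs_uminus, of f x g] by simp

lemma germs_inverse: "f \<in> germs X x \<Longrightarrow> f x \<noteq> 0 \<Longrightarrow> (\<lambda>x. inverse (f x)) \<in> germs X x"
proof -
  assume f: "f \<in> germs X x" "f x \<noteq> 0"
  then obtain U where U: "openin (fs_top X) U" "x \<in> U" "f \<in> fs_reg X U" unfolding germs_def by blast
  have "x \<in> {x \<in> U. f x \<noteq> 0}" using U f by simp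
  thus ?thesis using open_nonzero[OF U(1,3)] reg_inverse[OF U(1,3)] unfolding germs_def by blast
qed

lemma germs_divide: "f \<in> germs X x \<Longrightarrow> g \<in> germs X x \<Longrightarrow> g x \<noteq> 0 \<Longrightarrow> (\<lambda>x. f x / g x) \<in> germs X x"
  using germs_mult[OF _ germs_inverse, of f x g] by (simp add: divide_inverse)

lemma germs_sum:
  "x \<in> pts X \<Longrightarrow> (\<And>i. i \<in> A \<Longrightarrow> f i \<in> germs X x) \<Longrightarrow> (\<lambda>x. \<Sum>i\<in>A. f i x) \<in> germs X x"
  by (induction A rule: infinite_finite_induct) (auto intro: germs_const germs_add)

lemma germs_prod:
  "x \<in> pts X \<Longrightarrow> (\<And>i. i \<in> A \<Longrightarrow> f i \<in> germs X x) \<Longrightarrow> (\<lambda>x. \<Prod>i\<in>A. f i x) \<in> germs X x"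
  by (induction A rule: infinite_finite_induct) (auto intro: germs_const germs_mult)

lemma germs_power: "f \<in> germs X x \<Longrightarrow> (\<lambda>x. f x ^ n) \<in> germs X x"
  by (induction n) (auto intro: germs_const germs_mult germs_pts)

lemma germs_identity:
  assumes "f \<in> germs X x" "g \<in> germs X x" "\<forall>\<^sub>F z in gen X. f z = g z"
  obtains U where "openin (fs_top X) U" "x \<in> U" "\<And>z. z \<in> U \<Longrightarrow> f z = g z"
proof -
  obtain U where U: "openin (fs_top X) U" "x \<in> U" "f \<in> fs_reg X U" "g \<in> fs_reg X U"
    by (rule germs_common[OF assms(1,2)])
  show ?thesis using reg_identity[OF U(1,3,4) assms(3)] by (rule that[OF U(1,2)])
qed

lemma germs_nonzero: "f \<in> germs X x \<Longrightarrow> f x \<noteq> 0 \<Longrightarrow> \<forall>\<^sub>F z in gen X. f z \<noteq> 0"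
  unfolding germs_def using eventually_nonzero by blast

section \<open>The function field as classes modulo generic equality\<close>

lemma mem_cls:
  "(V, g) \<in> cls X f \<longleftrightarrow> openin (fs_top X) V \<and> V \<noteq> {} \<and> g \<in> fs_reg X V \<and> (\<forall>\<^sub>F x in gen X. f x = g x)"
  by (simp add: cls_def eventually_gen)

text \<open>By the identity principle, agreement on the overlap of the domains is the same as
  generic agreement.\<close>

lemma rat_fun_eq_cls:
  assumes "openin (fs_top X) U" "U \<noteq> {}" "f \<in> fs_reg X U"
  shows "rat_fun X U f = cls X f"
proof -
  have "(\<forall>x\<in>U \<inter> V. f x = g x) \<longleftrightarrow> (\<forall>\<^sub>F x in gen X. f x = g x)"
    if V: "openin (fs_top X) V" "V \<noteq> {}" "g \<in> fs_reg X V" for V g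
  proof
    assume "\<forall>x\<in>U \<inter> V. f x = g x"
    thus "\<forall>\<^sub>F x in gen X. f x = g x"
      using assms V open_inter_nonempty[of U V] by (intro eventually_genI[of "U \<inter> V"]) auto
  next
    assume *: "\<forall>\<^sub>F x in gen X. f x = g x"
    have "f \<in> fs_reg X (U \<inter> V)" by (rule reg_restrict[OF assms(3,1)]) (use assms V in auto)
    moreover have "g \<in> fs_reg X (U \<inter> V)" by (rule reg_restrict[OF V(3,1)]) (use assms V in auto)
    ultimately show "\<forall>x\<in>U \<inter> V. f x = g x" using reg_identity[OF _ _ _ *] assms V by blast
  qed
  thus ?thesis unfolding rat_fun_def cls_def eventually_gen[symmetric] by blast
qed

lemma cls_eq_iff:
  assumes "f \<in> rationals X" "g \<in> rationals X"
  shows "cls X f = cls X g \<longleftrightarrow> (\<forall>\<^sub>F x in gen X. f x = g x)"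
proof
  obtain U where U: "openin (fs_top X) U" "U \<noteq> {}" "g \<in> fs_reg X U"
    using assms(2) by (auto simp: rationals_def)
  assume "cls X f = cls X g"
  hence "(U, g) \<in> cls X f" using U by (simp add: mem_cls)
  thus "\<forall>\<^sub>F x in gen X. f x = g x" by (simp add: mem_cls)
next
  assume *: "\<forall>\<^sub>F x in gen X. f x = g x"
  have "(\<forall>\<^sub>F x in gen X. f x = h x) \<longleftrightarrow> (\<forall>\<^sub>F x in gen X. g x = h x)" for h
    by (rule eventually_cong[OF *]) simp
  thus "cls X f = cls X g" by (auto simp: mem_cls)
qed

lemma carrier_function_field: "carrier (function_field X) = cls X ` rationals X"
proof -
  have "{rat_fun X U f | U f. openin (fs_top X) U \<and> U \<noteq> {} \<and> f \<in> fs_reg X U} =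
      {cls X f | U f. openin (fs_top X) U \<and> U \<noteq> {} \<and> f \<in> fs_reg X U}"
    by (intro Collect_cong ex_cong1) (simp add: rat_fun_eq_cls cong: rev_conj_cong)
  thus ?thesis unfolding function_field_def rationals_def by auto
qed

lemma rat_fun_germ:
  assumes "openin (fs_top X) U" "x \<in> U" "f \<in> fs_reg X U"
  shows "rat_fun X U f = cls X f"
  using rat_fun_eq_cls[OF assms(1) _ assms(3)] assms(2) by blast

lemma local_ring_eq: "local_ring X x = cls X ` germs X x"
proof -
  have "local_ring X x = {cls X f | U f. openin (fs_top X) U \<and> x \<in> U \<and> f \<in> fs_reg X U}"
    unfolding local_ring_def
    by (intro Collect_cong ex_cong1) (auto simp: rat_fun_germ)
  thus ?thesis unfolding germs_def by auto
qed

lemma max_ideal_eq: "max_ideal X x = cls X ` {f \<in> germs X x. f x = 0}"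
proof -
  have "max_ideal X x = {cls X f | U f. openin (fs_top X) U \<and> x \<in> U \<and> f \<in> fs_reg X U \<and> f x = 0}"
    unfolding max_ideal_def
    by (intro Collect_cong ex_cong1) (auto simp: rat_fun_germ)
  thus ?thesis unfolding germs_def by auto
qed

text \<open>Sum and product of \<open>function_field\<close> are defined by the same pattern,
  quantified over representatives; \<open>F\<close> covers both and shows that the representatives
  do not matter.\<close>

lemma cls_op:
  fixes F :: "'k \<Rightarrow> 'k \<Rightarrow> 'k"
  assumes f: "f \<in> rationals X" and g: "g \<in> rationals X"
    and reg: "\<And>U f g. openin (fs_top X) U \<Longrightarrow> f \<in> fs_reg X U \<Longrightarrow> g \<in> fs_reg X U \<Longrightarrow> (\<lambda>x. F (f x) (g x)) \<in> fs_reg X U"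
  shows "{(W, h). openin (fs_top X) W \<and> W \<noteq> {} \<and> h \<in> fs_reg X W \<and>
          (\<exists>(U, f)\<in>cls X f. \<exists>(V, g)\<in>cls X g. \<forall>x\<in>W \<inter> U \<inter> V. h x = F (f x) (g x))} = cls X (\<lambda>x. F (f x) (g x))"
proof -
  define L where "L W h \<longleftrightarrow> (\<exists>(U, f)\<in>cls X f. \<exists>(V, g)\<in>cls X g. \<forall>x\<in>W \<inter> U \<inter> V. h x = F (f x) (g x))" for W h
  have "L W h \<longleftrightarrow> (\<forall>\<^sub>F x in gen X. F (f x) (g x) = h x)"
    if W: "openin (fs_top X) W" "W \<noteq> {}" "h \<in> fs_reg X W" for W h
  proof
    assume "L W h"
    then obtain a where a: "a \<in> cls X f"
      "case a of (U, f) \<Rightarrow> \<exists>(V, g)\<in>cls X g. \<forall>x\<in>W \<inter> U \<inter> V. h x = F (f x) (g x)"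
      unfolding L_def by (elim bexE)
    obtain U f' where aU: "a = (U, f')" by (cases a)
    with a(2) have "\<exists>(V, g)\<in>cls X g. \<forall>x\<in>W \<inter> U \<inter> V. h x = F (f' x) (g x)" by simp
    then obtain b where b: "b \<in> cls X g" "case b of (V, g) \<Rightarrow> \<forall>x\<in>W \<inter> U \<inter> V. h x = F (f' x) (g x)"
      by (elim bexE)
    obtain V g' where bV: "b = (V, g')" by (cases b)
    have U: "(U, f') \<in> cls X f" and V: "(V, g') \<in> cls X g"
      and h: "\<forall>x\<in>W \<inter> U \<inter> V. h x = F (f' x) (g' x)" using a(1) b aU bV by simp_all
    have "openin (fs_top X) (W \<inter> U \<inter> V)" "W \<inter> U \<inter> V \<noteq> {}"
      using U V W open_inter_nonempty[of W U] open_inter_nonempty[of "W \<inter> U" V] by (auto simp: mem_cls)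
    hence "\<forall>\<^sub>F x in gen X. h x = F (f' x) (g' x)" using h by (intro eventually_genI) auto
    moreover have "\<forall>\<^sub>F x in gen X. f x = f' x" "\<forall>\<^sub>F x in gen X. g x = g' x" using U V by (auto simp: mem_cls)
    ultimately show "\<forall>\<^sub>F x in gen X. F (f x) (g x) = h x" by eventually_elim simp
  next
    assume R: "\<forall>\<^sub>F x in gen X. F (f x) (g x) = h x"
    obtain U where U: "openin (fs_top X) U" "U \<noteq> {}" "f \<in> fs_reg X U" "g \<in> fs_reg X U"
      by (rule rationals_common[OF f g])
    have m: "(U, f) \<in> cls X f" "(U, g) \<in> cls X g" using U by (simp_all add: mem_cls)
    have h: "h x = F (f x) (g x)" if x: "x \<in> W \<inter> U \<inter> U" for x
    proof -
      have "h \<in> fs_reg X (W \<inter> U)" by (rule reg_restrict[OF W(3,1)]) (use U W in auto)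
      moreover have "(\<lambda>x. F (f x) (g x)) \<in> fs_reg X (W \<inter> U)"
        by (rule reg_restrict[OF reg[OF U(1,3,4)] U(1)]) (use U W in auto)
      ultimately show ?thesis using reg_identity[of "W \<inter> U" "\<lambda>x. F (f x) (g x)" h x] openin_Int[OF W(1) U(1)] R x by auto
    qed
    have "\<exists>(V, g)\<in>cls X g. \<forall>x\<in>W \<inter> U \<inter> V. h x = F (f x) (g x)"
      by (rule bexI[OF _ m(2)]) (use h in simp)
    thus "L W h" unfolding L_def by (intro bexI[OF _ m(1)]) simp
  qed
  thus ?thesis
    unfolding L_def[symmetric] cls_def[of X "\<lambda>x. F (f x) (g x)"] eventually_gen[symmetric] by blast
qed

lemma cls_mult:
  "f \<in> rationals X \<Longrightarrow> g \<in> rationals X \<Longrightarrow>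
    cls X f \<otimes>\<^bsub>function_field X\<^esub> cls X g = cls X (\<lambda>x. f x * g x)"
  using cls_op[of f g "(*)"] reg_mult by (simp add: function_field_def)

lemma cls_add:
  "f \<in> rationals X \<Longrightarrow> g \<in> rationals X \<Longrightarrow>
    cls X f \<oplus>\<^bsub>function_field X\<^esub> cls X g = cls X (\<lambda>x. f x + g x)"
  using cls_op[of f g "(+)"] reg_add by (simp add: function_field_def)

lemma cls_one: "\<one>\<^bsub>function_field X\<^esub> = cls X (\<lambda>_. 1)"
  using rat_fun_eq_cls[OF openin_topspace pts_nonempty reg_const[OF openin_topspace], of 1]
  by (simp add: function_field_def)

lemma cls_zero: "\<zero>\<^bsub>function_field X\<^esub> = cls X (\<lambda>_. 0)"
  using rat_fun_eq_cls[OF openin_topspace pts_nonempty reg_const[OF openin_topspace], of 0]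
  by (simp add: function_field_def)

lemma cls_in_carrier: "f \<in> rationals X \<Longrightarrow> cls X f \<in> carrier (function_field X)"
  by (simp add: carrier_function_field)

lemma carrier_function_fieldE:
  assumes "a \<in> carrier (function_field X)"
  obtains f where "f \<in> rationals X" "a = cls X f"
  using assms by (auto simp: carrier_function_field)

lemmas cls_simps = cls_add cls_mult cls_one cls_zero rationals_add rationals_mult rationals_const
  cls_in_carrier

lemma cring_function_field: "cring (function_field X)"
proof (rule cringI)
  let ?K = "function_field X"
  show "abelian_group ?K"
  proof (rule abelian_groupI)
    fix x assume "x \<in> carrier ?K"
    then obtain f where f: "f \<in> rationals X" "x = cls X f" by (elim carrier_function_fieldE)
    show "\<exists>y\<in>carrier ?K. y \<oplus>\<^bsub>?K\<^esub> x = \<zero>\<^bsub>?K\<^esub>"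
      using f rationals_uminus[OF f(1)] by (intro bexI[of _ "cls X (\<lambda>x. - f x)"]) (simp_all add: cls_simps)
  qed (auto elim!: carrier_function_fieldE simp: cls_simps add_ac)
  show "Group.comm_monoid ?K"
    by (rule comm_monoidI) (auto elim!: carrier_function_fieldE simp: cls_simps mult_ac)
qed (auto elim!: carrier_function_fieldE simp: cls_simps distrib_right)

lemma cls_eq_zero_iff: "f \<in> rationals X \<Longrightarrow> cls X f = \<zero>\<^bsub>function_field X\<^esub> \<longleftrightarrow> (\<forall>\<^sub>F x in gen X. f x = 0)"
  by (simp add: cls_zero cls_eq_iff rationals_const)

lemma field_function_field: "field (function_field X)"
proof -
  interpret K: cring "function_field X" by (rule cring_function_field)
  have one: "\<one>\<^bsub>function_field X\<^esub> \<noteq> \<zero>\<^bsub>function_field X\<^esub>"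
    by (simp add: cls_one cls_eq_zero_iff rationals_const)
  show ?thesis
  proof (rule K.cring_fieldI2)
    show "\<zero>\<^bsub>function_field X\<^esub> \<noteq> \<one>\<^bsub>function_field X\<^esub>" using one by simp
    fix a assume "a \<in> carrier (function_field X)" "a \<noteq> \<zero>\<^bsub>function_field X\<^esub>"
    then obtain f where f: "f \<in> rationals X" "a = cls X f" "\<not> (\<forall>\<^sub>F x in gen X. f x = 0)"
      by (metis carrier_function_fieldE cls_eq_zero_iff)
    hence "\<forall>\<^sub>F x in gen X. f x \<noteq> 0" using rationals_zero_or_nonzero by blast
    hence "\<forall>\<^sub>F x in gen X. f x * inverse (f x) = 1" by eventually_elim simp
    hence "cls X f \<otimes>\<^bsub>function_field X\<^esub> cls X (\<lambda>x. inverse (f x)) = \<one>\<^bsub>function_field X\<^esub>"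
      using f by (simp add: cls_mult cls_one rationals_inverse cls_eq_iff rationals_mult rationals_const)
    thus "\<exists>b\<in>carrier (function_field X). a \<otimes>\<^bsub>function_field X\<^esub> b = \<one>\<^bsub>function_field X\<^esub>"
      using f(2) cls_in_carrier[OF rationals_inverse[OF f(1)]] by blast
  qed
qed

lemma cls_power:
  assumes "f \<in> rationals X"
  shows "cls X f [^]\<^bsub>function_field X\<^esub> (n::nat) = cls X (\<lambda>x. f x ^ n)"
proof (induction n)
  case 0 show ?case by (simp add: cls_one)
next
  case (Suc n)
  thus ?case using assms rationals_power[OF assms, of n] by (simp add: cls_mult mult.commute)
qed

lemma cls_sum:
  assumes "finite A" "\<And>i. i \<in> A \<Longrightarrow> f i \<in> rationals X"
  shows "(\<Oplus>\<^bsub>function_field X\<^esub>i\<in>A. cls X (f i)) = cls X (\<lambda>x. \<Sum>i\<in>A. f i x)"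
  using assms
proof (induction A rule: finite_induct)
  interpret K: cring "function_field X" by (rule cring_function_field)
  case empty show ?case by (simp add: cls_zero)
next
  interpret K: cring "function_field X" by (rule cring_function_field)
  case (insert a A)
  have "(\<Oplus>\<^bsub>function_field X\<^esub>i\<in>insert a A. cls X (f i)) =
      cls X (f a) \<oplus>\<^bsub>function_field X\<^esub> (\<Oplus>\<^bsub>function_field X\<^esub>i\<in>A. cls X (f i))"
    using insert by (intro K.finsum_insert) (auto simp: cls_in_carrier)
  thus ?case using insert rationals_sum[of A f] by (simp add: cls_add)
qed

end

section \<open>Nakayama's lemma for germs\<close>

context irreducible_sheaf
begin

text \<open>Gaussian elimination in place of a determinant: \<open>1 - m n n\<close> is a unit at
  \<open>x\<close>, so \<open>d n\<close> can be solved for and substituted into the remaining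
  equations. The equations hold only generically, and \<open>J_cong\<close> transfers membership
  along generic equality.\<close>

lemma nakayama:
  fixes n :: nat
  assumes J_add: "\<And>f g. f \<in> J \<Longrightarrow> g \<in> J \<Longrightarrow> (\<lambda>z. f z + g z) \<in> J"
    and J_mult: "\<And>f g. f \<in> germs X x \<Longrightarrow> g \<in> J \<Longrightarrow> (\<lambda>z. f z * g z) \<in> J"
    and J_cong: "\<And>f g. f \<in> germs X x \<Longrightarrow> g \<in> J \<Longrightarrow> \<forall>\<^sub>F z in gen X. f z = g z \<Longrightarrow> f \<in> J"
  shows "(\<And>i. i < n \<Longrightarrow> d i \<in> germs X x) \<Longrightarrow> (\<And>i. i < n \<Longrightarrow> e i \<in> J) \<Longrightarrow>
    (\<And>i j. i < n \<Longrightarrow> j < n \<Longrightarrow> m i j \<in> germs X x \<and> m i j x = 0) \<Longrightarrow>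
    (\<And>i. i < n \<Longrightarrow> \<forall>\<^sub>F z in gen X. d i z = e i z + (\<Sum>j<n. m i j z * d j z)) \<Longrightarrow>
    i < n \<Longrightarrow> d i \<in> J"
proof (induction n arbitrary: e m i)
  case (Suc n)
  define u where "u z = inverse (1 - m n n z)" for z
  have x: "x \<in> pts X" using Suc.prems(1)[of 0] germs_pts by blast
  have mnn: "m n n \<in> germs X x" "m n n x = 0" using Suc.prems(3)[of n n] by auto
  have one: "(\<lambda>z. 1 - m n n z) \<in> germs X x" using mnn x by (intro germs_diff germs_const)
  have u: "u \<in> germs X x" unfolding u_def using mnn by (intro germs_inverse one) simp
  have "\<forall>\<^sub>F z in gen X. 1 - m n n z \<noteq> 0" using germs_nonzero[OF one] mnn by simp
  moreover have "\<forall>\<^sub>F z in gen X. d n z = e n z + (\<Sum>j<Suc n. m n j z * d j z)"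
    using Suc.prems(4)[of n] by simp
  ultimately have dn: "\<forall>\<^sub>F z in gen X. d n z = u z * e n z + (\<Sum>j<n. u z * m n j z * d j z)"
  proof eventually_elim
    case (elim z)
    have "d n z * (1 - m n n z) = e n z + (\<Sum>j<n. m n j z * d j z)"
      using elim(2) by (simp add: algebra_simps)
    hence "u z * (d n z * (1 - m n n z)) = u z * (e n z + (\<Sum>j<n. m n j z * d j z))" by simp
    moreover have "u z * (d n z * (1 - m n n z)) = d n z" using elim(1) by (simp add: u_def)
    ultimately show ?case by (simp add: distrib_left sum_distrib_left mult.assoc)
  qed
  \<comment> \<open>After the substitution the matrix entries still vanish at \<open>x\<close>,
    because each correction has the factor \<open>m i n\<close>, and the inhomogeneous terms stay in
    \<open>J\<close>.\<close>
  have small: "d i \<in> J" if i: "i < n" for i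
  proof (rule Suc.IH[where e = "\<lambda>i z. e i z + m i n z * (u z * e n z)"
        and m = "\<lambda>i j z. m i j z + m i n z * (u z * m n j z)", OF _ _ _ _ i])
    fix i assume i: "i < n"
    show "d i \<in> germs X x" using Suc.prems(1) i by simp
    show "(\<lambda>z. e i z + m i n z * (u z * e n z)) \<in> J"
      using Suc.prems(2,3) i u by (intro J_add J_mult) auto
    show "(\<lambda>z. m i j z + m i n z * (u z * m n j z)) \<in> germs X x \<and> m i j x + m i n x * (u x * m n j x) = 0"
      if "j < n" for j
      using Suc.prems(3) i that u by (auto intro!: germs_add germs_mult)
    have "\<forall>\<^sub>F z in gen X. d i z = e i z + (\<Sum>j<Suc n. m i j z * d j z)" using Suc.prems(4) i by simp
    thus "\<forall>\<^sub>F z in gen X. d i z = e i z + m i n z * (u z * e n z) +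
        (\<Sum>j<n. (m i j z + m i n z * (u z * m n j z)) * d j z)"
      using dn
    proof eventually_elim
      case (elim z)
      have "d i z = e i z + (\<Sum>j<n. m i j z * d j z) + m i n z * d n z" using elim(1) by simp
      also have "m i n z * d n z = m i n z * (u z * e n z) + (\<Sum>j<n. m i n z * (u z * m n j z) * d j z)"
        unfolding elim(2) by (simp add: distrib_left sum_distrib_left mult.assoc)
      finally show ?case by (simp add: distrib_right sum.distrib)
    qed
  qed
  have m: "m n j \<in> germs X x" if "j < n" for j using Suc.prems(3)[of n j] that by simp
  have sum: "(\<lambda>z. u z * e n z + (\<Sum>j<k. u z * m n j z * d j z)) \<in> J" if "k \<le> n" for k
    using that
  proof (induction k)
    case 0 thus ?case using J_mult[OF u Suc.prems(2)[of n]] by simp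
  next
    case (Suc k)
    have "(\<lambda>z. u z * m n k z) \<in> germs X x" using m u Suc.prems
      by (intro germs_mult) auto
    from J_add[OF Suc.IH J_mult[OF this small]] Suc.prems show ?case by (simp add: add.assoc)
  qed
  have "d n \<in> J" by (rule J_cong[OF _ sum[OF order_refl] dn]) (use Suc.prems(1) in simp)
  thus ?case using small Suc.prems(5) less_Suc_eq by auto
qed simp

section \<open>Polynomial expressions in germs\<close>

lemma germs_poly_function:
  assumes "F \<in> poly_functions n" "x \<in> pts X" "\<And>i. i < n \<Longrightarrow> u i \<in> germs X x"
  shows "(\<lambda>z. F (vec n (\<lambda>i. u i z))) \<in> germs X x"
  using assms(1) by induction (auto intro: germs_const germs_add germs_mult assms(2,3))

text \<open>An algebraic mean value formula. The only step of substance is the product, by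
  \<open>f g - f' g' = g (f - f') + f' (g - g')\<close>.\<close>

lemma poly_function_difference:
  assumes "F \<in> poly_functions n" "x \<in> pts X"
    and u: "\<And>i. i < n \<Longrightarrow> u i \<in> germs X x" and w: "\<And>i. i < n \<Longrightarrow> w i \<in> germs X x"
  shows "\<exists>c. (\<forall>i<n. c i \<in> germs X x) \<and>
    (\<forall>z. F (vec n (\<lambda>i. u i z)) - F (vec n (\<lambda>i. w i z)) = (\<Sum>i<n. c i z * (u i z - w i z)))"
  using assms(1)
proof induction
  case (const c)
  show ?case using germs_const[OF assms(2)] by (intro exI[of _ "\<lambda>_ _. 0"]) auto
next
  case (gen f)
  then obtain i where i: "f = (\<lambda>v. v $ i)" "i < n" by auto
  have "(\<Sum>j<n. (if j = i then 1 else 0) * (u j z - w j z)) = u i z - w i z" for z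
    using i(2) by (simp add: if_distrib[of "\<lambda>a. a * _"] cong: if_cong)
  thus ?case using i germs_const[OF assms(2)]
    by (intro exI[of _ "\<lambda>j _. if j = i then 1 else 0"]) auto
next
  case (add f g)
  from add.IH(1) obtain a where a: "\<And>i. i < n \<Longrightarrow> a i \<in> germs X x"
      "\<And>z. f (vec n (\<lambda>i. u i z)) - f (vec n (\<lambda>i. w i z)) = (\<Sum>i<n. a i z * (u i z - w i z))" by blast
  from add.IH(2) obtain b where b: "\<And>i. i < n \<Longrightarrow> b i \<in> germs X x"
      "\<And>z. g (vec n (\<lambda>i. u i z)) - g (vec n (\<lambda>i. w i z)) = (\<Sum>i<n. b i z * (u i z - w i z))" by blast
  have "f (vec n (\<lambda>i. u i z)) + g (vec n (\<lambda>i. u i z)) - (f (vec n (\<lambda>i. w i z)) + g (vec n (\<lambda>i. w i z))) =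
      (\<Sum>i<n. (a i z + b i z) * (u i z - w i z))" for z
  proof -
    have "f (vec n (\<lambda>i. u i z)) + g (vec n (\<lambda>i. u i z)) - (f (vec n (\<lambda>i. w i z)) + g (vec n (\<lambda>i. w i z))) =
      (\<Sum>i<n. a i z * (u i z - w i z)) + (\<Sum>i<n. b i z * (u i z - w i z))"
      unfolding a(2)[symmetric] b(2)[symmetric] by simp
    thus ?thesis by (simp add: distrib_right sum.distrib)
  qed
  thus ?case using a(1) b(1) by (intro exI[of _ "\<lambda>i z. a i z + b i z"]) (auto intro: germs_add)
next
  case (mult f g)
  from mult.IH(1) obtain a where a: "\<And>i. i < n \<Longrightarrow> a i \<in> germs X x"
      "\<And>z. f (vec n (\<lambda>i. u i z)) - f (vec n (\<lambda>i. w i z)) = (\<Sum>i<n. a i z * (u i z - w i z))" by blast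
  from mult.IH(2) obtain b where b: "\<And>i. i < n \<Longrightarrow> b i \<in> germs X x"
      "\<And>z. g (vec n (\<lambda>i. u i z)) - g (vec n (\<lambda>i. w i z)) = (\<Sum>i<n. b i z * (u i z - w i z))" by blast
  let ?f = "\<lambda>z. f (vec n (\<lambda>i. w i z))" and ?g = "\<lambda>z. g (vec n (\<lambda>i. u i z))"
  have "f (vec n (\<lambda>i. u i z)) * ?g z - ?f z * g (vec n (\<lambda>i. w i z)) =
      (\<Sum>i<n. (?g z * a i z + ?f z * b i z) * (u i z - w i z))" for z
  proof -
    have "f (vec n (\<lambda>i. u i z)) * ?g z - ?f z * g (vec n (\<lambda>i. w i z)) =
      ?g z * (f (vec n (\<lambda>i. u i z)) - ?f z) + ?f z * (?g z - g (vec n (\<lambda>i. w i z)))"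
      by (simp add: algebra_simps)
    also have "\<dots> = ?g z * (\<Sum>i<n. a i z * (u i z - w i z)) + ?f z * (\<Sum>i<n. b i z * (u i z - w i z))"
      by (simp only: a(2) b(2))
    also have "\<dots> = (\<Sum>i<n. (?g z * a i z + ?f z * b i z) * (u i z - w i z))"
      by (simp add: distrib_right sum.distrib sum_distrib_left mult.assoc)
    finally show ?thesis .
  qed
  moreover have "?f \<in> germs X x" "?g \<in> germs X x"
    using mult.hyps assms(2) u w by (auto intro: germs_poly_function)
  ultimately show ?case using a(1) b(1)
    by (intro exI[of _ "\<lambda>i z. ?g z * a i z + ?f z * b i z"]) (auto intro!: germs_add germs_mult)
qed

end

section \<open>Dominant maps\<close>

locale dominant_map = D: irreducible_sheaf D + C: irreducible_sheaf C
  for D :: "('p, 'k::field) fun_space" and C :: "('q, 'k) fun_space" +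
  fixes q :: "'p \<Rightarrow> 'q"
  assumes morphism: "fs_morphism D C q" and surjective: "q ` pts D = pts C"
begin

lemma openin_preimage: "openin (fs_top C) V \<Longrightarrow> openin (fs_top D) {x \<in> pts D. q x \<in> V}"
  using morphism by (auto simp: fs_morphism_def continuous_map_def)

lemma reg_pullback: "openin (fs_top C) V \<Longrightarrow> g \<in> fs_reg C V \<Longrightarrow> (\<lambda>x. g (q x)) \<in> fs_reg D {x \<in> pts D. q x \<in> V}"
  using morphism by (auto simp: fs_morphism_def comp_def)

lemma preimage_nonempty: "openin (fs_top C) V \<Longrightarrow> V \<noteq> {} \<Longrightarrow> {x \<in> pts D. q x \<in> V} \<noteq> {}"
  using surjective openin_subset[of "fs_top C" V] by force

lemma rationals_pullback: "g \<in> rationals C \<Longrightarrow> (\<lambda>x. g (q x)) \<in> rationals D"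
  using openin_preimage reg_pullback preimage_nonempty unfolding rationals_def mem_Collect_eq by meson

lemma germs_pullback: "g \<in> germs C (q x) \<Longrightarrow> x \<in> pts D \<Longrightarrow> (\<lambda>x. g (q x)) \<in> germs D x"
proof -
  assume "g \<in> germs C (q x)" "x \<in> pts D"
  then obtain V where V: "openin (fs_top C) V" "q x \<in> V" "g \<in> fs_reg C V" unfolding germs_def by blast
  have "x \<in> {x \<in> pts D. q x \<in> V}" using V \<open>x \<in> pts D\<close> by simp
  thus ?thesis using openin_preimage[OF V(1)] reg_pullback[OF V(1,3)] unfolding germs_def by blast
qed

lemma gen_pullback: "eventually P (gen C) \<Longrightarrow> \<forall>\<^sub>F x in gen D. P (q x)"
proof -
  assume "eventually P (gen C)"
  from C.eventually_genE[OF this]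
  obtain V where V: "openin (fs_top C) V" "V \<noteq> {}" "\<And>x. x \<in> V \<Longrightarrow> P x" by blast
  thus ?thesis using openin_preimage[OF V(1)] preimage_nonempty[OF V(1,2)]
    by (intro D.eventually_genI[of "{x \<in> pts D. q x \<in> V}"]) auto
qed

lemma gen_zero_pullback:
  assumes "g \<in> rationals C"
  shows "(\<forall>\<^sub>F x in gen D. g (q x) = 0) \<longleftrightarrow> (\<forall>\<^sub>F x in gen C. g x = 0)"
proof
  assume *: "\<forall>\<^sub>F x in gen D. g (q x) = 0"
  show "\<forall>\<^sub>F x in gen C. g x = 0"
  proof (rule ccontr)
    assume "\<not> ?thesis"
    hence "\<forall>\<^sub>F x in gen C. g x \<noteq> 0" using C.rationals_zero_or_nonzero[OF assms] by blast
    from gen_pullback[OF this] * have "\<forall>\<^sub>F x in gen D. False" by eventually_elim simp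
    thus False by simp
  qed
qed (rule gen_pullback)

text \<open>The clause \<open>q x \<in> V\<close> in \<open>pullback\<close> holds generically,
  since the preimage of a nonempty open set is open and nonempty.\<close>

lemma pullback_cls:
  assumes "g \<in> rationals C"
  shows "pullback D q (cls C g) = cls D (\<lambda>x. g (q x))"
proof -
  define L where "L W h \<longleftrightarrow> (\<exists>(V, g)\<in>cls C g. \<forall>x\<in>W. q x \<in> V \<longrightarrow> h x = g (q x))" for W h
  obtain V where V: "openin (fs_top C) V" "V \<noteq> {}" "g \<in> fs_reg C V"
    using assms unfolding rationals_def by blast
  have "L W h \<longleftrightarrow> (\<forall>\<^sub>F x in gen D. g (q x) = h x)"
    if W: "openin (fs_top D) W" "W \<noteq> {}" "h \<in> fs_reg D W" for W h
  proof
    assume "L W h"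
    then obtain b where b: "b \<in> cls C g" "case b of (V, g) \<Rightarrow> \<forall>x\<in>W. q x \<in> V \<longrightarrow> h x = g (q x)"
      unfolding L_def by (elim bexE)
    obtain V g' where "b = (V, g')" by (cases b)
    with b have V: "openin (fs_top C) V" "V \<noteq> {}" "\<forall>\<^sub>F x in gen C. g x = g' x"
      and h: "\<And>x. x \<in> W \<Longrightarrow> q x \<in> V \<Longrightarrow> h x = g' (q x)" by (simp_all add: C.mem_cls)
    have "\<forall>\<^sub>F x in gen D. x \<in> W" using W by (intro D.eventually_genI[of W])
    moreover have "\<forall>\<^sub>F x in gen C. x \<in> V" using V by (intro C.eventually_genI[of V])
    note gen_pullback[OF this]
    moreover note gen_pullback[OF V(3)]
    ultimately show "\<forall>\<^sub>F x in gen D. g (q x) = h x" by eventually_elim (simp add: h)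
  next
    assume *: "\<forall>\<^sub>F x in gen D. g (q x) = h x"
    have "(V, g) \<in> cls C g" using V by (simp add: C.mem_cls)
    moreover have "h x = g (q x)" if x: "x \<in> W" "q x \<in> V" for x
    proof -
      let ?U = "{x \<in> pts D. q x \<in> V} \<inter> W"
      have o: "openin (fs_top D) ?U" using openin_preimage[OF V(1)] W(1) by (rule openin_Int)
      have "h \<in> fs_reg D ?U" by (rule D.reg_restrict[OF W(3,1) o]) auto
      moreover have "(\<lambda>x. g (q x)) \<in> fs_reg D ?U"
        by (rule D.reg_restrict[OF reg_pullback[OF V(1,3)] openin_preimage[OF V(1)] o]) auto
      moreover have "x \<in> ?U" using x openin_subset[OF W(1)] by auto
      ultimately show ?thesis using D.reg_identity[OF o, of "\<lambda>x. g (q x)" h x] * by simp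
    qed
    hence "\<forall>x\<in>W. q x \<in> V \<longrightarrow> h x = g (q x)" by blast
    ultimately show "L W h" unfolding L_def by (intro bexI[of _ "(V, g)"]) simp_all
  qed
  thus ?thesis
    unfolding pullback_def L_def[symmetric] cls_def[of D "\<lambda>x. g (q x)"] D.eventually_gen[symmetric] by blast
qed

text \<open>Allows an integral equation on \<open>C\<close> to be verified on \<open>D\<close>: a
  rational function on \<open>C\<close> is generically 0 iff its pullback is.\<close>

lemma integral_overI:
  assumes g: "g \<in> rationals C" and a: "\<And>i. i < N \<Longrightarrow> a i \<in> germs C c"
    and eq: "\<forall>\<^sub>F x in gen D. g (q x) ^ N + (\<Sum>i<N. a i (q x) * g (q x) ^ i) = 0"
  shows "cls C g \<in> normalized_local_ring C c"
proof -
  let ?K = "function_field C"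
  have ar: "a i \<in> rationals C" if "i < N" for i using a[OF that] by (rule germs_rationals)
  have r: "(\<lambda>x. \<Sum>i<N. a i x * g x ^ i) \<in> rationals C"
    using ar by (intro C.rationals_sum C.rationals_mult C.rationals_power g) auto
  have "(\<Oplus>\<^bsub>?K\<^esub>i\<in>{..<N}. cls C (a i) \<otimes>\<^bsub>?K\<^esub> cls C g [^]\<^bsub>?K\<^esub> i) =
      (\<Oplus>\<^bsub>?K\<^esub>i\<in>{..<N}. cls C (\<lambda>x. a i x * g x ^ i))"
  proof -
    interpret K: cring ?K by (rule C.cring_function_field)
    show ?thesis using ar g
      by (intro K.add.finprod_cong')
        (auto simp: C.cls_power C.cls_mult C.rationals_power C.rationals_mult C.cls_in_carrier)
  qed
  also have "\<dots> = cls C (\<lambda>x. \<Sum>i<N. a i x * g x ^ i)"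
    using ar g by (intro C.cls_sum) (auto intro: C.rationals_mult C.rationals_power)
  finally have "cls C g [^]\<^bsub>?K\<^esub> N \<oplus>\<^bsub>?K\<^esub> (\<Oplus>\<^bsub>?K\<^esub>i\<in>{..<N}. cls C (a i) \<otimes>\<^bsub>?K\<^esub> cls C g [^]\<^bsub>?K\<^esub> i) =
     cls C (\<lambda>x. g x ^ N + (\<Sum>i<N. a i x * g x ^ i))"
    using g r by (simp add: C.cls_power C.cls_add C.rationals_power)
  also have "\<dots> = \<zero>\<^bsub>?K\<^esub>"
    using gen_zero_pullback[of "\<lambda>x. g x ^ N + (\<Sum>i<N. a i x * g x ^ i)"] eq
      C.rationals_add[OF C.rationals_power[OF g] r, of N]
    by (subst C.cls_eq_zero_iff) auto
  finally have "integral_over ?K (local_ring C c) (cls C g)"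
    unfolding integral_over_def C.local_ring_eq using a
    by (intro exI[of _ N] exI[of _ "\<lambda>i. cls C (a i)"]) auto
  thus ?thesis using g by (simp add: normalized_local_ring_def C.cls_in_carrier)
qed

end

section \<open>Places of function fields\<close>

text \<open>Read \<open>B f a\<close> as: \<open>f\<close> is finite at the place and has residue
  \<open>a\<close>. A valuation ring with residue field \<open>k\<close> is encoded by its residue
  map, as a relation that is compatible with generic equality; a pole is the absence of a
  value.\<close>

locale place = irreducible_sheaf X for X :: "('p, 'k::alg_closed_field) fun_space" +
  fixes B :: "('p \<Rightarrow> 'k) \<Rightarrow> 'k \<Rightarrow> bool"
  assumes B_rationals: "B f a \<Longrightarrow> f \<in> rationals X"
    and B_const: "B (\<lambda>_. c) c"
    and B_add: "B f a \<Longrightarrow> B g b \<Longrightarrow> B (\<lambda>z. f z + g z) (a + b)"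
    and B_mult: "B f a \<Longrightarrow> B g b \<Longrightarrow> B (\<lambda>z. f z * g z) (a * b)"
    and B_cong: "B f a \<Longrightarrow> \<forall>\<^sub>F z in gen X. g z = f z \<Longrightarrow> B g a"
    and B_zero: "B f a \<Longrightarrow> \<forall>\<^sub>F z in gen X. f z = 0 \<Longrightarrow> a = 0"
    and B_inverse: "B f a \<Longrightarrow> a \<noteq> 0 \<Longrightarrow> B (\<lambda>z. inverse (f z)) (inverse a)"
    and B_total: "f \<in> rationals X \<Longrightarrow> (\<exists>a. B f a) \<or> (\<exists>a. B (\<lambda>z. inverse (f z)) a)"

lemma sum_fun_apply: "(\<Sum>i\<in>A. f i) z = (\<Sum>i\<in>A. f i z :: 'b::comm_monoid_add)"
  by (induction A rule: infinite_finite_induct) (auto simp: zero_fun_def plus_fun_def)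

lemma power_fun_apply: "(f ^ n) z = (f z ^ n :: 'b::comm_semiring_1)"
  by (induction n) (auto simp: one_fun_def times_fun_def)

text \<open>\<open>A\<close> is a partial evaluation on a ring of rational functions. The hypothesis
  on relations says that sending \<open>t\<close> to 0 is consistent with it, because evaluating a
  relation would leave only its constant coefficient. For \<open>N = 0\<close> it makes the values
  of \<open>A\<close> well defined up to generic equality.\<close>

theorem place_extension:
  fixes X :: "('p, 'k::alg_closed_field) fun_space" and A :: "('p \<Rightarrow> 'k) \<Rightarrow> 'k \<Rightarrow> bool"
  assumes "irreducible_sheaf X"
    and A_rationals: "\<And>f a. A f a \<Longrightarrow> f \<in> rationals X"
    and A_const: "\<And>c. A (\<lambda>_. c) c"
    and A_diff: "\<And>f g a b. A f a \<Longrightarrow> A g b \<Longrightarrow> A (\<lambda>z. f z - g z) (a - b)"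
    and A_mult: "\<And>f g a b. A f a \<Longrightarrow> A g b \<Longrightarrow> A (\<lambda>z. f z * g z) (a * b)"
    and t: "t \<in> rationals X"
    and relation: "\<And>N f a. (\<And>i. i \<le> N \<Longrightarrow> A (f i) (a i)) \<Longrightarrow>
      \<forall>\<^sub>F z in gen X. (\<Sum>i\<le>N. f i z * t z ^ i) = 0 \<Longrightarrow> a 0 = 0"
  obtains B where "place X B" "\<And>f a. A f a \<Longrightarrow> B f a" "B t 0"
proof -
  interpret irreducible_sheaf X by fact
  \<comment> \<open>The point \<open>None\<close> carries a prospective residue beside the rational
    function stored at the points \<open>Some z\<close>. The two parts vary independently, so every
    element of \<open>E\<close> is congruent to one with any given value, as \<open>v_lift\<close>
    demands.\<close>
  define E where "E = {w. (\<lambda>z. w (Some z)) \<in> rationals X}"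
  define P where "P = {w :: 'p option \<Rightarrow> 'k. \<forall>\<^sub>F z in gen X. w (Some z) = 0}"
  define v where "v w = w None" for w :: "'p option \<Rightarrow> 'k"
  define ext where "ext f a = case_option (a::'k) f" for f :: "'p \<Rightarrow> 'k" and a
  have ext [simp]: "ext f a (Some z) = f z" "ext f a None = a" for f a z by (auto simp: ext_def)
  interpret residue_setting E P v
  proof
    show "1 \<in> E" by (simp add: E_def one_fun_def rationals_const)
    show "x - y \<in> E" if "x \<in> E" "y \<in> E" for x y using that by (simp add: E_def fun_diff_def rationals_diff)
    show "x * y \<in> E" if "x \<in> E" "y \<in> E" for x y using that by (simp add: E_def times_fun_def rationals_mult)
    show "P \<subseteq> E" using rationals_cong[OF _ rationals_const] by (auto simp: P_def E_def)
    show "0 \<in> P" by (simp add: P_def zero_fun_def)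
    show "x + y \<in> P" if "x \<in> P" "y \<in> P" for x y
    proof -
      have "\<forall>\<^sub>F z in gen X. x (Some z) = 0" "\<forall>\<^sub>F z in gen X. y (Some z) = 0" using that by (auto simp: P_def)
      hence "\<forall>\<^sub>F z in gen X. x (Some z) + y (Some z) = 0" by eventually_elim simp
      thus ?thesis by (simp add: P_def plus_fun_def)
    qed
    show "x * y \<in> P" if "y \<in> P" for x y
    proof -
      have "\<forall>\<^sub>F z in gen X. y (Some z) = 0" using that by (auto simp: P_def)
      hence "\<forall>\<^sub>F z in gen X. x (Some z) * y (Some z) = 0" by eventually_elim simp
      thus ?thesis by (simp add: P_def times_fun_def)
    qed
    show "\<exists>y\<in>E. x * y - 1 \<in> P" if x: "x \<in> E" "x \<notin> P" for x
    proof -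
      have "\<forall>\<^sub>F z in gen X. x (Some z) \<noteq> 0"
        using x rationals_zero_or_nonzero[of "\<lambda>z. x (Some z)"] by (auto simp: E_def P_def)
      hence "\<forall>\<^sub>F z in gen X. x (Some z) * inverse (x (Some z)) - 1 = 0" by eventually_elim simp
      moreover have "(\<lambda>z. inverse (x (Some z))) \<in> rationals X" using x by (simp add: E_def rationals_inverse)
      ultimately show ?thesis
        by (intro bexI[of _ "\<lambda>z. inverse (x z)"]) (auto simp: E_def P_def times_fun_def fun_diff_def one_fun_def)
    qed
    show "v 1 = 1" "v (x + y) = v x + v y" "v (x * y) = v x * v y" for x y
      by (auto simp: v_def one_fun_def plus_fun_def times_fun_def)
    show "\<exists>x'\<in>E. x' - x \<in> P \<and> v x' = c" if "x \<in> E" for x c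
      using that by (intro bexI[of _ "ext (\<lambda>z. x (Some z)) c"]) (auto simp: E_def P_def v_def fun_diff_def)
  qed
  define \<Gamma>0 where "\<Gamma>0 = {w. A (\<lambda>z. w (Some z)) (w None)}"
  have "valid \<Gamma>0"
    unfolding valid_def
  proof (intro conjI ballI)
    show "1 \<in> \<Gamma>0" by (simp add: \<Gamma>0_def one_fun_def A_const)
    show "\<Gamma>0 \<subseteq> E" using A_rationals by (auto simp: \<Gamma>0_def E_def)
    show "x - y \<in> \<Gamma>0" "x * y \<in> \<Gamma>0" if "x \<in> \<Gamma>0" "y \<in> \<Gamma>0" for x y
      using that A_diff A_mult by (auto simp: \<Gamma>0_def fun_diff_def times_fun_def)
    show "v x = 0" if "x \<in> \<Gamma>0 \<inter> P" for x
      using that relation[of 0 "\<lambda>_ z. x (Some z)" "\<lambda>_. x None"] by (auto simp: \<Gamma>0_def P_def v_def)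
  qed
  moreover have "ext t 0 \<in> E" using t by (simp add: E_def)
  \<comment> \<open>Evaluation at residue 0 kills all but the constant coefficient of
    \<open>p\<close>, and \<open>relation\<close> controls that one.\<close>
  moreover have "v (poly p (ext t 0)) = 0" if p: "p \<in> polys \<Gamma>0" "poly p (ext t 0) \<in> P" for p
  proof -
    have "coeff p i \<in> \<Gamma>0" for i using p(1) by (rule polysD)
    hence "A (\<lambda>z. coeff p i (Some z)) (coeff p i None)" for i by (simp add: \<Gamma>0_def)
    moreover have "\<forall>\<^sub>F z in gen X. (\<Sum>i\<le>degree p. coeff p i (Some z) * t z ^ i) = 0"
      using p(2) by (simp add: P_def poly_altdef sum_fun_apply power_fun_apply times_fun_def)
    ultimately have "coeff p 0 None = 0"
      using relation[of "degree p" "\<lambda>i z. coeff p i (Some z)" "\<lambda>i. coeff p i None"] by blast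
    moreover have "v (poly p (ext t 0)) = v (coeff p 0)"
      using v_poly[of p "ext t 0"] by (simp add: v_def[of "ext t 0"] poly_0_coeff_0 coeff_map_poly v_0)
    ultimately show ?thesis by (simp add: v_def)
  qed
  ultimately have ex: "valid ((\<lambda>p. poly p (ext t 0)) ` polys \<Gamma>0)"
    "\<Gamma>0 \<subseteq> (\<lambda>p. poly p (ext t 0)) ` polys \<Gamma>0" "ext t 0 \<in> (\<lambda>p. poly p (ext t 0)) ` polys \<Gamma>0"
    using valid_extension[of \<Gamma>0 "ext t 0"] by blast+
  have "\<exists>x\<in>(\<lambda>p. poly p (ext t 0)) ` polys \<Gamma>0. v x = c" for c
    using ex(2) A_const[of c] by (intro bexI[of _ "\<lambda>_. c"]) (auto simp: v_def \<Gamma>0_def)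
  from place_exists[OF ex(1) this] obtain \<Gamma> where \<Gamma>: "valid \<Gamma>"
    "(\<lambda>p. poly p (ext t 0)) ` polys \<Gamma>0 \<subseteq> \<Gamma>"
    "\<And>x y. x \<in> \<Gamma> \<Longrightarrow> v x \<noteq> 0 \<Longrightarrow> y \<in> E \<Longrightarrow> x * y - 1 \<in> P \<Longrightarrow> \<exists>y'\<in>\<Gamma>. y' - y \<in> P"
    "\<And>x y. x \<in> E \<Longrightarrow> y \<in> E \<Longrightarrow> x * y - 1 \<in> P \<Longrightarrow> (\<exists>x'\<in>\<Gamma>. x' - x \<in> P) \<or> (\<exists>y'\<in>\<Gamma>. y' - y \<in> P)"
    by blast
  note val = validD[OF \<Gamma>(1)]
  \<comment> \<open>\<open>\<Gamma>\<close> need not contain every function of a class, so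
    membership is relaxed to generic equality with an element of \<open>\<Gamma>\<close>. The
    residue is unique because \<open>v\<close> vanishes on
    \<open>\<Gamma> \<inter> P\<close>.\<close>
  define B where "B f a \<longleftrightarrow> (\<exists>w\<in>\<Gamma>. (\<forall>\<^sub>F z in gen X. w (Some z) = f z) \<and> w None = a)" for f a
  have BI: "B f a" if "w \<in> \<Gamma>" "\<forall>\<^sub>F z in gen X. w (Some z) = f z" "w None = a" for w f a
    using that by (auto simp: B_def)
  have A_B: "B f a" if "A f a" for f a
  proof (rule BI)
    have "ext f a \<in> \<Gamma>0" using that by (simp add: \<Gamma>0_def)
    thus "ext f a \<in> \<Gamma>" using ex(2) \<Gamma>(2) by blast
  qed simp_all
  have "place X B"
  proof
    show B_rat: "f \<in> rationals X" if "B f a" for f a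
    proof -
      obtain w where w: "w \<in> \<Gamma>" "\<forall>\<^sub>F z in gen X. w (Some z) = f z" using \<open>B f a\<close> by (auto simp: B_def)
      have "\<forall>\<^sub>F z in gen X. f z = w (Some z)" using w(2) by eventually_elim simp
      thus ?thesis using rationals_cong w(1) val(3) by (auto simp: E_def)
    qed
    show "B (\<lambda>_. c) c" for c using A_B A_const by blast
    show "B (\<lambda>z. f z + g z) (a + b)" "B (\<lambda>z. f z * g z) (a * b)" if "B f a" "B g b" for f g a b
    proof -
      obtain w u where w: "w \<in> \<Gamma>" "\<forall>\<^sub>F z in gen X. w (Some z) = f z" "w None = a"
        and u: "u \<in> \<Gamma>" "\<forall>\<^sub>F z in gen X. u (Some z) = g z" "u None = b"
        using \<open>B f a\<close> \<open>B g b\<close> unfolding B_def by blast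
      have "\<forall>\<^sub>F z in gen X. (w + u) (Some z) = f z + g z"
        using w(2) u(2) by eventually_elim (simp add: plus_fun_def)
      thus "B (\<lambda>z. f z + g z) (a + b)" using w(1,3) u(1,3) val(8)[of w u]
        by (intro BI[of "w + u"]) (auto simp: plus_fun_def)
      have "\<forall>\<^sub>F z in gen X. (w * u) (Some z) = f z * g z"
        using w(2) u(2) by eventually_elim (simp add: times_fun_def)
      thus "B (\<lambda>z. f z * g z) (a * b)" using w(1,3) u(1,3) val(6)[of w u]
        by (intro BI[of "w * u"]) (auto simp: times_fun_def)
    qed
    show "B g a" if "B f a" "\<forall>\<^sub>F z in gen X. g z = f z" for f g a
    proof -
      obtain w where w: "w \<in> \<Gamma>" "\<forall>\<^sub>F z in gen X. w (Some z) = f z" "w None = a"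
        using \<open>B f a\<close> unfolding B_def by blast
      have "\<forall>\<^sub>F z in gen X. w (Some z) = g z" using w(2) that(2) by eventually_elim simp
      thus ?thesis using w by (intro BI[of w])
    qed
    show "a = 0" if "B f a" "\<forall>\<^sub>F z in gen X. f z = 0" for f a
    proof -
      obtain w where w: "w \<in> \<Gamma>" "\<forall>\<^sub>F z in gen X. w (Some z) = f z" "w None = a"
        using \<open>B f a\<close> unfolding B_def by blast
      have "\<forall>\<^sub>F z in gen X. w (Some z) = 0" using w(2) that(2) by eventually_elim simp
      hence "v w = 0" using val(4)[OF w(1)] by (simp add: P_def)
      thus ?thesis using w by (simp add: v_def)
    qed
    note zero = this
    have diff: "B f (w None)" if "w \<in> \<Gamma>" "w - ext f c \<in> P" for w f c
    proof (rule BI[OF that(1)])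
      have "\<forall>\<^sub>F z in gen X. w (Some z) - f z = 0" using that(2) by (simp add: P_def fun_diff_def)
      thus "\<forall>\<^sub>F z in gen X. w (Some z) = f z" by eventually_elim simp
    qed simp
    show "B (\<lambda>z. inverse (f z)) (inverse a)" if f: "B f a" "a \<noteq> 0" for f a
    proof -
      obtain w where w: "w \<in> \<Gamma>" "\<forall>\<^sub>F z in gen X. w (Some z) = f z" "w None = a"
        using f(1) unfolding B_def by blast
      have fr: "f \<in> rationals X" by (rule B_rat[OF f(1)])
      have "\<forall>\<^sub>F z in gen X. f z \<noteq> 0" using rationals_zero_or_nonzero[OF fr] zero[OF f(1)] f(2) by blast
      with w(2) have "\<forall>\<^sub>F z in gen X. (w * ext (\<lambda>z. inverse (f z)) 0 - 1) (Some z) = 0"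
        by eventually_elim (simp add: times_fun_def fun_diff_def one_fun_def)
      hence P: "w * ext (\<lambda>z. inverse (f z)) 0 - 1 \<in> P" by (simp add: P_def)
      have E: "ext (\<lambda>z. inverse (f z)) 0 \<in> E" using rationals_inverse[OF fr] by (simp add: E_def)
      obtain y where y: "y \<in> \<Gamma>" "y - ext (\<lambda>z. inverse (f z)) 0 \<in> P"
        using \<Gamma>(3)[OF w(1) _ E P] w(3) f(2) by (auto simp: v_def)
      have By: "B (\<lambda>z. inverse (f z)) (y None)" by (rule diff[OF y])
      \<comment> \<open>The closure property of \<open>\<Gamma>\<close> only yields some
        representative \<open>y\<close> of the inverse of \<open>f\<close>. Its residue is the
        inverse of \<open>a\<close> because \<open>w * y - 1\<close> lies in
        \<open>\<Gamma> \<inter> P\<close>.\<close>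
      have "w * (y - ext (\<lambda>z. inverse (f z)) 0) + (w * ext (\<lambda>z. inverse (f z)) 0 - 1) \<in> P"
        using y(2) P w(1) val(3) by (intro P_add P_mult) auto
      hence "w * y - 1 \<in> P" by (simp add: right_diff_distrib)
      moreover have "w * y - 1 \<in> \<Gamma>" using w(1) y(1) val by simp
      ultimately have "v (w * y - 1) = 0" using val(4) by blast
      hence "a * y None = 1" using w(3) by (simp add: v_def times_fun_def fun_diff_def one_fun_def)
      hence "y None = inverse a" by (metis inverse_unique)
      thus ?thesis using By by simp
    qed
    show "(\<exists>a. B f a) \<or> (\<exists>a. B (\<lambda>z. inverse (f z)) a)" if f: "f \<in> rationals X" for f
    proof (cases "\<forall>\<^sub>F z in gen X. f z = 0")
      case True
      hence "B f 0" using val(2) by (intro BI[of 0]) (auto simp: zero_fun_def elim: eventually_mono)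
      thus ?thesis by blast
    next
      case False
      hence "\<forall>\<^sub>F z in gen X. f z \<noteq> 0" using rationals_zero_or_nonzero[OF f] by blast
      hence "\<forall>\<^sub>F z in gen X. (ext f 0 * ext (\<lambda>z. inverse (f z)) 0 - 1) (Some z) = 0"
        by eventually_elim (simp add: times_fun_def fun_diff_def one_fun_def)
      hence "ext f 0 * ext (\<lambda>z. inverse (f z)) 0 - 1 \<in> P" by (simp add: P_def)
      moreover have "ext f 0 \<in> E" "ext (\<lambda>z. inverse (f z)) 0 \<in> E"
        using rationals_inverse[OF f] f by (simp_all add: E_def)
      ultimately have "(\<exists>x'\<in>\<Gamma>. x' - ext f 0 \<in> P) \<or> (\<exists>y'\<in>\<Gamma>. y' - ext (\<lambda>z. inverse (f z)) 0 \<in> P)"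
        using \<Gamma>(4) by blast
      thus ?thesis using diff by blast
    qed
  qed
  moreover have "B t 0" using ex(3) \<Gamma>(2) by (intro BI[of "ext t 0"]) auto
  ultimately show ?thesis using A_B that by blast
qed

section \<open>Morphisms and separatedness\<close>

lemma fs_morphism_compose:
  assumes "fs_morphism X Y f" "fs_morphism Y Z g"
  shows "fs_morphism X Z (\<lambda>x. g (f x))"
proof -
  have f: "continuous_map (fs_top X) (fs_top Y) f" and g: "continuous_map (fs_top Y) (fs_top Z) g"
    using assms by (auto simp: fs_morphism_def)
  have eq: "{x \<in> pts X. g (f x) \<in> V} = {x \<in> pts X. f x \<in> {y \<in> pts Y. g y \<in> V}}" for V
    using continuous_map_funspace[OF f] by auto
  show ?thesis
    unfolding fs_morphism_def
  proof (intro conjI allI impI ballI)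
    show "continuous_map (fs_top X) (fs_top Z) (\<lambda>x. g (f x))"
      using continuous_map_compose[OF f g] by (simp add: comp_def)
    fix V \<phi> assume V: "openin (fs_top Z) V" and \<phi>: "\<phi> \<in> fs_reg Z V"
    have "openin (fs_top Y) {y \<in> pts Y. g y \<in> V}" using g V by (auto simp: continuous_map_def)
    moreover have "\<phi> \<circ> g \<in> fs_reg Y {y \<in> pts Y. g y \<in> V}" using assms(2) V \<phi> by (auto simp: fs_morphism_def)
    ultimately have "(\<phi> \<circ> g) \<circ> f \<in> fs_reg X {x \<in> pts X. f x \<in> {y \<in> pts Y. g y \<in> V}}"
      using assms(1) unfolding fs_morphism_def by blast
    thus "\<phi> \<circ> (\<lambda>x. g (f x)) \<in> fs_reg X {x \<in> pts X. g (f x) \<in> V}" unfolding eq by (simp add: comp_def)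
  qed
qed

lemma fs_morphism_induced:
  assumes "fs_morphism X Y f" "\<And>x. x \<in> W \<Longrightarrow> f x \<in> Z"
  shows "fs_morphism (induced X W) (induced Y Z) f"
proof -
  have f: "continuous_map (fs_top X) (fs_top Y) f" using assms by (auto simp: fs_morphism_def)
  show ?thesis
    unfolding fs_morphism_def
  proof (intro conjI allI impI ballI)
    show "continuous_map (fs_top (induced X W)) (fs_top (induced Y Z)) f"
      using assms(2) continuous_map_from_subtopology[OF f, of W]
      by (auto simp: continuous_map_in_subtopology)
    fix V \<phi> assume V: "openin (fs_top (induced Y Z)) V" and \<phi>: "\<phi> \<in> fs_reg (induced Y Z) V"
    show "\<phi> \<circ> f \<in> fs_reg (induced X W) {x \<in> pts (induced X W). f x \<in> V}"
    proof (rule reg_inducedI)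
      fix x assume x: "x \<in> {x \<in> pts (induced X W). f x \<in> V}"
      then obtain U g where U: "openin (fs_top Y) U" "f x \<in> U" "g \<in> fs_reg Y U"
        "\<And>z. z \<in> U \<Longrightarrow> z \<in> V \<Longrightarrow> \<phi> z = g z" using reg_inducedE[OF \<phi>, of "f x"] by blast
      have "openin (fs_top X) {x \<in> pts X. f x \<in> U}" using f U(1) by (auto simp: continuous_map_def)
      moreover have "g \<circ> f \<in> fs_reg X {x \<in> pts X. f x \<in> U}"
        using assms(1) U by (auto simp: fs_morphism_def)
      moreover have "\<forall>z\<in>{x \<in> pts X. f x \<in> U} \<inter> {x \<in> pts (induced X W). f x \<in> V}. (\<phi> \<circ> f) z = (g \<circ> f) z"
        using U(4) by auto
      ultimately show "\<exists>T g. openin (fs_top X) T \<and> x \<in> T \<and> g \<in> fs_reg X T \<and>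
          (\<forall>z\<in>T \<inter> {x \<in> pts (induced X W). f x \<in> V}. (\<phi> \<circ> f) z = g z)"
        using x U(2) by (intro exI[of _ "{x \<in> pts X. f x \<in> U}"] exI[of _ "g \<circ> f"]) auto
    qed
  qed
qed

lemma fs_morphism_inclusion: "fs_morphism (induced X U) X (\<lambda>x. x)"
  unfolding fs_morphism_def
proof (intro conjI allI impI ballI)
  show "continuous_map (fs_top (induced X U)) (fs_top X) (\<lambda>x. x)"
    using continuous_map_from_subtopology[OF continuous_map_id, of "fs_top X" U] by (simp add: id_def)
  fix V \<phi> assume "openin (fs_top X) V" "\<phi> \<in> fs_reg X V"
  thus "\<phi> \<circ> (\<lambda>x. x) \<in> fs_reg (induced X U) {x \<in> pts (induced X U). x \<in> V}"
    by (intro reg_inducedI exI[of _ V] exI[of _ \<phi>]) auto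
qed

section \<open>The Zariski topology of affine space\<close>

lemma openin_affine_basic: "f \<in> poly_functions n \<Longrightarrow> openin (fs_top (affine_space n)) {v \<in> carrier_vec n. f v \<noteq> 0}"
  unfolding affine_space_def Let_def by (auto intro!: topology_generated_by_Basis)

text \<open>Products of polynomials make the basic sets closed under intersection, so every point of
  an open set has a principal neighbourhood inside it.\<close>

lemma openin_affineE:
  assumes "openin (fs_top (affine_space n)) U" "v \<in> U"
  obtains f where "f \<in> poly_functions n" "f v \<noteq> (0::'k::field)" "\<And>w. w \<in> carrier_vec n \<Longrightarrow> f w \<noteq> 0 \<Longrightarrow> w \<in> U"
proof -
  have "generate_topology_on {{v \<in> carrier_vec n. f v \<noteq> (0::'k)} | f. f \<in> poly_functions n} U"
    using assms(1) by (simp add: affine_space_def openin_topology_generated_by_iff)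
  hence "\<forall>v\<in>U. \<exists>f\<in>poly_functions n. f v \<noteq> 0 \<and> (\<forall>w\<in>carrier_vec n. f w \<noteq> 0 \<longrightarrow> w \<in> U)"
  proof (induction rule: generate_topology_on.induct)
    case (Int a b)
    show ?case
    proof
      fix v assume v: "v \<in> a \<inter> b"
      obtain f where f: "f \<in> poly_functions n" "f v \<noteq> 0" "\<forall>w\<in>carrier_vec n. f w \<noteq> 0 \<longrightarrow> w \<in> a" using Int v by blast
      obtain g where g: "g \<in> poly_functions n" "g v \<noteq> 0" "\<forall>w\<in>carrier_vec n. g w \<noteq> 0 \<longrightarrow> w \<in> b" using Int v by blast
      show "\<exists>f\<in>poly_functions n. f v \<noteq> 0 \<and> (\<forall>w\<in>carrier_vec n. f w \<noteq> 0 \<longrightarrow> w \<in> a \<inter> b)"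
        using f g fun_algebra.mult[OF f(1) g(1)] by (intro bexI[of _ "\<lambda>w. f w * g w"]) auto
    qed
  next
    case (UN K)
    show ?case
    proof
      fix v assume "v \<in> \<Union>K"
      then obtain k where k: "k \<in> K" "v \<in> k" by blast
      then obtain f where "f \<in> poly_functions n" "f v \<noteq> 0" "\<forall>w\<in>carrier_vec n. f w \<noteq> 0 \<longrightarrow> w \<in> k"
        using UN.IH[OF k(1)] by blast
      thus "\<exists>f\<in>poly_functions n. f v \<noteq> 0 \<and> (\<forall>w\<in>carrier_vec n. f w \<noteq> 0 \<longrightarrow> w \<in> \<Union>K)"
        using k(1) by (intro bexI[of _ f]) auto
    qed
  next
    case (Basis s)
    then obtain f where f: "f \<in> poly_functions n" "s = {v \<in> carrier_vec n. f v \<noteq> 0}" by blast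
    show ?case by (intro ballI bexI[OF _ f(1)]) (auto simp: f(2))
  qed simp
  thus ?thesis using assms(2) that by blast
qed

lemma pts_affine_space: "pts (affine_space n) = (carrier_vec n :: 'k::field vec set)"
proof
  show "pts (affine_space n) \<subseteq> (carrier_vec n :: 'k vec set)"
    by (auto simp: affine_space_def Let_def topology_generated_by_topspace)
  have "openin (fs_top (affine_space n)) {v::'k vec. v \<in> carrier_vec n \<and> (1::'k) \<noteq> 0}"
    using openin_affine_basic[OF fun_algebra.const, of n "1::'k"] by simp
  thus "carrier_vec n \<subseteq> (pts (affine_space n) :: 'k vec set)" by (auto dest: openin_subset)
qed

lemma reg_affine_space:
  "\<phi> \<in> fs_reg (affine_space n) U \<longleftrightarrow> (\<forall>x\<in>U. \<exists>W. openin (fs_top (affine_space n)) W \<and> x \<in> W \<and> W \<subseteq> U \<and>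
     (\<exists>f\<in>poly_functions n. \<exists>g\<in>poly_functions n. \<forall>v\<in>W. g v \<noteq> 0 \<and> \<phi> v = f v / g v))"
  unfolding affine_space_def Let_def by simp

lemma poly_function_reg_affine:
  assumes "f \<in> poly_functions n" "openin (fs_top (affine_space n)) U"
  shows "f \<in> fs_reg (affine_space n) U"
  unfolding reg_affine_space
proof
  fix x assume x: "x \<in> U"
  have "\<forall>v\<in>U. (1::'a) \<noteq> 0 \<and> f v = f v / 1" by simp
  moreover have "(\<lambda>_. 1) \<in> poly_functions n" by (rule fun_algebra.const)
  ultimately have "\<exists>f'\<in>poly_functions n. \<exists>g\<in>poly_functions n. \<forall>v\<in>U. g v \<noteq> 0 \<and> f v = f' v / g v"
    using assms(1) by (intro bexI[of _ f] bexI[of _ "\<lambda>_. 1"])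
  thus "\<exists>W. openin (fs_top (affine_space n)) W \<and> x \<in> W \<and> W \<subseteq> U \<and>
     (\<exists>f'\<in>poly_functions n. \<exists>g\<in>poly_functions n. \<forall>v\<in>W. g v \<noteq> 0 \<and> f v = f' v / g v)"
    using x assms(2) by (intro exI[of _ U]) simp
qed

text \<open>Needed for the two projections of affine space of dimension \<open>N + N'\<close>, with
  \<open>s\<close> the identity or the shift by \<open>N\<close>.\<close>

lemma fs_morphism_coordinates:
  assumes s: "\<And>i. i < N \<Longrightarrow> s i < K"
  shows "fs_morphism (affine_space K :: ('k::field vec, 'k) fun_space) (affine_space N) (\<lambda>v. vec N (\<lambda>i. v $ s i))"
    (is "fs_morphism _ _ ?p")
proof -
  have poly: "(\<lambda>v. f (?p v)) \<in> poly_functions K" if "f \<in> poly_functions N" for f :: "'k vec \<Rightarrow> 'k"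
    using that
  proof induction
    case (gen f)
    then obtain i where "f = (\<lambda>v. v $ i)" "i < N" by blast
    thus ?case using s by (auto intro!: fun_algebra.gen)
  qed (auto intro: fun_algebra.const fun_algebra.add fun_algebra.mult)
  have op: "openin (fs_top (affine_space K)) {v \<in> carrier_vec K. ?p v \<in> U}"
    if U: "openin (fs_top (affine_space N)) U" for U :: "'k vec set"
  proof (subst openin_subopen, rule ballI)
    fix v assume v: "v \<in> {v \<in> carrier_vec K. ?p v \<in> U}"
    then obtain f where f: "f \<in> poly_functions N" "f (?p v) \<noteq> 0" "\<And>w. w \<in> carrier_vec N \<Longrightarrow> f w \<noteq> 0 \<Longrightarrow> w \<in> U"
      using openin_affineE[OF U, of "?p v"] by blast
    show "\<exists>T. openin (fs_top (affine_space K)) T \<and> v \<in> T \<and> T \<subseteq> {v \<in> carrier_vec K. ?p v \<in> U}"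
      using openin_affine_basic[OF poly[OF f(1)]] f(2,3) v
      by (intro exI[of _ "{v \<in> carrier_vec K. f (?p v) \<noteq> 0}"]) auto
  qed
  show ?thesis
    unfolding fs_morphism_def continuous_map_def pts_affine_space
  proof (intro conjI allI impI ballI op)
    show "?p \<in> carrier_vec K \<rightarrow> carrier_vec N" by auto
    fix V and \<phi> :: "'k vec \<Rightarrow> 'k" assume V: "openin (fs_top (affine_space N)) V" and \<phi>: "\<phi> \<in> fs_reg (affine_space N) V"
    show "\<phi> \<circ> ?p \<in> fs_reg (affine_space K) {x \<in> carrier_vec K. ?p x \<in> V}"
      unfolding reg_affine_space
    proof
      fix x assume x: "x \<in> {x \<in> carrier_vec K. ?p x \<in> V}"
      hence "?p x \<in> V" by simp
      from bspec[OF \<phi>[unfolded reg_affine_space] this]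
      obtain W f g where W: "openin (fs_top (affine_space N)) W" "?p x \<in> W" "W \<subseteq> V" "f \<in> poly_functions N"
        "g \<in> poly_functions N" "\<forall>v\<in>W. g v \<noteq> 0 \<and> \<phi> v = f v / g v" by (elim exE conjE bexE)
      have "\<forall>v\<in>{v \<in> carrier_vec K. ?p v \<in> W}. g (?p v) \<noteq> 0 \<and> (\<phi> \<circ> ?p) v = f (?p v) / g (?p v)"
        using W(6) by simp
      hence "\<exists>f\<in>poly_functions K. \<exists>g\<in>poly_functions K.
          \<forall>v\<in>{v \<in> carrier_vec K. ?p v \<in> W}. g v \<noteq> 0 \<and> (\<phi> \<circ> ?p) v = f v / g v"
        by (intro bexI[OF _ poly[OF W(4)]] bexI[OF _ poly[OF W(5)]])
      thus "\<exists>W. openin (fs_top (affine_space K)) W \<and> x \<in> W \<and> W \<subseteq> {x \<in> carrier_vec K. ?p x \<in> V} \<and>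
          (\<exists>f\<in>poly_functions K. \<exists>g\<in>poly_functions K. \<forall>v\<in>W. g v \<noteq> 0 \<and> (\<phi> \<circ> ?p) v = f v / g v)"
        using op[OF W(1)] x W(2,3) by (intro exI[of _ "{v \<in> carrier_vec K. ?p v \<in> W}"]) auto
    qed
  qed
qed

section \<open>Affine charts and separation of points\<close>

context irreducible_sheaf
begin

text \<open>Turns the isomorphism of a chart into data about germs: coordinates \<open>f\<close>
  that are regular at each point of \<open>U\<close>, and an inverse \<open>g\<close> whose target
  is all of \<open>X\<close>, as the definition of \<open>separated\<close> requires.\<close>

lemma affine_chart:
  assumes "prevariety X" "c \<in> pts X"
  obtains U N Z g f where "openin (fs_top X) U" "c \<in> U" "closedin (fs_top (affine_space N)) Z"
    "fs_morphism (induced (affine_space N) Z) X g" "\<And>x. x \<in> U \<Longrightarrow> f x \<in> Z" "\<And>x. x \<in> U \<Longrightarrow> g (f x) = x"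
    "\<And>i x. i < N \<Longrightarrow> x \<in> U \<Longrightarrow> (\<lambda>x. f x $ i) \<in> germs X x"
proof -
  obtain U where U: "openin (fs_top X) U" "c \<in> U" "affine_variety (induced X U)"
    using assms unfolding prevariety_def by blast
  have U_pts: "pts (induced X U) = U" using openin_subset[OF U(1)] by auto
  from U(3) obtain N Z where Z: "closedin (fs_top (affine_space N)) Z"
      and iso: "fs_isomorphic (induced X U) (induced (affine_space N) Z)"
    unfolding affine_variety_def by blast
  have Z_pts: "pts (induced (affine_space N) Z) = Z" using closedin_subset[OF Z] by auto
  from iso obtain f g where f: "fs_morphism (induced X U) (induced (affine_space N) Z) f"
    and g: "fs_morphism (induced (affine_space N) Z) (induced X U) g" and gf: "\<And>x. x \<in> U \<Longrightarrow> g (f x) = x"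
    unfolding fs_isomorphic_def U_pts by blast
  have fZ: "f x \<in> Z" if "x \<in> U" for x
  proof -
    have "continuous_map (fs_top (induced X U)) (fs_top (induced (affine_space N) Z)) f"
      using f by (simp add: fs_morphism_def)
    from continuous_map_funspace[OF this] show ?thesis using that unfolding U_pts Z_pts by auto
  qed
  have "(\<lambda>x. f x $ i) \<in> germs X x" if i: "i < N" and x: "x \<in> U" for i x
  proof -
    have "(\<lambda>v. v $ i) \<in> fs_reg (affine_space N) (pts (affine_space N))"
      using i by (intro poly_function_reg_affine openin_topspace fun_algebra.gen) auto
    hence "(\<lambda>v. v $ i) \<in> fs_reg (induced (affine_space N) Z) Z"
      using closedin_subset[OF Z]
      by (intro reg_inducedI exI[of _ "pts (affine_space N)"] exI[of _ "\<lambda>v. v $ i"]) auto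
    hence "(\<lambda>v. v $ i) \<circ> f \<in> fs_reg (induced X U) {x \<in> U. f x \<in> Z}"
      using f openin_topspace[of "fs_top (induced (affine_space N) Z)"]
      unfolding fs_morphism_def U_pts Z_pts by blast
    hence reg: "(\<lambda>x. f x $ i) \<in> fs_reg (induced X U) {x \<in> U. f x \<in> Z}" by (simp add: comp_def)
    have "{x \<in> U. f x \<in> Z} = U" using fZ by auto
    hence "(\<lambda>x. f x $ i) \<in> fs_reg (induced X U) U" using reg by simp
    from reg_inducedE[OF this x] obtain W h where W: "openin (fs_top X) W" "x \<in> W" "h \<in> fs_reg X W"
      "\<And>z. z \<in> W \<Longrightarrow> z \<in> U \<Longrightarrow> f z $ i = h z" by blast
    hence "h \<in> germs X x" by (auto simp: germs_def)
    thus ?thesis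
      by (rule germs_cong[OF _ openin_Int[OF W(1) U(1)]]) (use W U x in auto)
  qed
  moreover have "fs_morphism (induced (affine_space N) Z) X g"
    using fs_morphism_compose[OF g fs_morphism_inclusion] by simp
  ultimately show ?thesis using that[OF U(1,2) Z _ fZ gf] by blast
qed

text \<open>In the product of charts around \<open>c\<close> and \<open>c'\<close>, the pairs that
  name the same point of \<open>X\<close> form a closed set. It contains the pairs that come from a
  common point of both charts, but not the pair of \<open>c\<close> and \<open>c'\<close>;
  \<open>F\<close> distinguishes the two. Consequently no place can agree with evaluation at both
  points.\<close>

lemma separated_points:
  assumes "prevariety X" "separated X" "c \<in> pts X" "c' \<in> pts X" "c \<noteq> c'"
  obtains K w a F where "F \<in> poly_functions K" "F (vec K a) \<noteq> 0"
    "\<And>i. i < K \<Longrightarrow> (w i \<in> germs X c \<and> a i = w i c) \<or> (w i \<in> germs X c' \<and> a i = w i c')"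
    "\<forall>\<^sub>F x in gen X. F (vec K (\<lambda>i. w i x)) = 0"
proof -
  obtain U N Z f g where U: "openin (fs_top X) U" "c \<in> U" "closedin (fs_top (affine_space N)) Z"
    "fs_morphism (induced (affine_space N) Z) X g" "\<And>x. x \<in> U \<Longrightarrow> f x \<in> Z" "\<And>x. x \<in> U \<Longrightarrow> g (f x) = x"
    "\<And>i x. i < N \<Longrightarrow> x \<in> U \<Longrightarrow> (\<lambda>x. f x $ i) \<in> germs X x"
    by (rule affine_chart[OF assms(1,3)], rule that)
  obtain U' N' Z' f' g' where U': "openin (fs_top X) U'" "c' \<in> U'" "closedin (fs_top (affine_space N')) Z'"
    "fs_morphism (induced (affine_space N') Z') X g'" "\<And>x. x \<in> U' \<Longrightarrow> f' x \<in> Z'" "\<And>x. x \<in> U' \<Longrightarrow> g' (f' x) = x"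
    "\<And>i x. i < N' \<Longrightarrow> x \<in> U' \<Longrightarrow> (\<lambda>x. f' x $ i) \<in> germs X x"
    by (rule affine_chart[OF assms(1,4)], rule that)
  define K p p' where "K = N + N'" and "p = (\<lambda>v::'k vec. vec N (\<lambda>i. v $ i))"
    and "p' = (\<lambda>v::'k vec. vec N' (\<lambda>i. v $ (N + i)))"
  have p: "fs_morphism (affine_space K) (affine_space N) p"
    unfolding p_def K_def by (rule fs_morphism_coordinates) simp
  have p': "fs_morphism (affine_space K) (affine_space N') p'"
    unfolding p'_def K_def by (rule fs_morphism_coordinates) simp
  define W where "W = {v \<in> carrier_vec K. p v \<in> Z} \<inter> {v \<in> carrier_vec K. p' v \<in> Z'}"
  have "closedin (fs_top (affine_space K)) {v \<in> carrier_vec K. p v \<in> Z}"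
  proof -
    have "continuous_map (fs_top (affine_space K)) (fs_top (affine_space N)) p"
      using p by (simp add: fs_morphism_def)
    from closedin_continuous_map_preimage[OF this U(3)] show ?thesis by (simp add: pts_affine_space)
  qed
  moreover have "closedin (fs_top (affine_space K)) {v \<in> carrier_vec K. p' v \<in> Z'}"
  proof -
    have "continuous_map (fs_top (affine_space K)) (fs_top (affine_space N')) p'"
      using p' by (simp add: fs_morphism_def)
    from closedin_continuous_map_preimage[OF this U'(3)] show ?thesis by (simp add: pts_affine_space)
  qed
  ultimately have W: "closedin (fs_top (affine_space K)) W" unfolding W_def by (rule closedin_Int)
  have h: "fs_morphism (induced (affine_space K) W) X (\<lambda>v. g (p v))"
    by (rule fs_morphism_compose[OF fs_morphism_induced[OF p] U(4)]) (simp add: W_def)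
  have h': "fs_morphism (induced (affine_space K) W) X (\<lambda>v. g' (p' v))"
    by (rule fs_morphism_compose[OF fs_morphism_induced[OF p'] U'(4)]) (simp add: W_def)
  have cl: "closedin (fs_top (affine_space K)) {v \<in> W. g (p v) = g' (p' v)}"
    using assms(2) W h h' unfolding separated_def by blast
  define w where "w i x = (if i < N then f x $ i else f' x $ (i - N))" for i x
  define a where "a i = (if i < N then f c $ i else f' c' $ (i - N))" for i
  have dim: "dim_vec (f x) = N" if "x \<in> U" for x
    using U(5)[OF that] closedin_subset[OF U(3)] unfolding pts_affine_space by auto
  have dim': "dim_vec (f' x) = N'" if "x \<in> U'" for x
    using U'(5)[OF that] closedin_subset[OF U'(3)] unfolding pts_affine_space by auto
  have pa: "p (vec K a) = f c" "p' (vec K a) = f' c'"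
    using dim[OF U(2)] dim'[OF U'(2)] by (auto simp: p_def p'_def K_def a_def)
  have "vec K a \<in> pts (affine_space K) - {v \<in> W. g (p v) = g' (p' v)}"
    using pa U(2,6) U'(2,6) assms(5) by (auto simp: pts_affine_space)
  from openin_affineE[OF openin_diff[OF openin_topspace cl] this]
  obtain F where F: "F \<in> poly_functions K" "F (vec K a) \<noteq> 0"
    "\<And>v. v \<in> carrier_vec K \<Longrightarrow> F v \<noteq> 0 \<Longrightarrow> v \<in> pts (affine_space K) - {v \<in> W. g (p v) = g' (p' v)}" by blast
  show ?thesis
  proof (rule that[OF F(1,2)])
    show "(w i \<in> germs X c \<and> a i = w i c) \<or> (w i \<in> germs X c' \<and> a i = w i c')" if "i < K" for i
    proof (cases "i < N")
      case True thus ?thesis using U(7)[OF True U(2)] by (simp add: w_def[abs_def] a_def)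
    next
      case False
      hence "i - N < N'" using that by (simp add: K_def)
      thus ?thesis using False U'(7)[OF _ U'(2)] by (simp add: w_def[abs_def] a_def)
    qed
    show "\<forall>\<^sub>F x in gen X. F (vec K (\<lambda>i. w i x)) = 0"
    proof (rule eventually_genI)
      show "openin (fs_top X) (U \<inter> U')" using U(1) U'(1) by (rule openin_Int)
      show "U \<inter> U' \<noteq> {}" using open_inter_nonempty[OF U(1) _ U'(1)] U(2) U'(2) by blast
      fix x assume x: "x \<in> U \<inter> U'"
      have "p (vec K (\<lambda>i. w i x)) = f x" "p' (vec K (\<lambda>i. w i x)) = f' x"
        using dim[of x] dim'[of x] x by (auto simp: p_def p'_def K_def w_def)
      hence "vec K (\<lambda>i. w i x) \<in> {v \<in> W. g (p v) = g' (p' v)}" using x U(5,6) U'(5,6) by (auto simp: W_def)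
      thus "F (vec K (\<lambda>i. w i x)) = 0" using F(3)[of "vec K (\<lambda>i. w i x)"] by auto
    qed
  qed
qed

end

section \<open>Subspaces of projective space\<close>

text \<open>A choice of homogeneous coordinates. Vanishing of forms and ratios of forms of equal
  degree do not depend on it.\<close>

definition lift :: "'k::field vec set \<Rightarrow> 'k vec" where
  "lift z = (SOME v. v \<in> z)"

lemma lift_in: "z \<in> proj_points n \<Longrightarrow> lift z \<in> z"
  unfolding lift_def by (rule someI_ex[OF proj_point_nonempty])

lemma lift_carrier: "z \<in> proj_points n \<Longrightarrow> lift z \<in> carrier_vec n"
  using proj_pointE(1) lift_in by blast

lemma lift_nonzero: "z \<in> proj_points n \<Longrightarrow> \<exists>i<n. lift z $ i \<noteq> 0"
proof (rule ccontr)
  assume z: "z \<in> proj_points n" and "\<not> (\<exists>i<n. lift z $ i \<noteq> 0)"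
  hence "lift z = 0\<^sub>v n" using lift_carrier[OF z] by (intro eq_vecI) auto
  thus False using proj_pointE(2)[OF z lift_in[OF z]] by simp
qed

text \<open>For a linear form \<open>l\<close>, the affine coordinates where \<open>l\<close> is
  nonzero, normalized by \<open>l = 1\<close>. Keeping all \<open>n\<close> of them leaves
  \<open>l\<close> free to be chosen nonzero at finitely many given points.\<close>

definition coord :: "('k::field vec \<Rightarrow> 'k) \<Rightarrow> nat \<Rightarrow> 'k vec set \<Rightarrow> 'k" where
  "coord l i z = lift z $ i / l (lift z)"

lemma coord_vec:
  assumes "z \<in> proj_points n"
  shows "vec n (\<lambda>i. coord l i z) = (1 / l (lift z)) \<cdot>\<^sub>v lift z"
  using lift_carrier[OF assms] by (intro eq_vecI) (auto simp: coord_def)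

lemma hom_poly_coord_vec:
  assumes "z \<in> proj_points n" "hom_poly n d f"
  shows "f (vec n (\<lambda>i. coord l i z)) = (1 / l (lift z)) ^ d * f (lift z)"
  using hom_poly_smult[OF assms(2) lift_carrier[OF assms(1)]] by (simp add: coord_vec[OF assms(1)])

lemma hom_poly_coord_quotient:
  assumes "z \<in> proj_points n" "hom_poly n d f" "hom_poly n d g" "l (lift z) \<noteq> 0"
  shows "f (vec n (\<lambda>i. coord l i z)) / g (vec n (\<lambda>i. coord l i z)) = f (lift z) / g (lift z)"
  using assms by (simp add: hom_poly_coord_vec)

text \<open>The vector of coordinates is itself a lift, and distinct points of projective space have
  no common lift.\<close>

lemma coord_inject:
  assumes "z \<in> proj_points n" "w \<in> proj_points n" "l (lift z) \<noteq> 0" "l (lift w) \<noteq> 0"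
    "\<And>i. i < n \<Longrightarrow> coord l i z = coord l i w"
  shows "z = w"
proof -
  have eq: "(1 / l (lift z)) \<cdot>\<^sub>v lift z = (1 / l (lift w)) \<cdot>\<^sub>v lift w"
  proof -
    have "vec n (\<lambda>i. coord l i z) = vec n (\<lambda>i. coord l i w)"
      by (intro eq_vecI) (simp_all add: assms(5))
    thus ?thesis unfolding coord_vec[OF assms(1)] coord_vec[OF assms(2)] .
  qed
  have mem: "(1 / l (lift u)) \<cdot>\<^sub>v lift u \<in> u" if "u \<in> proj_points n" "l (lift u) \<noteq> 0" for u
  proof -
    have "\<exists>c. (1 / l (lift u)) \<cdot>\<^sub>v lift u = c \<cdot>\<^sub>v lift u \<and> c \<noteq> 0"
      using that(2) by (intro exI[of _ "1 / l (lift u)"]) simp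
    thus ?thesis by (subst proj_pointE(3)[OF that(1) lift_in[OF that(1)]]) (rule CollectI)
  qed
  show ?thesis using proj_point_eqI[OF assms(1,2) mem[OF assms(1,3)]] mem[OF assms(2,4)] eq by simp
qed

locale projective_subspace = irreducible_sheaf "induced (proj_space n) D"
  for n :: nat and D :: "'k::field vec set set" +
  assumes subset: "D \<subseteq> proj_points n"
begin

abbreviation Y :: "('k vec set, 'k) fun_space" where "Y \<equiv> induced (proj_space n) D"

lemma pts_Y: "pts Y = D"
  using subset by (auto simp: pts_proj_space)

lemma nonzero_iff: "hom_poly n d f \<Longrightarrow> z \<in> proj_points n \<Longrightarrow> (\<forall>v\<in>z. f v \<noteq> 0) \<longleftrightarrow> f (lift z) \<noteq> 0"
  using hom_poly_ratio(2)[of n d f f z "lift z"] lift_in by blast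

lemma openin_form_nonzero:
  assumes "hom_poly n d f"
  shows "openin (fs_top Y) {z \<in> D. f (lift z) \<noteq> 0}"
proof -
  have "{z \<in> D. f (lift z) \<noteq> 0} = {p \<in> proj_points n. \<forall>v\<in>p. f v \<noteq> 0} \<inter> D"
    using nonzero_iff[OF assms] subset by blast
  thus ?thesis using openin_proj_nonzero[OF assms] by (auto simp: openin_subtopology)
qed

lemma quotient_reg:
  assumes "hom_poly n d f" "hom_poly n d g"
  shows "(\<lambda>z. f (lift z) / g (lift z)) \<in> fs_reg Y {z \<in> D. g (lift z) \<noteq> 0}"
proof (rule reg_inducedI)
  let ?W = "{p \<in> proj_points n. \<forall>v\<in>p. g v \<noteq> 0}"
  fix x assume x: "x \<in> {z \<in> D. g (lift z) \<noteq> 0}"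
  have "\<forall>q\<in>?W. \<forall>v\<in>q. g v \<noteq> 0 \<and> f (lift q) / g (lift q) = f v / g v"
    using hom_poly_ratio(1)[OF assms] lift_in by blast
  hence "(\<lambda>z. f (lift z) / g (lift z)) \<in> fs_reg (proj_space n) ?W"
    unfolding reg_proj_space using assms openin_proj_nonzero[OF assms(2)] by blast
  thus "\<exists>W h. openin (fs_top (proj_space n)) W \<and> x \<in> W \<and> h \<in> fs_reg (proj_space n) W \<and>
      (\<forall>z\<in>W \<inter> {z \<in> D. g (lift z) \<noteq> 0}. f (lift z) / g (lift z) = h z)"
    using openin_proj_nonzero[OF assms(2)] x nonzero_iff[OF assms(2)] subset
    by (intro exI[of _ ?W] exI[of _ "\<lambda>z. f (lift z) / g (lift z)"]) auto
qed

lemma quotient_germ: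
  assumes "hom_poly n d f" "hom_poly n d g" "x \<in> D" "g (lift x) \<noteq> 0"
  shows "(\<lambda>z. f (lift z) / g (lift z)) \<in> germs Y x"
  using quotient_reg[OF assms(1,2)] openin_form_nonzero[OF assms(2)] assms(3,4)
  unfolding germs_def by blast

lemma germ_quotient:
  assumes "\<phi> \<in> germs Y x"
  obtains d f g U where "hom_poly n d f" "hom_poly n d g" "openin (fs_top Y) U" "x \<in> U"
    "\<And>z. z \<in> U \<Longrightarrow> g (lift z) \<noteq> 0 \<and> \<phi> z = f (lift z) / g (lift z)"
proof -
  obtain U where U: "openin (fs_top Y) U" "x \<in> U" "\<phi> \<in> fs_reg Y U" using assms unfolding germs_def by blast
  obtain W h where W: "openin (fs_top (proj_space n)) W" "x \<in> W" "h \<in> fs_reg (proj_space n) W"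
    "\<And>z. z \<in> W \<Longrightarrow> z \<in> U \<Longrightarrow> \<phi> z = h z" using reg_inducedE[OF U(3,2)] by blast
  obtain V d f g where V: "openin (fs_top (proj_space n)) V" "x \<in> V" "V \<subseteq> W" "hom_poly n d f"
    "hom_poly n d g" "\<And>q v. q \<in> V \<Longrightarrow> v \<in> q \<Longrightarrow> g v \<noteq> 0 \<and> h q = f v / g v"
    by (rule reg_proj_spaceE[OF W(3,2)], rule that)
  have "openin (fs_top Y) (V \<inter> D)" using V(1) by (auto simp: openin_subtopology)
  hence o: "openin (fs_top Y) (V \<inter> D \<inter> U)" using U(1) by (rule openin_Int)
  have xD: "x \<in> D" using openin_subset[OF U(1)] U(2) pts_Y by blast
  show ?thesis
  proof (rule that[OF V(4,5) o])
    show "x \<in> V \<inter> D \<inter> U" using V U xD by blast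
    fix z assume z: "z \<in> V \<inter> D \<inter> U"
    have "lift z \<in> z" using z subset lift_in by blast
    thus "g (lift z) \<noteq> 0 \<and> \<phi> z = f (lift z) / g (lift z)" using V(3,6) W(4) z by auto
  qed
qed

lemma coord_germ:
  "hom_poly n 1 l \<Longrightarrow> x \<in> D \<Longrightarrow> l (lift x) \<noteq> 0 \<Longrightarrow> i < n \<Longrightarrow> coord l i \<in> germs Y x"
  unfolding coord_def[abs_def] by (rule quotient_germ[OF hom_poly_coord])

text \<open>Used with \<open>s\<close> an automorphism fixing \<open>x\<close>, and with \<open>s\<close> constant, where it says that the
  differences \<open>y\<^sub>i(x) - y\<^sub>i\<close> of coordinates generate the maximal ideal at \<open>x\<close>.\<close>

lemma germ_difference:
  assumes l: "hom_poly n 1 l" "l (lift x) \<noteq> 0" and \<phi>: "\<phi> \<in> germs Y x"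
    and s: "s x = x" "\<And>z. z \<in> D \<Longrightarrow> s z \<in> D"
      "\<And>U. openin (fs_top Y) U \<Longrightarrow> openin (fs_top Y) {z \<in> D. s z \<in> U}"
      "\<And>\<psi>. \<psi> \<in> germs Y x \<Longrightarrow> (\<lambda>z. \<psi> (s z)) \<in> germs Y x"
  obtains c where "\<And>i. i < n \<Longrightarrow> c i \<in> germs Y x"
    "\<forall>\<^sub>F z in gen Y. \<phi> (s z) - \<phi> z = (\<Sum>i<n. c i z * (coord l i (s z) - coord l i z))"
proof -
  have x: "x \<in> D" using germs_pts[OF \<phi>] by (simp add: pts_Y)
  have xp: "x \<in> pts Y" using germs_pts[OF \<phi>] .
  obtain d f g U where U: "hom_poly n d f" "hom_poly n d g" "openin (fs_top Y) U" "x \<in> U"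
    "\<And>z. z \<in> U \<Longrightarrow> g (lift z) \<noteq> 0 \<and> \<phi> z = f (lift z) / g (lift z)"
    by (rule germ_quotient[OF \<phi>], rule that)
  define V where "V = U \<inter> {z \<in> D. l (lift z) \<noteq> 0}"
  have V: "openin (fs_top Y) V" "x \<in> V" unfolding V_def
    using openin_Int[OF U(3) openin_form_nonzero[OF l(1)]] U(4) l(2) x by auto
  define y where "y = (\<lambda>z. vec n (\<lambda>i. coord l i z))"
  have \<phi>y: "\<phi> z = f (y z) / g (y z) \<and> g (y z) \<noteq> 0" if "z \<in> V" for z
  proof -
    have z: "z \<in> proj_points n" "l (lift z) \<noteq> 0" using that subset by (auto simp: V_def)
    show ?thesis
      using U(5)[of z] that z hom_poly_coord_quotient[where l = l, OF z(1) U(1,2) z(2)] hom_poly_coord_vec[OF z(1) U(2), of l]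
      by (simp add: y_def V_def)
  qed
  have u: "coord l i \<in> germs Y x" "(\<lambda>z. coord l i (s z)) \<in> germs Y x" if "i < n" for i
    using coord_germ[OF l(1) x l(2) that] s(4) by auto
  \<comment> \<open>Numerator and denominator are polynomials in the coordinates, so each of their
    differences is a combination of the coordinate differences.\<close>
  obtain a where a: "\<And>i. i < n \<Longrightarrow> a i \<in> germs Y x"
    "\<And>z. f (y (s z)) - f (y z) = (\<Sum>i<n. a i z * (coord l i (s z) - coord l i z))"
    using poly_function_difference[OF hom_poly_in_poly_functions[OF U(1)] xp,
      of "\<lambda>i z. coord l i (s z)" "coord l"] u
    unfolding y_def by blast
  obtain b where b: "\<And>i. i < n \<Longrightarrow> b i \<in> germs Y x"
    "\<And>z. g (y (s z)) - g (y z) = (\<Sum>i<n. b i z * (coord l i (s z) - coord l i z))"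
    using poly_function_difference[OF hom_poly_in_poly_functions[OF U(2)] xp,
      of "\<lambda>i z. coord l i (s z)" "coord l"] u
    unfolding y_def by blast
  have fg: "(\<lambda>z. f (y z)) \<in> germs Y x" "(\<lambda>z. g (y z)) \<in> germs Y x" "(\<lambda>z. g (y (s z))) \<in> germs Y x"
    using germs_poly_function[OF hom_poly_in_poly_functions[OF U(1)] xp, of "coord l"]
      germs_poly_function[OF hom_poly_in_poly_functions[OF U(2)] xp, of "coord l"]
      s(4)[of "\<lambda>z. g (y z)"] u unfolding y_def by auto
  have gx: "g (y x) \<noteq> 0" using \<phi>y[OF V(2)] by blast
  \<comment> \<open>From \<open>f'/g' - f/g = (g (f' - f) - f (g' - g)) / (g' g)\<close>. The
    denominator is a unit at \<open>x\<close> because \<open>s\<close> fixes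
    \<open>x\<close>.\<close>
  define c where "c i z = (g (y z) * a i z - f (y z) * b i z) / (g (y (s z)) * g (y z))" for i z
  show ?thesis
  proof (rule that[of c])
    show "c i \<in> germs Y x" if "i < n" for i
      unfolding c_def[abs_def] using fg a(1)[OF that] b(1)[OF that] gx s(1)
      by (intro germs_divide germs_diff germs_mult) auto
    have oW: "openin (fs_top Y) (V \<inter> {z \<in> D. s z \<in> V})" using V(1) s(3) by (intro openin_Int)
    have xW: "x \<in> V \<inter> {z \<in> D. s z \<in> V}" using V(2) x s(1) by auto
    show "\<forall>\<^sub>F z in gen Y. \<phi> (s z) - \<phi> z = (\<Sum>i<n. c i z * (coord l i (s z) - coord l i z))"
    proof (rule eventually_genI[OF oW])
      show "V \<inter> {z \<in> D. s z \<in> V} \<noteq> {}" using xW by blast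
      fix z assume z: "z \<in> V \<inter> {z \<in> D. s z \<in> V}"
      let ?G = "g (y (s z)) * g (y z)"
      have nz: "g (y z) \<noteq> 0" "g (y (s z)) \<noteq> 0" and eq: "\<phi> z = f (y z) / g (y z)" "\<phi> (s z) = f (y (s z)) / g (y (s z))"
        using \<phi>y[of z] \<phi>y[of "s z"] z by auto
      have "\<phi> (s z) - \<phi> z = (g (y z) * (f (y (s z)) - f (y z)) - f (y z) * (g (y (s z)) - g (y z))) / ?G"
        unfolding eq using nz by (simp add: field_simps)
      also have "\<dots> = (\<Sum>i<n. c i z * (coord l i (s z) - coord l i z))"
        unfolding a(2) b(2) c_def
        by (simp add: sum_distrib_left sum_subtractf[symmetric] sum_divide_distrib algebra_simps)
      finally show "\<phi> (s z) - \<phi> z = (\<Sum>i<n. c i z * (coord l i (s z) - coord l i z))" .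
    qed
  qed
qed

end

section \<open>The centre of a place on a complete subspace\<close>

locale projective_place = projective_subspace n D + place "induced (proj_space n) D" B
  for n :: nat and D :: "'k::alg_closed_field vec set set" and B
begin

lemma B_unique: "B f a \<Longrightarrow> B f b \<Longrightarrow> a = b"
proof -
  assume "B f a" "B f b"
  hence "B (\<lambda>z. f z + (-1) * f z) (a + (-1) * b)" by (intro B_add B_mult B_const)
  from B_zero[OF this] show "a = b" by simp
qed

lemma B_poly_function:
  assumes "F \<in> poly_functions k" "\<And>i. i < k \<Longrightarrow> B (u i) (a i)"
  shows "B (\<lambda>z. F (vec k (\<lambda>i. u i z))) (F (vec k a))"
  using assms(1) by induction (auto intro: B_const B_add B_mult assms(2))

text \<open>Picks a coordinate of least order at the place: each new index is compared with the
  current winner, and finiteness of ratios passes through products.\<close>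

lemma dominating_coordinate:
  fixes \<xi> :: "nat \<Rightarrow> 'k vec set \<Rightarrow> 'k"
  assumes "finite I" "I \<noteq> {}" and r: "\<And>i j. i \<in> I \<Longrightarrow> j \<in> I \<Longrightarrow> (\<lambda>z. \<xi> i z / \<xi> j z) \<in> rationals Y"
    and nz: "\<And>i. i \<in> I \<Longrightarrow> \<forall>\<^sub>F z in gen Y. \<xi> i z \<noteq> 0"
  shows "\<exists>j\<in>I. \<forall>i\<in>I. \<exists>a. B (\<lambda>z. \<xi> i z / \<xi> j z) a"
  using assms
proof (induction I rule: finite_ne_induct)
  case (singleton i)
  have "\<forall>\<^sub>F z in gen Y. \<xi> i z / \<xi> i z = 1" using singleton(2)[of i] by (auto elim: eventually_mono)
  from B_cong[OF B_const this] show ?case by blast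
next
  case (insert i I)
  then obtain j where j: "j \<in> I" "\<And>k. k \<in> I \<Longrightarrow> \<exists>a. B (\<lambda>z. \<xi> k z / \<xi> j z) a" by blast
  have one: "\<exists>a. B (\<lambda>z. \<xi> i z / \<xi> i z) a"
  proof -
    have "\<forall>\<^sub>F z in gen Y. \<xi> i z / \<xi> i z = 1" using insert.prems(2)[of i] by (auto elim: eventually_mono)
    from B_cong[OF B_const this] show ?thesis by blast
  qed
  have "(\<exists>a. B (\<lambda>z. \<xi> i z / \<xi> j z) a) \<or> (\<exists>a. B (\<lambda>z. inverse (\<xi> i z / \<xi> j z)) a)"
    using insert.prems(1)[of i j] j(1) by (intro B_total) auto
  thus ?case
  proof
    assume "\<exists>a. B (\<lambda>z. \<xi> i z / \<xi> j z) a"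
    thus ?thesis using j by (intro bexI[of _ j]) auto
  next
    assume "\<exists>a. B (\<lambda>z. inverse (\<xi> i z / \<xi> j z)) a"
    then obtain a where a: "B (\<lambda>z. \<xi> j z / \<xi> i z) a" by auto
    have "\<exists>b. B (\<lambda>z. \<xi> k z / \<xi> i z) b" if k: "k \<in> I" for k
    proof -
      obtain b where b: "B (\<lambda>z. \<xi> k z / \<xi> j z) b" using j(2)[OF k] by blast
      have eq: "\<forall>\<^sub>F z in gen Y. \<xi> k z / \<xi> i z = \<xi> k z / \<xi> j z * (\<xi> j z / \<xi> i z)"
        using insert.prems(2)[of j] j(1) by (auto elim: eventually_mono)
      from B_cong[OF B_mult[OF b a] eq] show ?thesis by blast
    qed
    thus ?thesis using one by (intro bexI[of _ i]) auto
  qed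
qed

text \<open>The valuative criterion for \<open>D\<close>. Divided by a dominating one, the
  homogeneous coordinates have finite values \<open>a\<close> at the place, and a point of
  \<open>D\<close> on the line of \<open>a\<close> is wanted. Completeness supplies it by making the
  affine cone over \<open>D\<close> closed.\<close>

lemma center:
  assumes complete: "complete_space Y"
  obtains y where "y \<in> D" "\<And>\<phi>. \<phi> \<in> germs Y y \<Longrightarrow> B \<phi> (\<phi> y)"
proof -
  define Z where "Z = {(z, v). z \<in> D \<and> v \<in> carrier_vec n \<and> (\<forall>i<n. \<forall>j<n. v $ i * lift z $ j = v $ j * lift z $ i)}"
  define S where "S = {{(x, v). x \<in> U \<and> v \<in> carrier_vec n \<and> F (x, v) \<noteq> (0::'k)} | U F. openin (fs_top Y) U \<and>
      F \<in> fun_algebra ({\<lambda>(x, v). f x | f. f \<in> fs_reg Y U} \<union> {\<lambda>(x, v). v $ i | i. i < n})}"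
  have top: "prod_affine_top Y n = topology_generated_by S" by (simp add: prod_affine_top_def S_def)
  have basic: "openin (prod_affine_top Y n) {(x, v). x \<in> U \<and> v \<in> carrier_vec n \<and> F (x, v) \<noteq> 0}"
    if "openin (fs_top Y) U" "F \<in> fun_algebra ({\<lambda>(x, v). f x | f. f \<in> fs_reg Y U} \<union> {\<lambda>(x, v). v $ i | i. i < n})"
    for U F unfolding top by (rule topology_generated_by_Basis) (use that in \<open>auto simp: S_def\<close>)
  have "openin (prod_affine_top Y n) {(x, v). x \<in> D \<and> v \<in> carrier_vec n \<and> (1::'k) \<noteq> 0}"
    using basic[OF _ fun_algebra.const, of D 1] pts_Y openin_topspace[of "fs_top Y"] by simp
  hence sub: "D \<times> carrier_vec n \<subseteq> topspace (prod_affine_top Y n)" by (auto dest: openin_subset)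
  have sup: "topspace (prod_affine_top Y n) \<subseteq> D \<times> carrier_vec n"
  proof -
    have "\<Union>S \<subseteq> D \<times> carrier_vec n" unfolding S_def using pts_Y openin_subset[of "fs_top Y"] by blast
    thus ?thesis unfolding top topology_generated_by_topspace .
  qed
  have "closedin (prod_affine_top Y n) Z"
    unfolding closedin_def
  proof
    show "Z \<subseteq> topspace (prod_affine_top Y n)" using sub by (auto simp: Z_def)
    show "openin (prod_affine_top Y n) (topspace (prod_affine_top Y n) - Z)"
    proof (subst openin_subopen, rule ballI)
      fix p assume p: "p \<in> topspace (prod_affine_top Y n) - Z"
      then obtain z v where zv: "p = (z, v)" "z \<in> D" "v \<in> carrier_vec n" using sup by blast
      then obtain i j where ij: "i < n" "j < n" "v $ i * lift z $ j \<noteq> v $ j * lift z $ i"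
        using p by (auto simp: Z_def)
      \<comment> \<open>Dividing the minor by a coordinate that is nonzero at \<open>z\<close> turns
        it into a regular function near \<open>z\<close>, as the basic open sets of the product
        topology require.\<close>
      obtain k where k: "k < n" "lift z $ k \<noteq> 0" using lift_nonzero zv(2) subset by blast
      define U where "U = {z \<in> D. lift z $ k \<noteq> 0}"
      define A where "A = {\<lambda>(x, v). f x | f. f \<in> fs_reg Y U} \<union> {\<lambda>(x, v). v $ i | i. i < n}"
      have coord: "(\<lambda>(x, v). v $ m) \<in> fun_algebra A" if "m < n" for m
        by (rule fun_algebra.gen) (use that in \<open>auto simp: A_def\<close>)
      have ratio: "(\<lambda>(x, v). c * (lift x $ m / lift x $ k)) \<in> fun_algebra A" if "m < n" for m c
      proof -
        have "(\<lambda>x. c * lift x $ m / lift x $ k) \<in> fs_reg Y U" unfolding U_def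
          by (rule quotient_reg[OF hom_poly_cmult[OF hom_poly_coord[OF that]] hom_poly_coord[OF k(1)]])
        thus ?thesis by (intro fun_algebra.gen) (force simp: A_def)
      qed
      define F where "F p = (case p of (x, v) \<Rightarrow> v $ i) * (case p of (x, v) \<Rightarrow> 1 * (lift x $ j / lift x $ k)) +
        (case p of (x, v) \<Rightarrow> v $ j) * (case p of (x, v) \<Rightarrow> (-1) * (lift x $ i / lift x $ k))"
        for p :: "'k vec set \<times> 'k vec"
      have "F \<in> fun_algebra A" unfolding F_def[abs_def]
        by (intro fun_algebra.add fun_algebra.mult coord ratio ij)
      moreover have "openin (fs_top Y) U" unfolding U_def using openin_form_nonzero[OF hom_poly_coord[OF k(1)]] .
      ultimately have o: "openin (prod_affine_top Y n) {(x, v). x \<in> U \<and> v \<in> carrier_vec n \<and> F (x, v) \<noteq> 0}"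
        unfolding A_def by (intro basic)
      have Fval: "F (x, w) = (w $ i * lift x $ j - w $ j * lift x $ i) / lift x $ k" for x w
        by (simp add: F_def diff_divide_distrib)
      have "p \<in> {(x, v). x \<in> U \<and> v \<in> carrier_vec n \<and> F (x, v) \<noteq> 0}"
        using zv k ij(3) by (simp add: U_def Fval)
      moreover have "{(x, v). x \<in> U \<and> v \<in> carrier_vec n \<and> F (x, v) \<noteq> 0} \<subseteq> topspace (prod_affine_top Y n) - Z"
        using sub ij(1,2) by (auto simp: U_def Fval Z_def)
      ultimately show "\<exists>T. openin (prod_affine_top Y n) T \<and> p \<in> T \<and> T \<subseteq> topspace (prod_affine_top Y n) - Z"
        using o by blast
    qed
  qed
  hence cone: "closedin (fs_top (affine_space n)) (snd ` Z)" using complete by (auto simp: complete_space_def)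
  define \<xi> where "\<xi> i z = lift z $ i" for i and z :: "'k vec set"
  \<comment> \<open>Coordinates that vanish identically on \<open>D\<close> cannot serve as
    denominators; their own ratios to the chosen coordinate are generically 0.\<close>
  define I where "I = {i. i < n \<and> (\<exists>z\<in>D. \<xi> i z \<noteq> 0)}"
  have open_I: "openin (fs_top Y) {z \<in> D. \<xi> i z \<noteq> 0}" "{z \<in> D. \<xi> i z \<noteq> 0} \<noteq> {}" if "i \<in> I" for i
    using that openin_form_nonzero[OF hom_poly_coord, of i] by (auto simp: I_def \<xi>_def)
  have rat: "(\<lambda>z. \<xi> i z / \<xi> j z) \<in> rationals Y" if "i < n" "j \<in> I" for i j
  proof -
    have "j < n" using that(2) by (simp add: I_def)
    from quotient_reg[OF hom_poly_coord[OF that(1)] hom_poly_coord[OF this]] open_I[OF that(2)]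
    show ?thesis unfolding rationals_def \<xi>_def by blast
  qed
  have nz: "\<forall>\<^sub>F z in gen Y. \<xi> i z \<noteq> 0" if "i \<in> I" for i using open_I[OF that] by (rule eventually_genI) auto
  have "I \<noteq> {}" using pts_nonempty lift_nonzero subset unfolding pts_Y I_def \<xi>_def by blast
  moreover have "finite I" by (simp add: I_def)
  ultimately obtain j where j: "j \<in> I" "\<And>i. i \<in> I \<Longrightarrow> \<exists>a. B (\<lambda>z. \<xi> i z / \<xi> j z) a"
    using dominating_coordinate[of I \<xi>] rat nz unfolding I_def by blast
  have "\<exists>a. B (\<lambda>z. \<xi> i z / \<xi> j z) a" if i: "i < n" for i
  proof (cases "i \<in> I")
    case False
    hence "\<xi> i z = 0" if "z \<in> D" for z using i that by (auto simp: I_def)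
    hence "\<forall>\<^sub>F z in gen Y. \<xi> i z / \<xi> j z = 0" using eventually_pts unfolding pts_Y by (auto elim: eventually_mono)
    from B_cong[OF B_const this] show ?thesis by blast
  qed (use j in blast)
  then obtain a where a: "\<And>i. i < n \<Longrightarrow> B (\<lambda>z. \<xi> i z / \<xi> j z) (a i)" by metis
  have jn: "j < n" using j(1) by (simp add: I_def)
  have "\<forall>\<^sub>F z in gen Y. \<xi> j z / \<xi> j z = 1" using nz[OF j(1)] by (auto elim: eventually_mono)
  \<comment> \<open>This normalization keeps \<open>a\<close> away from the zero vector of the
    cone.\<close>
  from B_cong[OF B_const this] have aj: "a j = 1" using B_unique[OF a[OF jn]] by blast
  define l where "l v = v $ j" for v :: "'k vec"
  have l: "hom_poly n 1 l" unfolding l_def[abs_def] by (rule hom_poly_coord[OF jn])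
  have co: "coord l i z = \<xi> i z / \<xi> j z" for i z by (simp add: coord_def l_def \<xi>_def)
  \<comment> \<open>Otherwise some polynomial vanishes on the cone but not at \<open>a\<close>. It
    vanishes at the scaled coordinates of every point of \<open>D\<close>, even where
    \<open>\<xi> j z = 0\<close>, since these are then the zero vector; so its value at the place is
    0.\<close>
  have "vec n a \<in> snd ` Z"
  proof (rule ccontr)
    assume "vec n a \<notin> snd ` Z"
    hence "vec n a \<in> pts (affine_space n) - snd ` Z" by (simp add: pts_affine_space)
    from openin_affineE[OF openin_diff[OF openin_topspace cone] this]
    obtain f where f: "f \<in> poly_functions n" "f (vec n a) \<noteq> 0"
      "\<And>w. w \<in> carrier_vec n \<Longrightarrow> f w \<noteq> 0 \<Longrightarrow> w \<in> pts (affine_space n) - snd ` Z" by blast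
    have "\<forall>\<^sub>F z in gen Y. f (vec n (\<lambda>i. \<xi> i z / \<xi> j z)) = 0"
      using eventually_pts
    proof eventually_elim
      case (elim z)
      let ?w = "vec n (\<lambda>i. \<xi> i z / \<xi> j z)"
      have "(z, ?w) \<in> Z" using elim pts_Y by (auto simp: Z_def \<xi>_def)
      hence "?w \<in> snd ` Z" by force
      thus ?case using f(3)[of ?w] by auto
    qed
    moreover have "B (\<lambda>z. f (vec n (\<lambda>i. \<xi> i z / \<xi> j z))) (f (vec n a))"
      by (rule B_poly_function[OF f(1) a])
    ultimately show False using B_zero f(2) by blast
  qed
  then obtain y where y: "y \<in> D" "\<And>i k. i < n \<Longrightarrow> k < n \<Longrightarrow> a i * lift y $ k = a k * lift y $ i"
    by (auto simp: Z_def)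
  have yp: "y \<in> proj_points n" using y(1) subset by blast
  have "lift y $ i = a i * lift y $ j" if "i < n" for i using y(2)[OF that jn] aj by simp
  hence yj: "lift y $ j \<noteq> 0" using lift_nonzero[OF yp] by auto
  have ay: "vec n (\<lambda>i. coord l i y) = vec n a"
    using y(2)[OF _ jn] aj yj by (intro eq_vecI) (auto simp: co \<xi>_def field_simps)
  show ?thesis
  proof (rule that[OF y(1)])
    fix \<phi> assume \<phi>: "\<phi> \<in> germs Y y"
    obtain d f g U where U: "hom_poly n d f" "hom_poly n d g" "openin (fs_top Y) U" "y \<in> U"
      "\<And>z. z \<in> U \<Longrightarrow> g (lift z) \<noteq> 0 \<and> \<phi> z = f (lift z) / g (lift z)"
      by (rule germ_quotient[OF \<phi>], rule that)
    \<comment> \<open>A germ is a quotient of forms of equal degree, hence of polynomials in the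
      scaled coordinates. Its value at the place is therefore obtained by inserting
      \<open>a\<close>, which is its value at \<open>y\<close>.\<close>
    have val: "\<phi> z = f (vec n (\<lambda>i. \<xi> i z / \<xi> j z)) / g (vec n (\<lambda>i. \<xi> i z / \<xi> j z)) \<and> g (vec n (\<lambda>i. \<xi> i z / \<xi> j z)) \<noteq> 0"
      if "z \<in> U" "lift z $ j \<noteq> 0" for z
    proof -
      have z: "z \<in> proj_points n" "l (lift z) \<noteq> 0"
        using that openin_subset[OF U(3)] pts_Y subset by (auto simp: l_def)
      show ?thesis
        using U(5)[of z] that z hom_poly_coord_quotient[where l = l, OF z(1) U(1,2) z(2)] hom_poly_coord_vec[OF z(1) U(2), of l]
        by (simp add: co)
    qed
    have ga: "g (vec n a) \<noteq> 0" and \<phi>y: "\<phi> y = f (vec n a) / g (vec n a)"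
      using val[OF U(4) yj] ay by (simp_all add: co)
    have Bf: "B (\<lambda>z. f (vec n (\<lambda>i. \<xi> i z / \<xi> j z))) (f (vec n a))"
      by (rule B_poly_function[OF hom_poly_in_poly_functions[OF U(1)] a])
    have Bg: "B (\<lambda>z. g (vec n (\<lambda>i. \<xi> i z / \<xi> j z))) (g (vec n a))"
      by (rule B_poly_function[OF hom_poly_in_poly_functions[OF U(2)] a])
    have "B (\<lambda>z. f (vec n (\<lambda>i. \<xi> i z / \<xi> j z)) * inverse (g (vec n (\<lambda>i. \<xi> i z / \<xi> j z)))) (\<phi> y)"
      using B_mult[OF Bf B_inverse[OF Bg ga]] by (simp add: \<phi>y divide_inverse)
    moreover have "\<forall>\<^sub>F z in gen Y. \<phi> z = f (vec n (\<lambda>i. \<xi> i z / \<xi> j z)) * inverse (g (vec n (\<lambda>i. \<xi> i z / \<xi> j z)))"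
    proof -
      have "\<forall>\<^sub>F z in gen Y. z \<in> U" using U(3,4) by (intro eventually_genI[of U]) auto
      with nz[OF j(1)] show ?thesis
        by eventually_elim (use val in \<open>simp add: \<xi>_def divide_inverse\<close>)
    qed
    ultimately show "B \<phi> (\<phi> y)" by (rule B_cong)
  qed
qed

end

text \<open>This replaces finiteness of a proper map with finite fibres. A place at which a
  non-integral function has a pole has a centre on the complete source, and by separatedness
  of the target that centre lies over the given point.\<close>

theorem integral_of_regular_on_fibre:
  fixes D :: "'k::alg_closed_field vec set set" and C :: "('q, 'k) fun_space"
  assumes "projective_subspace n D" "complete_space (induced (proj_space n) D)"
    and "dominant_map (induced (proj_space n) D) C q" "prevariety C" "separated C"
    and \<zeta>: "\<zeta> \<in> rationals C" and x: "x \<in> D"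
    and reg: "\<And>z. z \<in> D \<Longrightarrow> q z = q x \<Longrightarrow>
      \<exists>f\<in>germs (induced (proj_space n) D) z. \<forall>\<^sub>F w in gen (induced (proj_space n) D). f w = \<zeta> (q w)"
  shows "cls C \<zeta> \<in> normalized_local_ring C (q x)"
proof (rule ccontr)
  assume not_integral: "cls C \<zeta> \<notin> normalized_local_ring C (q x)"
  interpret projective_subspace n D by fact
  interpret dominant_map Y C q by fact
  let ?c = "q x"
  have c: "?c \<in> pts C" using surjective x pts_Y by blast
  have \<zeta>q: "(\<lambda>z. \<zeta> (q z)) \<in> rationals Y" using rationals_pullback[OF \<zeta>] .
  \<comment> \<open>Zero satisfies the integral equation of degree 1 with coefficient 0; so the
    inverse \<open>t\<close> below is a genuine one.\<close>
  have "\<not> (\<forall>\<^sub>F z in gen Y. \<zeta> (q z) = 0)"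
  proof
    assume "\<forall>\<^sub>F z in gen Y. \<zeta> (q z) = 0"
    hence "\<forall>\<^sub>F z in gen Y. \<zeta> (q z) ^ 1 + (\<Sum>i<1. 0 * \<zeta> (q z) ^ i) = 0" by eventually_elim simp
    from integral_overI[OF \<zeta> C.germs_const[OF c] this] not_integral show False by blast
  qed
  hence nz: "\<forall>\<^sub>F z in gen Y. \<zeta> (q z) \<noteq> 0" using rationals_zero_or_nonzero[OF \<zeta>q] by blast
  \<comment> \<open>The place to be found extends evaluation at \<open>?c\<close>.\<close>
  define A where "A f a \<longleftrightarrow> (\<exists>\<alpha>\<in>germs C ?c. f = (\<lambda>z. \<alpha> (q z)) \<and> a = \<alpha> ?c)" for f a
  define t where "t z = inverse (\<zeta> (q z))" for z
  have "\<exists>B. place Y B \<and> (\<forall>f a. A f a \<longrightarrow> B f a) \<and> B t 0"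
  proof (rule place_extension[of Y A t])
    show "\<exists>B. place Y B \<and> (\<forall>f a. A f a \<longrightarrow> B f a) \<and> B t 0"
      if "place Y B" "\<And>f a. A f a \<Longrightarrow> B f a" "B t 0" for B using that by blast
    show "irreducible_sheaf Y" by unfold_locales
    show "f \<in> rationals Y" if "A f a" for f a
      using that by (auto simp: A_def intro: rationals_pullback germs_rationals)
    show "A (\<lambda>_. k) k" for k unfolding A_def using C.germs_const[OF c] by (intro bexI[of _ "\<lambda>_. k"]) auto
    show "A (\<lambda>z. f z - g z) (a - b)" "A (\<lambda>z. f z * g z) (a * b)" if "A f a" "A g b" for f g a b
    proof -
      obtain \<alpha> \<beta> where ab: "\<alpha> \<in> germs C ?c" "f = (\<lambda>z. \<alpha> (q z))" "a = \<alpha> ?c"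
        "\<beta> \<in> germs C ?c" "g = (\<lambda>z. \<beta> (q z))" "b = \<beta> ?c" using \<open>A f a\<close> \<open>A g b\<close> unfolding A_def by blast
      show "A (\<lambda>z. f z - g z) (a - b)" unfolding A_def
        using C.germs_diff[OF ab(1,4)] by (intro bexI[of _ "\<lambda>z. \<alpha> z - \<beta> z"]) (auto simp: ab)
      show "A (\<lambda>z. f z * g z) (a * b)" unfolding A_def
        using C.germs_mult[OF ab(1,4)] by (intro bexI[of _ "\<lambda>z. \<alpha> z * \<beta> z"]) (auto simp: ab)
    qed
    show "t \<in> rationals Y" unfolding t_def[abs_def] by (rule rationals_inverse[OF \<zeta>q])
    fix N f a assume Afa: "\<And>i. i \<le> N \<Longrightarrow> A (f i) (a i)"
      and rel: "\<forall>\<^sub>F z in gen Y. (\<Sum>i\<le>N. f i z * t z ^ i) = 0"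
    show "a 0 = 0"
    proof (rule ccontr)
      assume a0: "a 0 \<noteq> 0"
      have "\<forall>i. \<exists>\<alpha>. i \<le> N \<longrightarrow> \<alpha> \<in> germs C ?c \<and> f i = (\<lambda>z. \<alpha> (q z)) \<and> a i = \<alpha> ?c"
        using Afa unfolding A_def by blast
      then obtain \<alpha> where \<alpha>: "\<And>i. i \<le> N \<Longrightarrow> \<alpha> i \<in> germs C ?c \<and> f i = (\<lambda>z. \<alpha> i (q z)) \<and> a i = \<alpha> i ?c"
        by metis
      have \<alpha>0: "\<alpha> 0 \<in> germs C ?c" "\<alpha> 0 ?c \<noteq> 0" using \<alpha>[of 0] a0 by auto
      have "\<forall>\<^sub>F z in gen Y. \<alpha> 0 (q z) \<noteq> 0" using gen_pullback[OF C.germs_nonzero[OF \<alpha>0]] .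
      \<comment> \<open>Multiplication by the \<open>N\<close>-th power of \<open>\<zeta>\<close>
        turns powers of \<open>t\<close> into powers of \<open>\<zeta>\<close>, and division by the
        unit \<open>\<alpha> 0\<close> makes the relation monic, that is, an integral
        equation.\<close>
      with rel nz have "\<forall>\<^sub>F z in gen Y. \<zeta> (q z) ^ N + (\<Sum>i<N. \<alpha> (N - i) (q z) / \<alpha> 0 (q z) * \<zeta> (q z) ^ i) = 0"
      proof eventually_elim
        case (elim z)
        let ?x = "\<zeta> (q z)" and ?a = "\<lambda>i. \<alpha> i (q z)"
        have "(\<Sum>i\<le>N. ?a i * ?x ^ (N - i)) = (\<Sum>i\<le>N. ?x ^ N * (?a i * t z ^ i))"
          using elim(2) by (intro sum.cong) (auto simp: t_def power_diff field_simps)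
        also have "\<dots> = ?x ^ N * (\<Sum>i\<le>N. f i z * t z ^ i)"
          using \<alpha> by (simp add: sum_distrib_left)
        finally have "(\<Sum>i\<le>N. ?a i * ?x ^ (N - i)) = 0" using elim(1) by simp
        moreover have "(\<Sum>i\<le>N. ?a i * ?x ^ (N - i)) = (\<Sum>i\<le>N. ?a (N - i) * ?x ^ i)"
          by (rule sum.reindex_bij_witness[of _ "\<lambda>i. N - i" "\<lambda>i. N - i"]) auto
        moreover have "(\<Sum>i\<le>N. ?a (N - i) * ?x ^ i) = (\<Sum>i<N. ?a (N - i) * ?x ^ i) + ?a 0 * ?x ^ N"
          by (simp add: lessThan_Suc_atMost[symmetric])
        ultimately have "(\<Sum>i<N. ?a (N - i) * ?x ^ i) + ?a 0 * ?x ^ N = 0" by simp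
        hence "((\<Sum>i<N. ?a (N - i) * ?x ^ i) + ?a 0 * ?x ^ N) / ?a 0 = 0" by simp
        thus ?case using elim(3) by (simp add: add_divide_distrib sum_divide_distrib add.commute)
      qed
      moreover have "(\<lambda>z. \<alpha> (N - i) z / \<alpha> 0 z) \<in> germs C ?c" for i
        using \<alpha>[of "N - i"] \<alpha>0 by (intro C.germs_divide) auto
      ultimately show False using integral_overI[OF \<zeta>, of N "\<lambda>i z. \<alpha> (N - i) z / \<alpha> 0 z" ?c] not_integral by blast
    qed
  qed
  then obtain B where B: "place Y B" "\<And>f a. A f a \<Longrightarrow> B f a" "B t 0" by blast
  interpret place Y B by (rule B(1))
  interpret projective_place n D B by unfold_locales
  obtain y where y: "y \<in> D" "\<And>\<phi>. \<phi> \<in> germs Y y \<Longrightarrow> B \<phi> (\<phi> y)" using center[OF assms(2)] by blast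
  have qy: "q y \<in> pts C" using surjective y(1) pts_Y by blast
  \<comment> \<open>The place agrees with evaluation at \<open>q y\<close> through its centre, and
    with evaluation at \<open>?c\<close> by construction. A polynomial separating two such points
    would have a nonzero value at the place although it vanishes generically.\<close>
  have "q y = ?c"
  proof (rule ccontr)
    assume neq: "q y \<noteq> ?c"
    obtain K w a F where F: "F \<in> poly_functions K" "F (vec K a) \<noteq> 0"
      and w: "\<And>i. i < K \<Longrightarrow> (w i \<in> germs C (q y) \<and> a i = w i (q y)) \<or> (w i \<in> germs C ?c \<and> a i = w i ?c)"
      and zero: "\<forall>\<^sub>F x in gen C. F (vec K (\<lambda>i. w i x)) = 0"
      by (rule C.separated_points[OF assms(4,5) qy c neq], rule that)
    have "B (\<lambda>z. w i (q z)) (a i)" if "i < K" for i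
      using w[OF that]
    proof
      assume "w i \<in> germs C (q y) \<and> a i = w i (q y)"
      moreover have "y \<in> pts Y" using y(1) unfolding pts_Y .
      ultimately show ?thesis using y(2)[OF germs_pullback[of "w i" y]] by simp
    next
      assume "w i \<in> germs C ?c \<and> a i = w i ?c"
      thus ?thesis by (intro B(2)) (auto simp: A_def)
    qed
    from B_zero[OF B_poly_function[OF F(1) this] gen_pullback[OF zero]] F(2) show False by blast
  qed
  then obtain f where f: "f \<in> germs Y y" "\<forall>\<^sub>F w in gen Y. f w = \<zeta> (q w)" using reg[OF y(1)] by blast
  \<comment> \<open>\<open>\<zeta>\<close> is regular at the centre while its inverse has value 0,
    so their product 1 would have value 0.\<close>
  have "B (\<lambda>z. f z * t z) (f y * 0)" by (rule B_mult[OF y(2)[OF f(1)] B(3)])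
  moreover have "\<forall>\<^sub>F z in gen Y. 1 = f z * t z"
    using nz f(2) by eventually_elim (simp add: t_def)
  ultimately have "B (\<lambda>_. 1) 0" using B_cong by fastforce
  with B_const[of 1] B_unique show False by fastforce
qed

section \<open>Finite groups acting on subspaces of projective space\<close>

text \<open>Otherwise the product of all \<open>X - a\<close>, increased by 1, would be a
  nonconstant polynomial without roots.\<close>

lemma alg_closed_infinite: "infinite (UNIV :: 'k::alg_closed_field set)"
proof
  assume fin: "finite (UNIV :: 'k set)"
  define p where "p = (\<Prod>a\<in>(UNIV :: 'k set). [:- a, 1:])"
  have "degree p = (\<Sum>a\<in>(UNIV :: 'k set). degree [:- a, 1:])"
    unfolding p_def by (rule degree_prod_eq_sum_degree) simp
  hence "degree p > 0" using fin by (simp add: card_gt_0_iff)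
  hence "degree (p + 1) > 0" by (subst degree_add_eq_left) auto
  then obtain a where "poly (p + 1) a = 0" using alg_closed_imp_poly_has_root by blast
  moreover have "poly p a = 0" unfolding p_def poly_prod using fin by (intro prod_zero) auto
  ultimately show False by simp
qed

text \<open>One parameter suffices for a linear form in general position: each \<open>v\<close>
  gives a nonzero polynomial in \<open>s\<close>, and an infinite field has a point outside the
  finitely many roots.\<close>

lemma power_combination_nonzero:
  fixes V :: "(nat \<Rightarrow> 'k::alg_closed_field) set"
  assumes "finite V" "\<And>v. v \<in> V \<Longrightarrow> \<exists>i<n. v i \<noteq> 0"
  obtains s where "\<And>v. v \<in> V \<Longrightarrow> (\<Sum>i<n. s ^ i * v i) \<noteq> 0"
proof -
  define P where "P v = (\<Sum>i<n. monom (v i) i)" for v :: "nat \<Rightarrow> 'k"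
  have nz: "P v \<noteq> 0" if v: "v \<in> V" for v
  proof -
    obtain i where i: "i < n" "v i \<noteq> 0" using assms(2)[OF v] by blast
    have "coeff (P v) i = v i" using i(1) by (simp add: P_def coeff_sum)
    thus ?thesis using i(2) by auto
  qed
  have "finite (\<Union>v\<in>V. {x. poly (P v) x = 0})" using assms(1) poly_roots_finite[OF nz] by blast
  then obtain s where "s \<notin> (\<Union>v\<in>V. {x. poly (P v) x = 0})"
    using alg_closed_infinite ex_new_if_finite by blast
  thus ?thesis by (intro that[of s]) (auto simp: P_def poly_sum poly_monom mult.commute)
qed

text \<open>Two choices in general position: a linear form that vanishes at no point of
  \<open>Q\<close>, and then a combination of the resulting coordinates that is nonzero on all
  differences between points of \<open>Q\<close>.\<close>

lemma separating_function:
  fixes D :: "'k::alg_closed_field vec set set"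
  assumes "projective_subspace n D" "finite Q" "Q \<subseteq> D"
  obtains l a where "hom_poly n 1 l" "\<And>z. z \<in> Q \<Longrightarrow> l (lift z) \<noteq> 0"
    "\<And>z. z \<in> Q \<Longrightarrow> a \<in> germs (induced (proj_space n) D) z" "inj_on a Q"
proof -
  interpret projective_subspace n D by fact
  have "\<exists>i<n. v i \<noteq> 0" if "v \<in> (\<lambda>z i. lift z $ i) ` Q" for v
    using that assms(3) subset lift_nonzero[of _ n] by auto
  then obtain s where s: "\<And>v. v \<in> (\<lambda>z i. lift z $ i) ` Q \<Longrightarrow> (\<Sum>i<n. s ^ i * v i) \<noteq> 0"
    using power_combination_nonzero[of "(\<lambda>z i. lift z $ i) ` Q" n] assms(2) by blast
  define l where "l v = (\<Sum>i<n. s ^ i * v $ i)" for v :: "'k vec"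
  have l: "hom_poly n 1 l" unfolding l_def[abs_def] by (rule hom_poly_linear)
  have lz: "l (lift z) \<noteq> 0" if "z \<in> Q" for z using s that by (auto simp: l_def)
  let ?V = "(\<lambda>(z, w) i. coord l i z - coord l i w) ` {(z, w) \<in> Q \<times> Q. z \<noteq> w}"
  have "finite {(z, w) \<in> Q \<times> Q. z \<noteq> w}" by (rule finite_subset[of _ "Q \<times> Q"]) (use assms(2) in auto)
  hence "finite ?V" by simp
  moreover have "\<exists>i<n. v i \<noteq> 0" if v: "v \<in> ?V" for v
  proof -
    obtain z w where zw: "z \<in> Q" "w \<in> Q" "z \<noteq> w" "v = (\<lambda>i. coord l i z - coord l i w)" using v by auto
    have "z \<in> proj_points n" "w \<in> proj_points n" using zw assms(3) subset by auto
    from coord_inject[OF this lz[OF zw(1)] lz[OF zw(2)]] zw(3,4) show ?thesis by auto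
  qed
  ultimately obtain u where u: "\<And>v. v \<in> ?V \<Longrightarrow> (\<Sum>i<n. u ^ i * v i) \<noteq> 0"
    using power_combination_nonzero[of ?V n] by blast
  define a where "a z = (\<Sum>i<n. u ^ i * coord l i z)" for z :: "'k vec set"
  show ?thesis
  proof (rule that[OF l lz])
    show "a \<in> germs Y z" if "z \<in> Q" for z
    proof -
      have "z \<in> D" using that assms(3) by blast
      thus ?thesis unfolding a_def[abs_def] using lz[OF that] pts_Y
        by (intro germs_sum germs_mult germs_const coord_germ l) auto
    qed
    show "inj_on a Q"
    proof (rule inj_onI, rule ccontr)
      fix z w assume zw: "z \<in> Q" "w \<in> Q" "a z = a w" "z \<noteq> w"
      hence "(\<lambda>i. coord l i z - coord l i w) \<in> ?V" by (intro image_eqI[of _ _ "(z, w)"]) auto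
      from u[OF this] zw(3) show False by (simp add: a_def right_diff_distrib sum_subtractf)
    qed
  qed
qed

text \<open>What is retained of the geometry once \<open>S\<close> acts on \<open>D\<close>: a
  finite abstract group whose orbits are the fibres of \<open>q\<close>. \<open>moved_open\<close>
  says that fixed loci are closed; for linear actions it is supplied by
  \<open>moved_points_open\<close>.\<close>

locale finite_group_quotient =
  projective_subspace n D + dominant_map "induced (proj_space n) D" C q + G: group G
  for n :: nat and D :: "'k::alg_closed_field vec set set" and C :: "('q, 'k) fun_space" and q
    and G :: "('g, 'm) monoid_scheme" +
  fixes act :: "'g \<Rightarrow> 'k vec set \<Rightarrow> 'k vec set" and m h :: nat
  assumes finite_G: "finite (carrier G)"
    and act_closed: "g \<in> carrier G \<Longrightarrow> z \<in> D \<Longrightarrow> act g z \<in> D"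
    and act_one: "z \<in> D \<Longrightarrow> act \<one>\<^bsub>G\<^esub> z = z"
    and act_mult: "g \<in> carrier G \<Longrightarrow> k \<in> carrier G \<Longrightarrow> z \<in> D \<Longrightarrow> act (g \<otimes>\<^bsub>G\<^esub> k) z = act g (act k z)"
    and act_open: "g \<in> carrier G \<Longrightarrow> openin (fs_top Y) U \<Longrightarrow> openin (fs_top Y) {z \<in> D. act g z \<in> U}"
    and act_germ: "g \<in> carrier G \<Longrightarrow> z \<in> D \<Longrightarrow> f \<in> germs Y (act g z) \<Longrightarrow> (\<lambda>z. f (act g z)) \<in> germs Y z"
    and moved_open: "g \<in> carrier G \<Longrightarrow> openin (fs_top Y) {z \<in> D. act g z \<noteq> z}"
    and fibre: "z \<in> D \<Longrightarrow> w \<in> D \<Longrightarrow> q z = q w \<longleftrightarrow> (\<exists>g\<in>carrier G. w = act g z)"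
    and order: "card (carrier G) = m * h"
    and degree: "ring.dimension (function_field Y) m (pullback Y q ` carrier (function_field C))
      (carrier (function_field Y))"
    and generic_stabilizer: "\<forall>\<^sub>F z in gen Y. card {g \<in> carrier G. act g z = z} = h"
begin

definition Stab where "Stab z = {g \<in> carrier G. act g z = z}"

definition Ker where "Ker = {g \<in> carrier G. \<forall>z\<in>D. act g z = z}"

definition Orb where "Orb z = (\<lambda>g. act g z) ` carrier G"

text \<open>The points on which the quotient of \<open>G\<close> by \<open>Ker\<close> acts
  freely.\<close>

definition Free where "Free = {z \<in> D. Stab z = Ker}"

section \<open>Orbits, stabilizers and generic points\<close>

lemma act_inv: "g \<in> carrier G \<Longrightarrow> z \<in> D \<Longrightarrow> act (inv\<^bsub>G\<^esub> g) (act g z) = z"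
  using act_mult[of "inv\<^bsub>G\<^esub> g" g z] act_one by simp

lemma act_inv': "g \<in> carrier G \<Longrightarrow> z \<in> D \<Longrightarrow> act g (act (inv\<^bsub>G\<^esub> g) z) = z"
  using act_mult[of g "inv\<^bsub>G\<^esub> g" z] act_one by simp

lemma q_act: "g \<in> carrier G \<Longrightarrow> z \<in> D \<Longrightarrow> q (act g z) = q z"
  using fibre[of z "act g z"] act_closed by auto

lemma Orb_subset: "z \<in> D \<Longrightarrow> Orb z \<subseteq> D"
  using act_closed by (auto simp: Orb_def)

lemma Orb_self: "z \<in> D \<Longrightarrow> z \<in> Orb z"
  unfolding Orb_def using act_one G.one_closed by (metis image_eqI)

lemma finite_Orb: "finite (Orb z)"
  using finite_G by (simp add: Orb_def)

lemma Orb_act: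
  assumes "g \<in> carrier G" "z \<in> D"
  shows "Orb (act g z) = Orb z"
proof
  show "Orb (act g z) \<subseteq> Orb z"
    using assms act_mult[symmetric] by (force simp: Orb_def)
  show "Orb z \<subseteq> Orb (act g z)"
  proof
    fix w assume "w \<in> Orb z"
    then obtain k where k: "k \<in> carrier G" "w = act k z" by (auto simp: Orb_def)
    have "w = act (k \<otimes>\<^bsub>G\<^esub> inv\<^bsub>G\<^esub> g) (act g z)"
      using k assms act_closed[OF assms] by (simp add: act_mult act_inv)
    thus "w \<in> Orb (act g z)" using k(1) assms(1) by (auto simp: Orb_def)
  qed
qed

lemma Orb_eq_fibre: "x \<in> D \<Longrightarrow> Orb x = {z \<in> D. q z = q x}"
  using fibre[of x] unfolding Orb_def by (auto simp: q_act act_closed image_iff) metis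

text \<open>The fibres of the orbit map are translates of \<open>Stab z\<close>.\<close>

lemma card_Orb_Stab: assumes "z \<in> D" shows "card (Orb z) * card (Stab z) = card (carrier G)"
proof -
  have "card {g \<in> carrier G. act g z = w} = card (Stab z)" if "w \<in> Orb z" for w
  proof -
    obtain k where k: "k \<in> carrier G" "w = act k z" using \<open>w \<in> Orb z\<close> by (auto simp: Orb_def)
    have "bij_betw (\<lambda>g. k \<otimes>\<^bsub>G\<^esub> g) (Stab z) {g \<in> carrier G. act g z = w}"
    proof (rule bij_betw_byWitness[where f' = "\<lambda>g. inv\<^bsub>G\<^esub> k \<otimes>\<^bsub>G\<^esub> g"])
      show "\<forall>g\<in>Stab z. inv\<^bsub>G\<^esub> k \<otimes>\<^bsub>G\<^esub> (k \<otimes>\<^bsub>G\<^esub> g) = g"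
        using k(1) by (auto simp: Stab_def G.inv_solve_left' simp flip: G.m_assoc)
      show "\<forall>g\<in>{g \<in> carrier G. act g z = w}. k \<otimes>\<^bsub>G\<^esub> (inv\<^bsub>G\<^esub> k \<otimes>\<^bsub>G\<^esub> g) = g"
        using k(1) by (auto simp flip: G.m_assoc)
      show "(\<lambda>g. k \<otimes>\<^bsub>G\<^esub> g) ` Stab z \<subseteq> {g \<in> carrier G. act g z = w}"
        using k assms by (auto simp: Stab_def act_mult)
      show "(\<lambda>g. inv\<^bsub>G\<^esub> k \<otimes>\<^bsub>G\<^esub> g) ` {g \<in> carrier G. act g z = w} \<subseteq> Stab z"
        using k assms by (auto simp: Stab_def act_mult act_inv)
    qed
    thus ?thesis by (simp add: bij_betw_same_card)
  qed
  hence "(\<Sum>w\<in>Orb z. card {g \<in> carrier G. act g z = w}) = card (Orb z) * card (Stab z)" by simp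
  moreover have "(\<Sum>w\<in>Orb z. card {g \<in> carrier G. act g z = w}) = card (carrier G)"
    using sum.group[OF finite_G finite_Orb, of "\<lambda>g. act g z" z "\<lambda>_. 1::nat"] by (simp add: Orb_def)
  ultimately show ?thesis by simp
qed

lemma gen_act: "g \<in> carrier G \<Longrightarrow> eventually P (gen Y) \<Longrightarrow> \<forall>\<^sub>F z in gen Y. P (act g z)"
proof -
  assume g: "g \<in> carrier G" and "eventually P (gen Y)"
  from eventually_genE[OF this(2)]
  obtain U where U: "openin (fs_top Y) U" "U \<noteq> {}" "\<And>z. z \<in> U \<Longrightarrow> P z" by blast
  obtain u where "u \<in> U" "u \<in> D" using U openin_subset pts_Y by blast
  hence "act (inv\<^bsub>G\<^esub> g) u \<in> {z \<in> D. act g z \<in> U}" using g by (simp add: act_closed act_inv')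
  thus ?thesis using act_open[OF g U(1)] U(3) by (intro eventually_genI[of "{z \<in> D. act g z \<in> U}"]) auto
qed

lemma Ker_subset_Stab: "z \<in> D \<Longrightarrow> Ker \<subseteq> Stab z"
  by (auto simp: Ker_def Stab_def)

text \<open>Each element outside \<open>Ker\<close> moves a nonempty open set of points, and
  finitely many generic conditions hold simultaneously.\<close>

lemma generic_Free: "\<forall>\<^sub>F z in gen Y. z \<in> Free"
proof -
  have "\<forall>\<^sub>F z in gen Y. act g z \<noteq> z" if "g \<in> carrier G - Ker" for g
  proof (rule eventually_genI)
    show "openin (fs_top Y) {z \<in> D. act g z \<noteq> z}" using moved_open that by blast
    show "{z \<in> D. act g z \<noteq> z} \<noteq> {}" using that by (auto simp: Ker_def)
  qed auto
  hence "\<forall>\<^sub>F z in gen Y. \<forall>g\<in>carrier G - Ker. act g z \<noteq> z"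
    using finite_G by (intro eventually_ball_finite) auto
  with eventually_pts show ?thesis
  proof eventually_elim
    case (elim z)
    thus ?case unfolding pts_Y Free_def using Ker_subset_Stab[of z] by (auto simp: Stab_def)
  qed
qed

lemma Free_nonempty: "\<exists>z. z \<in> Free"
  using eventually_happens'[OF gen_nontrivial generic_Free] .

lemma card_Ker: "card Ker = h"
proof -
  have "\<forall>\<^sub>F z in gen Y. card Ker = h"
    using generic_Free generic_stabilizer by eventually_elim (auto simp: Free_def Stab_def)
  thus ?thesis by simp
qed

text \<open>\<open>Ker\<close> contains the identity, so \<open>h\<close> is positive and cancels
  from the orbit-stabilizer formula.\<close>

lemma card_Orb_Free:
  assumes "z \<in> Free"
  shows "card (Orb z) = m"
proof -
  have "\<one>\<^bsub>G\<^esub> \<in> Ker" using act_one by (simp add: Ker_def)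
  moreover have "finite Ker" using finite_G by (simp add: Ker_def)
  ultimately have "h > 0" using card_Ker card_gt_0_iff by blast
  moreover have "card (Orb z) * h = m * h"
    using card_Orb_Stab[of z] assms order card_Ker by (simp add: Free_def)
  ultimately show ?thesis by simp
qed

lemma Free_act: "g \<in> carrier G \<Longrightarrow> \<forall>\<^sub>F z in gen Y. act g z \<in> Free"
  using gen_act[OF _ generic_Free] .

lemma representatives:
  assumes "x \<in> D"
  obtains t where "\<And>w. w \<in> Orb x \<Longrightarrow> t w \<in> carrier G" "\<And>w. w \<in> Orb x \<Longrightarrow> act (t w) x = w"
proof -
  have "\<forall>w. \<exists>g. w \<in> Orb x \<longrightarrow> g \<in> carrier G \<and> act g x = w" by (auto simp: Orb_def)
  then obtain t where "\<forall>w. w \<in> Orb x \<longrightarrow> t w \<in> carrier G \<and> act (t w) x = w" by metis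
  thus ?thesis by (intro that[of t]) auto
qed

text \<open>If \<open>t w\<close> and \<open>t w'\<close> agree on \<open>z\<close>, their quotient
  lies in \<open>Stab z = Ker\<close> and hence fixes \<open>x\<close>. Representatives chosen at
  \<open>x\<close> therefore enumerate the orbit of every free point, which makes sums over them
  traces.\<close>

lemma representatives_bij:
  assumes x: "x \<in> Free" and z: "z \<in> Free"
    and t: "\<And>w. w \<in> Orb x \<Longrightarrow> t w \<in> carrier G" "\<And>w. w \<in> Orb x \<Longrightarrow> act (t w) x = w"
  shows "bij_betw (\<lambda>w. act (t w) z) (Orb x) (Orb z)"
proof -
  have xD: "x \<in> D" and zD: "z \<in> D" using x z by (auto simp: Free_def)
  have "inj_on (\<lambda>w. act (t w) z) (Orb x)"
  proof (rule inj_onI)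
    fix w w' assume w: "w \<in> Orb x" "w' \<in> Orb x" "act (t w) z = act (t w') z"
    let ?k = "inv\<^bsub>G\<^esub> (t w) \<otimes>\<^bsub>G\<^esub> t w'"
    have k: "?k \<in> carrier G" using t(1) w by simp
    have "act ?k z = act (inv\<^bsub>G\<^esub> (t w)) (act (t w) z)" using t(1) w zD by (simp add: act_mult)
    also have "\<dots> = z" using t(1) w(1) zD by (simp add: act_inv)
    finally have "?k \<in> Stab z" using k by (simp add: Stab_def)
    hence "?k \<in> Stab x" using x z by (simp add: Free_def)
    hence "act (inv\<^bsub>G\<^esub> (t w)) (act (t w') x) = x" using t(1) w xD by (simp add: Stab_def act_mult)
    hence "act (t w) (act (inv\<^bsub>G\<^esub> (t w)) w') = act (t w) x" using t(2)[OF w(2)] by simp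
    moreover have "w' \<in> D" using w(2) Orb_subset[OF xD] by blast
    ultimately show "w = w'" using t w(1) by (simp add: act_inv')
  qed
  moreover have "(\<lambda>w. act (t w) z) ` Orb x \<subseteq> Orb z" using t(1) by (auto simp: Orb_def)
  moreover have "card (Orb x) = card (Orb z)" using card_Orb_Free x z by simp
  ultimately show ?thesis
    unfolding bij_betw_def by (metis card_image card_subset_eq finite_Orb)
qed

section \<open>The function field of the quotient\<close>

text \<open>The pullbacks from \<open>C\<close> are invariant, and \<open>1, a, \<dots>, a\<^sup>m\<^sup>-\<^sup>1\<close> are linearly independent over
  the invariants when \<open>a\<close> takes distinct values on a free orbit, since a polynomial of degree less
  than \<open>m\<close> cannot vanish on these. So an invariant \<open>u\<close> outside the pullbacks would give
  \<open>m + 1\<close> independent elements \<open>u, 1, a, \<dots>, a\<^sup>m\<^sup>-\<^sup>1\<close>.\<close>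

lemma pullbacks: "pullback Y q ` carrier (function_field C) = (\<lambda>g. cls Y (\<lambda>z. g (q z))) ` rationals C"
  unfolding C.carrier_function_field image_image by (rule image_cong[OF refl pullback_cls])

lemma subfield_pullbacks: "subfield (pullback Y q ` carrier (function_field C)) (function_field Y)"
proof -
  interpret KY: field "function_field Y" by (rule field_function_field)
  interpret KC: field "function_field C" by (rule C.field_function_field)
  have hom: "pullback Y q \<in> Ring.ring_hom (function_field C) (function_field Y)"
  proof (rule ring_hom_memI)
    fix a assume "a \<in> carrier (function_field C)"
    then obtain f where f: "f \<in> rationals C" "a = cls C f" by (rule C.carrier_function_fieldE)
    thus "pullback Y q a \<in> carrier (function_field Y)"
      by (simp add: pullback_cls cls_in_carrier rationals_pullback)
    fix b assume "b \<in> carrier (function_field C)"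
    then obtain g where g: "g \<in> rationals C" "b = cls C g" by (rule C.carrier_function_fieldE)
    show "pullback Y q (a \<otimes>\<^bsub>function_field C\<^esub> b) = pullback Y q a \<otimes>\<^bsub>function_field Y\<^esub> pullback Y q b"
      using f g by (simp add: pullback_cls cls_mult C.cls_mult C.rationals_mult rationals_pullback)
    show "pullback Y q (a \<oplus>\<^bsub>function_field C\<^esub> b) = pullback Y q a \<oplus>\<^bsub>function_field Y\<^esub> pullback Y q b"
      using f g by (simp add: pullback_cls cls_add C.cls_add C.rationals_add rationals_pullback)
  next
    show "pullback Y q \<one>\<^bsub>function_field C\<^esub> = \<one>\<^bsub>function_field Y\<^esub>"
      by (simp add: cls_one C.cls_one pullback_cls C.rationals_const)
  qed
  interpret ring_hom_ring "function_field C" "function_field Y" "pullback Y q"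
    by (rule ring_hom_ringI2[OF KC.ring_axioms KY.ring_axioms hom])
  show ?thesis
    using img_is_subfield(2)[OF KC.carrier_is_subfield] KY.one_not_zero by blast
qed

lemma combine_cls:
  assumes "length ks = length us" "set ks \<subseteq> rationals Y" "set us \<subseteq> rationals Y"
  shows "ring.combine (function_field Y) (map (cls Y) ks) (map (cls Y) us) =
      cls Y (\<lambda>z. \<Sum>j<length us. (ks ! j) z * (us ! j) z) \<and>
    (\<lambda>z. \<Sum>j<length us. (ks ! j) z * (us ! j) z) \<in> rationals Y"
  using assms
proof (induction ks us rule: list_induct2)
  case Nil
  interpret KY: field "function_field Y" by (rule field_function_field)
  show ?case by (simp add: cls_zero rationals_const)
next
  case (Cons k ks u us)
  interpret KY: field "function_field Y" by (rule field_function_field)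
  show ?case using Cons
    by (simp add: cls_mult cls_add rationals_mult rationals_add sum.lessThan_Suc_shift del: sum.lessThan_Suc)
qed

lemma invariant_is_pullback:
  assumes u: "u \<in> rationals Y" and inv: "\<And>g. g \<in> carrier G \<Longrightarrow> \<forall>\<^sub>F z in gen Y. u (act g z) = u z"
  shows "\<exists>g\<in>rationals C. \<forall>\<^sub>F z in gen Y. u z = g (q z)"
proof -
  interpret KY: field "function_field Y" by (rule field_function_field)
  let ?L = "pullback Y q ` carrier (function_field C)"
  obtain x where x: "x \<in> Free" using Free_nonempty by blast
  hence xD: "x \<in> D" by (simp add: Free_def)
  obtain l a where a: "\<And>z. z \<in> Orb x \<Longrightarrow> a \<in> germs Y z" "inj_on a (Orb x)"
    by (rule separating_function[OF projective_subspace_axioms finite_Orb Orb_subset[OF xD]], rule that)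
  obtain t where t: "\<And>w. w \<in> Orb x \<Longrightarrow> t w \<in> carrier G" "\<And>w. w \<in> Orb x \<Longrightarrow> act (t w) x = w"
    by (rule representatives[OF xD], rule that)
  have ar: "a \<in> rationals Y" using a(1)[OF Orb_self[OF xD]] by (rule germs_rationals)
  \<comment> \<open>One element more than the dimension \<open>m\<close> over the pullbacks allows
    to be independent.\<close>
  define us where "us = u # map (\<lambda>i z. a z ^ i) [0..<m]"
  have us: "set us \<subseteq> rationals Y" using u ar by (auto simp: us_def intro: rationals_power)
  have dep: "\<not> KY.independent ?L (map (cls Y) us)"
  proof
    assume "KY.independent ?L (map (cls Y) us)"
    from KY.independent_length_le_dimension[OF subfield_pullbacks degree this] us
    have "length us \<le> m" using cls_in_carrier by auto
    thus False by (simp add: us_def)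
  qed
  have carr: "set (map (cls Y) us) \<subseteq> carrier (function_field Y)" using us cls_in_carrier by auto
  obtain Ks where Ks: "length Ks = length us" "KY.combine Ks (map (cls Y) us) = \<zero>\<^bsub>function_field Y\<^esub>"
    "set Ks \<subseteq> ?L" "set Ks \<noteq> {\<zero>\<^bsub>function_field Y\<^esub>}"
    by (rule KY.dependent_imp_non_trivial_combine[OF subfield_pullbacks carr dep], rule that) simp_all
  have "\<forall>j<length us. \<exists>\<phi>\<in>rationals C. Ks ! j = cls Y (\<lambda>z. \<phi> (q z))"
  proof (intro allI impI)
    fix j assume "j < length us"
    hence "Ks ! j \<in> ?L" using Ks(1,3) nth_mem[of j Ks] by auto
    thus "\<exists>\<phi>\<in>rationals C. Ks ! j = cls Y (\<lambda>z. \<phi> (q z))" unfolding pullbacks by auto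
  qed
  then obtain \<phi> where \<phi>: "\<And>j. j < length us \<Longrightarrow> \<phi> j \<in> rationals C \<and> Ks ! j = cls Y (\<lambda>z. \<phi> j (q z))" by metis
  have len: "length us = Suc m" by (simp add: us_def)
  define ks where "ks = map (\<lambda>j z. \<phi> j (q z)) [0..<Suc m]"
  have Ks_eq: "Ks = map (cls Y) ks"
    using Ks(1) \<phi> len by (intro nth_equalityI) (auto simp: ks_def simp del: upt_Suc)
  have ks: "set ks \<subseteq> rationals Y" using \<phi> len rationals_pullback by (auto simp: ks_def simp del: upt_Suc)
  have lks: "length ks = length us" by (simp add: ks_def len)
  note comb = combine_cls[OF lks ks us]
  have us_nth: "(us ! Suc i) z = a z ^ i" if "i < m" for i z using that by (simp add: us_def)
  have sum_eq: "(\<Sum>j<length us. (ks ! j) z * (us ! j) z) = \<phi> 0 (q z) * u z + (\<Sum>i<m. \<phi> (Suc i) (q z) * a z ^ i)" for z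
  proof -
    have "(\<Sum>j<length us. (ks ! j) z * (us ! j) z) = \<phi> 0 (q z) * (us ! 0) z + (\<Sum>i<m. \<phi> (Suc i) (q z) * (us ! Suc i) z)"
      unfolding len sum.lessThan_Suc_shift by (simp add: ks_def del: upt_Suc)
    thus ?thesis using us_nth by (simp add: us_def[of] )
  qed
  have "cls Y (\<lambda>z. \<Sum>j<length us. (ks ! j) z * (us ! j) z) = \<zero>\<^bsub>function_field Y\<^esub>"
    using comb Ks(2) unfolding Ks_eq by simp
  hence rel: "\<forall>\<^sub>F z in gen Y. \<phi> 0 (q z) * u z + (\<Sum>i<m. \<phi> (Suc i) (q z) * a z ^ i) = 0"
    using comb cls_eq_zero_iff unfolding sum_eq by blast
  \<comment> \<open>The term in \<open>u\<close> is absorbed into the constant coefficient. All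
    \<open>c i\<close> are then generically invariant, and the relation is a polynomial equation of
    degree below \<open>m\<close> for \<open>a\<close>.\<close>
  define c where "c i z = (if i = 0 then \<phi> 0 (q z) * u z else 0) + \<phi> (Suc i) (q z)" for i z
  have m0: "m > 0" using card_Orb_Free[OF x] Orb_self[OF xD] finite_Orb by (auto simp: card_gt_0_iff)
  have c_sum: "(\<Sum>i<m. c i z * b ^ i) = \<phi> 0 (q z) * u z + (\<Sum>i<m. \<phi> (Suc i) (q z) * b ^ i)" for z b
  proof -
    have "(\<Sum>i<m. c i z * b ^ i) = (\<Sum>i<m. (if i = 0 then \<phi> 0 (q z) * u z else 0)) + (\<Sum>i<m. \<phi> (Suc i) (q z) * b ^ i)"
      unfolding sum.distrib[symmetric] by (intro sum.cong) (auto simp: c_def distrib_right)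
    also have "(\<Sum>i<m. (if i = 0 then \<phi> 0 (q z) * u z else 0)) = \<phi> 0 (q z) * u z" using m0 by simp
    finally show ?thesis .
  qed
  have roots: "\<forall>\<^sub>F z in gen Y. \<forall>w\<in>Orb x. (\<Sum>i<m. c i z * a (act (t w) z) ^ i) = 0"
  proof (intro eventually_ball_finite finite_Orb ballI)
    fix w assume w: "w \<in> Orb x"
    from gen_act[OF t(1)[OF w] rel] inv[OF t(1)[OF w]] eventually_pts
    show "\<forall>\<^sub>F z in gen Y. (\<Sum>i<m. c i z * a (act (t w) z) ^ i) = 0"
      by eventually_elim (simp add: c_sum pts_Y q_act[OF t(1)[OF w]] del: fs_top_induced)
  qed
  \<comment> \<open>At \<open>x\<close> these are the distinct values of \<open>a\<close> on its
    orbit. That finitely many differences of germs are nonzero at \<open>x\<close> spreads to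
    generic points.\<close>
  have distinct: "\<forall>\<^sub>F z in gen Y. inj_on (\<lambda>w. a (act (t w) z)) (Orb x)"
  proof -
    have "\<forall>\<^sub>F z in gen Y. a (act (t w) z) - a (act (t w') z) \<noteq> 0" if "w \<in> Orb x" "w' \<in> Orb x" "w \<noteq> w'" for w w'
    proof (rule germs_nonzero[where x = x])
      show "(\<lambda>z. a (act (t w) z) - a (act (t w') z)) \<in> germs Y x"
        using that t xD a(1) by (intro germs_diff act_germ) auto
      show "a (act (t w) x) - a (act (t w') x) \<noteq> 0" using that t(2) a(2) by (auto dest: inj_onD)
    qed
    hence "\<forall>\<^sub>F z in gen Y. \<forall>w\<in>Orb x. \<forall>w'\<in>Orb x. w \<noteq> w' \<longrightarrow> a (act (t w) z) - a (act (t w') z) \<noteq> 0"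
      by (intro eventually_ball_finite finite_Orb ballI) (auto intro: eventually_mono)
    thus ?thesis by eventually_elim (auto intro!: inj_onI)
  qed
  have zero: "\<forall>\<^sub>F z in gen Y. \<forall>i<m. c i z = 0"
    using roots distinct
  proof eventually_elim
    case (elim z)
    define p where "p = (\<Sum>i<m. monom (c i z) i)"
    have pc: "coeff p i = (if i < m then c i z else 0)" for i by (simp add: p_def coeff_sum)
    have "p = 0"
    proof (rule ccontr)
      assume p0: "p \<noteq> 0"
      have "degree p < m"
        by (rule le_less_trans[of _ "m - 1"], rule degree_le) (use pc m0 in auto)
      moreover have "(\<lambda>w. a (act (t w) z)) ` Orb x \<subseteq> {b. poly p b = 0}"
        using elim(1) by (auto simp: p_def poly_sum poly_monom)
      hence "card ((\<lambda>w. a (act (t w) z)) ` Orb x) \<le> card {b. poly p b = 0}"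
        by (rule card_mono[OF poly_roots_finite[OF p0]])
      moreover have "card ((\<lambda>w. a (act (t w) z)) ` Orb x) = m"
        using card_image[OF elim(2)] card_Orb_Free[OF x] by simp
      ultimately show False using card_poly_roots_bound[OF p0] by linarith
    qed
    thus ?case using pc by (metis coeff_0)
  qed
  have \<phi>r: "(\<lambda>z. \<phi> j (q z)) \<in> rationals Y" "\<phi> j \<in> rationals C" if "j \<le> m" for j
    using that \<phi>[of j] len rationals_pullback by auto
  show ?thesis
  \<comment> \<open>If the coefficient of \<open>u\<close> vanished, all coefficients would, against
    the choice of \<open>Ks\<close>. Otherwise the equation \<open>c 0 = 0\<close> is solved for
    \<open>u\<close>.\<close>
  proof (cases "\<forall>\<^sub>F z in gen Y. \<phi> 0 (q z) = 0")
    case True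
    have "\<forall>\<^sub>F z in gen Y. \<phi> j (q z) = 0" if j: "j \<le> m" for j
    proof (cases j)
      case (Suc i)
      have "i < m" using Suc j by simp
      from zero True show ?thesis by eventually_elim (use \<open>i < m\<close> in \<open>auto simp: c_def Suc split: if_splits\<close>)
    qed (use True in simp)
    hence "cls Y (\<lambda>z. \<phi> j (q z)) = \<zero>\<^bsub>function_field Y\<^esub>" if "j \<le> m" for j
      using cls_eq_zero_iff[OF \<phi>r(1)[OF that]] that by blast
    hence "set Ks \<subseteq> {\<zero>\<^bsub>function_field Y\<^esub>}" unfolding Ks_eq by (auto simp: ks_def less_Suc_eq_le simp del: upt_Suc)
    moreover have "set Ks \<noteq> {}" using Ks(1) len by auto
    ultimately have "set Ks = {\<zero>\<^bsub>function_field Y\<^esub>}" by (metis subset_singletonD)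
    thus ?thesis using Ks(4) by simp
  next
    case False
    hence nz: "\<forall>\<^sub>F z in gen Y. \<phi> 0 (q z) \<noteq> 0" using rationals_zero_or_nonzero[OF \<phi>r(1)[of 0]] by blast
    with zero have "\<forall>\<^sub>F z in gen Y. u z = - \<phi> (Suc 0) (q z) / \<phi> 0 (q z)"
    proof eventually_elim
      case (elim z)
      have "\<phi> 0 (q z) * u z + \<phi> (Suc 0) (q z) = 0" using elim(1) m0 by (auto simp: c_def)
      thus ?case using elim(2) by (simp add: field_simps eq_neg_iff_add_eq_0)
    qed
    moreover have "(\<lambda>c. - \<phi> (Suc 0) c / \<phi> 0 c) \<in> rationals C"
      using \<phi>r(2) m0 by (intro C.rationals_divide C.rationals_uminus) auto
    ultimately show ?thesis by (intro bexI[of _ "\<lambda>c. - \<phi> (Suc 0) c / \<phi> 0 c"])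
  qed
qed

end

section \<open>Ramification\<close>

lemma (in cring) idealI_closed:
  assumes "I \<subseteq> carrier R" "\<zero> \<in> I" "\<And>a b. a \<in> I \<Longrightarrow> b \<in> I \<Longrightarrow> a \<oplus> b \<in> I"
    "\<And>a x. a \<in> I \<Longrightarrow> x \<in> carrier R \<Longrightarrow> x \<otimes> a \<in> I"
  shows "ideal I R"
proof (rule idealI[OF ring_axioms])
  show "subgroup I (add_monoid R)"
  proof (rule add.subgroupI)
    show "I \<subseteq> carrier R" "I \<noteq> {}" using assms by auto
    show "\<ominus> a \<in> I" if "a \<in> I" for a
    proof -
      have "(\<ominus> \<one>) \<otimes> a = \<ominus> a" using that assms(1) by (simp add: l_minus subset_iff)
      thus ?thesis using assms(4)[OF that, of "\<ominus> \<one>"] by simp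
    qed
  qed (use assms(3) in auto)
  fix a x assume ax: "a \<in> I" "x \<in> carrier R"
  show xa: "x \<otimes> a \<in> I" by (rule assms(4)[OF ax])
  have "a \<in> carrier R" using ax(1) assms(1) by blast
  thus "a \<otimes> x \<in> I" using xa m_comm[OF ax(2)] by metis
qed

context irreducible_sheaf
begin

lemma cring_local_ring:
  assumes x: "x \<in> pts X"
  shows "cring ((function_field X)\<lparr>carrier := local_ring X x\<rparr>)"
proof -
  interpret K: cring "function_field X" by (rule cring_function_field)
  have sub: "local_ring X x \<subseteq> carrier (function_field X)"
    unfolding local_ring_eq carrier_function_field
    by (intro image_mono subsetI) (rule germs_rationals)
  have "subring (local_ring X x) (function_field X)"
  proof (rule K.subringI[OF sub])
    show "\<one>\<^bsub>function_field X\<^esub> \<in> local_ring X x"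
      unfolding cls_one local_ring_eq using germs_const[OF x] by (rule imageI)
    show "\<ominus>\<^bsub>function_field X\<^esub> a \<in> local_ring X x" if "a \<in> local_ring X x" for a
    proof -
      obtain f where f: "f \<in> germs X x" "a = cls X f" using \<open>a \<in> local_ring X x\<close> unfolding local_ring_eq by blast
      have r: "f \<in> rationals X" "(\<lambda>z. - f z) \<in> rationals X"
        using germs_rationals[OF f(1)] rationals_uminus by auto
      have "cls X (\<lambda>z. - f z) \<oplus>\<^bsub>function_field X\<^esub> cls X f = \<zero>\<^bsub>function_field X\<^esub>"
        using r by (simp add: cls_add cls_zero)
      hence "\<ominus>\<^bsub>function_field X\<^esub> a = cls X (\<lambda>z. - f z)"
        unfolding f(2) using r cls_in_carrier by (intro K.minus_equality) auto
      thus ?thesis unfolding local_ring_eq using germs_uminus[OF f(1)] by simp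
    qed
    show "a \<otimes>\<^bsub>function_field X\<^esub> b \<in> local_ring X x" "a \<oplus>\<^bsub>function_field X\<^esub> b \<in> local_ring X x"
      if ab: "a \<in> local_ring X x" "b \<in> local_ring X x" for a b
    proof -
      obtain f g where f: "f \<in> germs X x" "a = cls X f" and g: "g \<in> germs X x" "b = cls X g"
        using ab unfolding local_ring_eq by blast
      show "a \<otimes>\<^bsub>function_field X\<^esub> b \<in> local_ring X x"
        using germs_rationals[OF f(1)] germs_rationals[OF g(1)] germs_mult[OF f(1) g(1)]
        by (simp add: f(2) g(2) cls_mult local_ring_eq)
      show "a \<oplus>\<^bsub>function_field X\<^esub> b \<in> local_ring X x"
        using germs_rationals[OF f(1)] germs_rationals[OF g(1)] germs_add[OF f(1) g(1)]
        by (simp add: f(2) g(2) cls_add local_ring_eq)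
    qed
  qed
  hence "subcring (local_ring X x) (function_field X)" by (rule K.subcringI')
  from K.subcring_iff[OF sub] this show ?thesis by (rule iffD1)
qed

lemma ideal_local_ring:
  assumes x: "x \<in> pts X" and M: "M \<subseteq> germs X x" "(\<lambda>_. 0) \<in> M"
    "\<And>f g. f \<in> M \<Longrightarrow> g \<in> M \<Longrightarrow> (\<lambda>z. f z + g z) \<in> M"
    "\<And>f g. f \<in> germs X x \<Longrightarrow> g \<in> M \<Longrightarrow> (\<lambda>z. f z * g z) \<in> M"
  shows "ideal (cls X ` M) ((function_field X)\<lparr>carrier := local_ring X x\<rparr>)"
proof -
  interpret O: cring "(function_field X)\<lparr>carrier := local_ring X x\<rparr>" by (rule cring_local_ring[OF x])
  have r: "f \<in> rationals X" if "f \<in> M" for f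
    by (rule germs_rationals[OF subsetD[OF M(1) that]])
  show ?thesis
  proof (rule O.idealI_closed)
    show "cls X ` M \<subseteq> carrier ((function_field X)\<lparr>carrier := local_ring X x\<rparr>)"
      using M(1) by (auto simp: local_ring_eq)
    show "\<zero>\<^bsub>(function_field X)\<lparr>carrier := local_ring X x\<rparr>\<^esub> \<in> cls X ` M"
      using M(2) by (simp add: cls_zero)
    show "a \<oplus>\<^bsub>(function_field X)\<lparr>carrier := local_ring X x\<rparr>\<^esub> b \<in> cls X ` M"
      if "a \<in> cls X ` M" "b \<in> cls X ` M" for a b
      using that M(3) r by (auto simp: cls_add)
    show "y \<otimes>\<^bsub>(function_field X)\<lparr>carrier := local_ring X x\<rparr>\<^esub> a \<in> cls X ` M"
      if a: "a \<in> cls X ` M" and y: "y \<in> carrier ((function_field X)\<lparr>carrier := local_ring X x\<rparr>)" for a y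
    proof -
      obtain f where f: "f \<in> M" "a = cls X f" using a by blast
      obtain g where g: "g \<in> germs X x" "y = cls X g" using y by (auto simp: local_ring_eq)
      show ?thesis
        using M(4)[OF g(1) f(1)] by (simp add: f(2) g(2) cls_mult r[OF f(1)] germs_rationals[OF g(1)])
    qed
  qed
qed

end

context finite_group_quotient
begin

text \<open>\<open>ramified_at\<close> says exactly that this ideal differs from
  \<open>max_ideal Y x\<close>.\<close>

abbreviation local_ideal where
  "local_ideal x \<equiv> Idl\<^bsub>(function_field Y)\<lparr>carrier := local_ring Y x\<rparr>\<^esub>
    (pullback Y q ` normalized_local_ring C (q x) \<inter> max_ideal Y x)"

lemma local_ideal_generators:
  assumes x: "x \<in> D"
  shows "ideal (local_ideal x) ((function_field Y)\<lparr>carrier := local_ring Y x\<rparr>)"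
    and "pullback Y q ` normalized_local_ring C (q x) \<inter> max_ideal Y x \<subseteq> local_ideal x"
    and "local_ideal x \<subseteq> max_ideal Y x"
proof -
  have xp: "x \<in> pts Y" unfolding pts_Y by fact
  interpret O: cring "(function_field Y)\<lparr>carrier := local_ring Y x\<rparr>" by (rule cring_local_ring[OF xp])
  have sub: "pullback Y q ` normalized_local_ring C (q x) \<inter> max_ideal Y x
      \<subseteq> carrier ((function_field Y)\<lparr>carrier := local_ring Y x\<rparr>)"
    by (auto simp: max_ideal_eq local_ring_eq)
  show "ideal (local_ideal x) ((function_field Y)\<lparr>carrier := local_ring Y x\<rparr>)"
    by (rule O.genideal_ideal[OF sub])
  show "pullback Y q ` normalized_local_ring C (q x) \<inter> max_ideal Y x \<subseteq> local_ideal x"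
    by (rule O.genideal_self[OF sub])
  have "ideal (max_ideal Y x) ((function_field Y)\<lparr>carrier := local_ring Y x\<rparr>)"
    unfolding max_ideal_eq
    by (rule ideal_local_ring[OF xp]) (auto intro: germs_const[OF xp] germs_add germs_mult)
  thus "local_ideal x \<subseteq> max_ideal Y x" by (rule O.genideal_minimal) simp
qed

text \<open>Near a point with generic stabilizer, the generators \<open>y\<^sub>i - y\<^sub>i(x)\<close> of the maximal ideal agree
  up to its square with the traces of \<open>(y\<^sub>i - y\<^sub>i(x)) e\<^sup>2\<close>, where \<open>e\<close> is 1 at \<open>x\<close> and 0 on the rest
  of its orbit. These traces are invariant and regular on the whole fibre.\<close>

lemma max_ideal_generated:
  assumes x: "x \<in> Free" and C: "prevariety C" "separated C" "complete_space Y"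
  shows "max_ideal Y x \<subseteq> local_ideal x"
proof -
  have xD: "x \<in> D" using x by (simp add: Free_def)
  have xp: "x \<in> pts Y" unfolding pts_Y by (rule xD)
  note self = Orb_self[OF xD]
  obtain l a where l: "hom_poly n 1 l" "\<And>z. z \<in> Orb x \<Longrightarrow> l (lift z) \<noteq> 0"
    and a: "\<And>z. z \<in> Orb x \<Longrightarrow> a \<in> germs Y z" "inj_on a (Orb x)"
    by (rule separating_function[OF projective_subspace_axioms finite_Orb Orb_subset[OF xD]], rule that)
  obtain t where t: "\<And>w. w \<in> Orb x \<Longrightarrow> t w \<in> carrier G" "\<And>w. w \<in> Orb x \<Longrightarrow> act (t w) x = w"
    by (rule representatives[OF xD], rule that)
  have OrbD: "y \<in> D" "y \<in> pts Y" if "y \<in> Orb x" for y using Orb_subset[OF xD] that pts_Y by blast+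
  have moves: "act g y \<in> Orb x" if "g \<in> carrier G" "y \<in> Orb x" for g y
  proof -
    obtain k where "k \<in> carrier G" "y = act k x" using \<open>y \<in> Orb x\<close> by (auto simp: Orb_def)
    thus ?thesis using that(1) xD act_mult[of g k x] by (auto simp: Orb_def)
  qed
  define d where "d i z = coord l i z - coord l i x" for i z
  \<comment> \<open>Lagrange interpolation in the separating function \<open>a\<close>. The
    differences \<open>a x - a w\<close> are constants, so \<open>e\<close> is regular along the
    whole orbit.\<close>
  define e where "e z = (\<Prod>w\<in>Orb x - {x}. (a z - a w) * inverse (a x - a w))" for z
  have d_germ: "d i \<in> germs Y y" if "i < n" "y \<in> Orb x" for i y
    unfolding d_def[abs_def] using that l OrbD by (intro germs_diff germs_const coord_germ) auto
  have e_germ: "e \<in> germs Y y" if "y \<in> Orb x" for y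
    unfolding e_def[abs_def] using that a(1) OrbD by (intro germs_prod germs_mult germs_diff germs_const) auto
  have ex: "e x = 1" unfolding e_def
  proof (intro prod.neutral ballI)
    fix w assume "w \<in> Orb x - {x}"
    hence "a x \<noteq> a w" using inj_onD[OF a(2) _ self, of w] by auto
    thus "(a x - a w) * inverse (a x - a w) = 1" by simp
  qed
  have e0: "e w = 0" if "w \<in> Orb x - {x}" for w
    unfolding e_def using that finite_Orb by (intro prod_zero) auto
  \<comment> \<open>The square matters for \<open>w \<noteq> x\<close>: of the two factors
    \<open>e (act (t w) z)\<close>, one is expanded in the generators \<open>d j\<close>, and the
    other still vanishes at \<open>x\<close>.\<close>
  define F where "F i z = d i z * e z ^ 2" for i z
  \<comment> \<open>The sum runs over the orbit. A sum over the group would carry the additional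
    factor \<open>h\<close>, the order of \<open>Ker\<close>, which may be 0 in
    \<open>k\<close>.\<close>
  define T where "T i z = (\<Sum>w\<in>Orb x. F i (act (t w) z))" for i z
  have F_germ: "F i \<in> germs Y y" if "i < n" "y \<in> Orb x" for i y
    unfolding F_def[abs_def] using that by (intro germs_mult germs_power d_germ e_germ)
  have T_germ: "T i \<in> germs Y y" if "i < n" "y \<in> Orb x" for i y
    unfolding T_def[abs_def] using that OrbD t(1) moves F_germ
    by (intro germs_sum act_germ) auto
  have T_inv: "\<forall>\<^sub>F z in gen Y. T i (act g z) = T i z" if g: "g \<in> carrier G" for i g
  proof -
    \<comment> \<open>At free points the sum no longer refers to the representatives and is visibly
      constant on orbits.\<close>
    have T_eq: "T i z = (\<Sum>y\<in>Orb z. F i y)" if "z \<in> Free" for z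
      unfolding T_def using sum.reindex_bij_betw[OF representatives_bij[OF x that t]] .
    from generic_Free Free_act[OF g] show ?thesis
    proof eventually_elim
      case (elim z)
      hence "Orb (act g z) = Orb z" using Orb_act[OF g] by (simp add: Free_def)
      thus ?case using elim by (simp add: T_eq)
    qed
  qed
  have Tx: "T i x = 0" for i
    unfolding T_def using t(2) e0 by (intro sum.neutral) (auto simp: F_def d_def)
  have T_ideal: "cls Y (T i) \<in> local_ideal x" if i: "i < n" for i
  proof -
    obtain \<phi> where \<phi>: "\<phi> \<in> rationals C" "\<forall>\<^sub>F z in gen Y. T i z = \<phi> (q z)"
      using invariant_is_pullback[OF germs_rationals[OF T_germ[OF i self]] T_inv] by blast
    have "cls C \<phi> \<in> normalized_local_ring C (q x)"
    proof (rule integral_of_regular_on_fibre[OF projective_subspace_axioms C(3) dominant_map_axioms C(1,2) \<phi>(1) xD])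
      fix z assume "z \<in> D" "q z = q x"
      hence "z \<in> Orb x" using Orb_eq_fibre[OF xD] by simp
      thus "\<exists>f\<in>germs Y z. \<forall>\<^sub>F w in gen Y. f w = \<phi> (q w)" using T_germ[OF i] \<phi>(2) by blast
    qed
    moreover have "pullback Y q (cls C \<phi>) = cls Y (T i)"
      using pullback_cls[OF \<phi>(1)] cls_eq_iff[OF germs_rationals[OF T_germ[OF i self]] rationals_pullback[OF \<phi>(1)]] \<phi>(2)
      by simp
    moreover have "cls Y (T i) \<in> max_ideal Y x" unfolding max_ideal_eq using T_germ[OF i self] Tx by blast
    ultimately have "cls Y (T i) \<in> pullback Y q ` normalized_local_ring C (q x) \<inter> max_ideal Y x"
      by (intro IntI image_eqI[of _ _ "cls C \<phi>"]) simp_all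
    thus ?thesis by (rule subsetD[OF local_ideal_generators(2)[OF xD]])
  qed
  interpret I: ideal "local_ideal x" "(function_field Y)\<lparr>carrier := local_ring Y x\<rparr>"
    by (rule local_ideal_generators(1)[OF xD])
  \<comment> \<open>Germs whose class lies in the ideal. Nakayama's lemma is applied modulo
    \<open>J\<close>, with the traces as inhomogeneous terms.\<close>
  define J where "J = {f \<in> germs Y x. cls Y f \<in> local_ideal x}"
  have J_add: "(\<lambda>z. f z + g z) \<in> J" if "f \<in> J" "g \<in> J" for f g
    using that additive_subgroup.a_closed[OF I.additive_subgroup_axioms, of "cls Y f" "cls Y g"]
      germs_rationals[of f Y x] germs_rationals[of g Y x]
    by (auto simp: J_def cls_add intro: germs_add)
  have J_mult: "(\<lambda>z. f z * g z) \<in> J" if f: "f \<in> germs Y x" and g: "g \<in> J" for f g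
  proof -
    have "cls Y f \<in> carrier ((function_field Y)\<lparr>carrier := local_ring Y x\<rparr>)" using f by (simp add: local_ring_eq)
    from I.I_l_closed[OF _ this, of "cls Y g"] show ?thesis
      using f g germs_rationals[OF f] germs_rationals[of g] by (auto simp: J_def cls_mult intro: germs_mult)
  qed
  have J_cong: "f \<in> J" if "f \<in> germs Y x" "g \<in> J" "\<forall>\<^sub>F z in gen Y. f z = g z" for f g
    using that cls_eq_iff[of f g] germs_rationals[of f Y x] germs_rationals[of g Y x] by (simp add: J_def)
  have expand: "\<exists>b. (\<forall>j<n. b j \<in> germs Y x) \<and> (\<forall>\<^sub>F z in gen Y. f z = (\<Sum>j<n. b j z * d j z))"
    if f: "f \<in> germs Y x" "f x = 0" for f
  proof -
    obtain c where c: "\<And>j. j < n \<Longrightarrow> c j \<in> germs Y x"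
      "\<forall>\<^sub>F z in gen Y. f x - f z = (\<Sum>j<n. c j z * (coord l j x - coord l j z))"
    proof (rule germ_difference[OF l(1) l(2)[OF self] f(1), of "\<lambda>_. x"])
      show "openin (fs_top Y) {z \<in> D. x \<in> U}" for U
        using openin_topspace[of "fs_top Y"] pts_Y by (cases "x \<in> U") auto
    qed (use xD germs_const[OF xp] in auto)
    have "\<forall>\<^sub>F z in gen Y. f z = (\<Sum>j<n. c j z * d j z)"
      using c(2)
    proof eventually_elim
      case (elim z)
      have "(\<Sum>j<n. c j z * (coord l j x - coord l j z)) = - (\<Sum>j<n. c j z * d j z)"
        unfolding sum_negf[symmetric] by (intro sum.cong) (auto simp: d_def algebra_simps)
      thus ?case using elim f(2) by simp
    qed
    thus ?thesis using c(1) by blast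
  qed
  let ?e = "\<lambda>w z. e (act (t w) z)" and ?R = "Orb x - {x}"
  have te: "?e w \<in> germs Y x" "?e w x = 0" if "w \<in> ?R" for w
    using that t e0 e_germ[of w] xD by (auto intro!: act_germ)
  have "\<forall>w. \<exists>b. w \<in> ?R \<longrightarrow> (\<forall>j<n. b j \<in> germs Y x) \<and> (\<forall>\<^sub>F z in gen Y. ?e w z = (\<Sum>j<n. b j z * d j z))"
  proof
    fix w
    show "\<exists>b. w \<in> ?R \<longrightarrow> (\<forall>j<n. b j \<in> germs Y x) \<and> (\<forall>\<^sub>F z in gen Y. ?e w z = (\<Sum>j<n. b j z * d j z))"
    proof (cases "w \<in> ?R")
      case True
      show ?thesis using expand[OF te[OF True]] by simp
    next
      case False
      thus ?thesis by (intro exI impI) (rule notE)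
    qed
  qed
  from choice[OF this] obtain b where b': "\<forall>w. w \<in> ?R \<longrightarrow> (\<forall>j<n. b w j \<in> germs Y x) \<and>
      (\<forall>\<^sub>F z in gen Y. ?e w z = (\<Sum>j<n. b w j z * d j z))" by (elim exE)
  have b: "b w j \<in> germs Y x" if "w \<in> ?R" "j < n" for w j using b' that by simp
  have b2: "\<forall>\<^sub>F z in gen Y. ?e w z = (\<Sum>j<n. b w j z * d j z)" if "w \<in> ?R" for w
    using b' that by simp
  have b_gen: "\<forall>\<^sub>F z in gen Y. \<forall>w\<in>?R. ?e w z = (\<Sum>j<n. b w j z * d j z)"
    using finite_Orb b2 by (intro eventually_ball_finite) auto
  \<comment> \<open>Obtained by solving the trace \<open>T i\<close> for \<open>d i\<close>. The
    representative \<open>t x\<close> acts trivially and contributes \<open>d i * e^2\<close>,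
    whence \<open>1 - e^2\<close> on the diagonal; the other orbit points contribute through the
    expansion \<open>b\<close> of one factor \<open>e\<close>. All entries vanish at
    \<open>x\<close>.\<close>
  define k where "k i j z = (if i = j then 1 - e z ^ 2 else 0) - (\<Sum>w\<in>?R. d i (act (t w) z) * ?e w z * b w j z)" for i j z
  have tx: "act (t x) z = z" if "z \<in> D" for z
  proof -
    have "t x \<in> Stab x" using t self by (simp add: Stab_def)
    hence "t x \<in> Ker" using x by (simp add: Free_def)
    thus ?thesis using that by (simp add: Ker_def)
  qed
  have dJ: "d i \<in> J" if "i < n" for i
  proof (rule nakayama[where J = J and x = x and n = n and e = T and m = k, OF J_add J_mult J_cong _ _ _ _ that])
    fix i assume i: "i < n"
    show "d i \<in> germs Y x" by (rule d_germ[OF i self])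
    show "T i \<in> J" unfolding J_def using T_germ[OF i self] T_ideal[OF i] by blast
    show "k i j \<in> germs Y x \<and> k i j x = 0" if j: "j < n" for j
    proof
      have "(\<lambda>z. d i (act (t w) z)) \<in> germs Y x" if "w \<in> ?R" for w
        using that t xD d_germ[OF i, of w] by (intro act_germ) auto
      moreover have "(\<lambda>z. if i = j then 1 - e z ^ 2 else 0) \<in> germs Y x"
        using e_germ[OF self] germs_const[OF xp] by (cases "i = j") (auto intro: germs_diff germs_power)
      ultimately show "k i j \<in> germs Y x"
        unfolding k_def[abs_def] using te b[OF _ j] xp
        by (intro germs_diff germs_sum germs_mult) auto
      show "k i j x = 0" unfolding k_def using te(2) ex by simp
    qed
    show "\<forall>\<^sub>F z in gen Y. d i z = T i z + (\<Sum>j<n. k i j z * d j z)"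
      using b_gen eventually_pts
    proof eventually_elim
      case (elim z)
      have z: "z \<in> D" using elim(2) unfolding pts_Y .
      have "(\<Sum>j<n. k i j z * d j z) = (\<Sum>j<n. (if i = j then 1 - e z ^ 2 else 0) * d j z) -
          (\<Sum>j<n. \<Sum>w\<in>?R. d i (act (t w) z) * ?e w z * (b w j z * d j z))"
        unfolding k_def by (simp add: left_diff_distrib sum_subtractf sum_distrib_right mult.assoc)
      also have "(\<Sum>j<n. (if i = j then 1 - e z ^ 2 else 0) * d j z) = (1 - e z ^ 2) * d i z"
        using i by (simp add: if_distrib[of "\<lambda>a. a * _"] cong: if_cong)
      also have "(\<Sum>j<n. \<Sum>w\<in>?R. d i (act (t w) z) * ?e w z * (b w j z * d j z)) =
          (\<Sum>w\<in>?R. d i (act (t w) z) * ?e w z * (\<Sum>j<n. b w j z * d j z))"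
        by (subst sum.swap) (simp add: sum_distrib_left)
      also have "\<dots> = (\<Sum>w\<in>?R. F i (act (t w) z))"
        using elim(1) by (intro sum.cong) (auto simp: F_def power2_eq_square)
      also have "T i z = F i (act (t x) z) + (\<Sum>w\<in>?R. F i (act (t w) z))"
        unfolding T_def using finite_Orb self by (rule sum.remove)
      hence "(\<Sum>w\<in>?R. F i (act (t w) z)) = T i z - d i z * e z ^ 2" using tx[OF z] by (simp add: F_def)
      finally show ?case by (simp add: algebra_simps)
    qed
  qed
  show ?thesis
  proof
    fix u assume "u \<in> max_ideal Y x"
    then obtain f where f: "f \<in> germs Y x" "f x = 0" "u = cls Y f" by (auto simp: max_ideal_eq)
    obtain c where c: "\<And>j. j < n \<Longrightarrow> c j \<in> germs Y x" "\<forall>\<^sub>F z in gen Y. f z = (\<Sum>j<n. c j z * d j z)"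
      using expand[OF f(1,2)] by blast
    have sumJ: "(\<lambda>z. \<Sum>j<i. c j z * d j z) \<in> J" if "i \<le> n" for i
      using that
    proof (induction i)
      case 0
      have "(\<lambda>_. 0) \<in> germs Y x" by (rule germs_const[OF xp])
      moreover have "cls Y (\<lambda>_. 0) \<in> local_ideal x" using additive_subgroup.zero_closed[OF I.additive_subgroup_axioms] by (simp add: cls_zero)
      ultimately show ?case by (simp add: J_def)
    next
      case (Suc i)
      thus ?case using J_add[OF Suc.IH J_mult[OF c(1) dJ]] by simp
    qed
    have "f \<in> J" by (rule J_cong[OF f(1) sumJ[OF order_refl] c(2)])
    thus "u \<in> local_ideal x" by (simp add: J_def f(3))
  qed
qed

text \<open>If \<open>g\<close> fixes \<open>x\<close> and the maximal ideal \<open>m\<close> at \<open>x\<close> is generated by invariants, then the ideal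
  generated by all \<open>f \<circ> g - f\<close> is contained in \<open>m\<close> times itself, so it vanishes by Nakayama.\<close>

lemma stabilizer_trivial:
  assumes x: "x \<in> D" and g: "g \<in> Stab x" and gen: "max_ideal Y x \<subseteq> local_ideal x"
  shows "g \<in> Ker"
proof -
  have xp: "x \<in> pts Y" unfolding pts_Y by (rule x)
  have gG: "g \<in> carrier G" and gx: "act g x = x" using g by (auto simp: Stab_def)
  interpret O: cring "(function_field Y)\<lparr>carrier := local_ring Y x\<rparr>" by (rule cring_local_ring[OF xp])
  obtain l a where l: "hom_poly n 1 l" "l (lift x) \<noteq> 0"
    by (rule separating_function[OF projective_subspace_axioms, of "{x}"]) (use x in auto)
  have g_germ: "(\<lambda>z. f (act g z)) \<in> germs Y x" if "f \<in> germs Y x" for f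
    using act_germ[OF gG x] that gx by simp
  define d where "d i z = coord l i (act g z) - coord l i z" for i z
  have c_germ: "coord l i \<in> germs Y x" if "i < n" for i using coord_germ[OF l(1) x l(2) that] .
  have d_germ: "d i \<in> germs Y x" if "i < n" for i
    unfolding d_def[abs_def] by (intro germs_diff g_germ c_germ that)
  \<comment> \<open>The product of the maximal ideal at \<open>x\<close> with the ideal generated by
    the \<open>d i\<close>.\<close>
  define A where "A = {f \<in> germs Y x. \<exists>k. (\<forall>i<n. k i \<in> germs Y x \<and> k i x = 0) \<and>
      (\<forall>\<^sub>F z in gen Y. f z = (\<Sum>i<n. k i z * d i z))}"
  have AI: "f \<in> A" if "f \<in> germs Y x" "\<And>i. i < n \<Longrightarrow> k i \<in> germs Y x" "\<And>i. i < n \<Longrightarrow> k i x = 0"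
    "\<forall>\<^sub>F z in gen Y. f z = (\<Sum>i<n. k i z * d i z)" for f k
    using that unfolding A_def by blast
  have A_add: "(\<lambda>z. f z + h z) \<in> A" if f: "f \<in> A" and h: "h \<in> A" for f h
  proof -
    obtain k where k: "\<And>i. i < n \<Longrightarrow> k i \<in> germs Y x \<and> k i x = 0" "\<forall>\<^sub>F z in gen Y. f z = (\<Sum>i<n. k i z * d i z)"
      using f unfolding A_def by blast
    obtain k' where k': "\<And>i. i < n \<Longrightarrow> k' i \<in> germs Y x \<and> k' i x = 0" "\<forall>\<^sub>F z in gen Y. h z = (\<Sum>i<n. k' i z * d i z)"
      using h unfolding A_def by blast
    show ?thesis
    proof (rule AI[of "\<lambda>z. f z + h z" "\<lambda>i z. k i z + k' i z"])
      show "(\<lambda>z. f z + h z) \<in> germs Y x" using f h by (auto simp: A_def intro: germs_add)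
      show "\<forall>\<^sub>F z in gen Y. f z + h z = (\<Sum>i<n. (k i z + k' i z) * d i z)"
        using k(2) k'(2) by eventually_elim (simp add: distrib_right sum.distrib)
    qed (use k(1) k'(1) in \<open>auto intro: germs_add\<close>)
  qed
  have A_mult: "(\<lambda>z. r z * f z) \<in> A" if r: "r \<in> germs Y x" and f: "f \<in> A" for f r
  proof -
    obtain k where k: "\<And>i. i < n \<Longrightarrow> k i \<in> germs Y x \<and> k i x = 0" "\<forall>\<^sub>F z in gen Y. f z = (\<Sum>i<n. k i z * d i z)"
      using f unfolding A_def by blast
    show ?thesis
    proof (rule AI[of "\<lambda>z. r z * f z" "\<lambda>i z. r z * k i z"])
      show "(\<lambda>z. r z * f z) \<in> germs Y x" using f r by (auto simp: A_def intro: germs_mult)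
      show "\<forall>\<^sub>F z in gen Y. r z * f z = (\<Sum>i<n. r z * k i z * d i z)"
        using k(2) by eventually_elim (simp add: sum_distrib_left mult.assoc)
    qed (use k(1) r in \<open>auto intro: germs_mult\<close>)
  qed
  have A_cong: "f \<in> A" if f: "f \<in> germs Y x" and h: "h \<in> A" and eq: "\<forall>\<^sub>F z in gen Y. f z = h z" for f h
  proof -
    obtain k where k: "\<And>i. i < n \<Longrightarrow> k i \<in> germs Y x \<and> k i x = 0" "\<forall>\<^sub>F z in gen Y. h z = (\<Sum>i<n. k i z * d i z)"
      using h unfolding A_def by blast
    have "\<forall>\<^sub>F z in gen Y. f z = (\<Sum>i<n. k i z * d i z)" using eq k(2) by eventually_elim simp
    thus ?thesis using AI[OF f] k(1) by blast
  qed
  have A_0: "(\<lambda>_. 0) \<in> A"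
    by (rule AI[of "\<lambda>_. 0" "\<lambda>_ _. 0"]) (auto intro: germs_const[OF xp])
  \<comment> \<open>The germs in the maximal ideal for which the desired containment holds. It
    suffices that they form an ideal containing the generators that come from
    \<open>C\<close>.\<close>
  define M where "M = {f \<in> germs Y x. f x = 0 \<and> (\<lambda>z. f (act g z) - f z) \<in> A}"
  have M_cong: "f \<in> M" if f: "f \<in> germs Y x" and h: "h \<in> M" and eq: "\<forall>\<^sub>F z in gen Y. f z = h z" for f h
  proof -
    have hg: "h \<in> germs Y x" "h x = 0" "(\<lambda>z. h (act g z) - h z) \<in> A" using h by (auto simp: M_def)
    have "f x = h x" using germs_identity[OF f hg(1) eq] by metis
    moreover have "(\<lambda>z. f (act g z) - f z) \<in> A"
    proof (rule A_cong[OF _ hg(3)])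
      show "(\<lambda>z. f (act g z) - f z) \<in> germs Y x" by (intro germs_diff g_germ f)
      show "\<forall>\<^sub>F z in gen Y. f (act g z) - f z = h (act g z) - h z"
        using eq gen_act[OF gG eq] by eventually_elim simp
    qed
    ultimately show ?thesis using f hg(2) by (simp add: M_def)
  qed
  have "ideal (cls Y ` M) ((function_field Y)\<lparr>carrier := local_ring Y x\<rparr>)"
  proof (rule ideal_local_ring[OF xp])
    show "M \<subseteq> germs Y x" by (auto simp: M_def)
    show "(\<lambda>_. 0) \<in> M" using A_0 germs_const[OF xp] by (simp add: M_def)
    show "(\<lambda>z. f z + h z) \<in> M" if "f \<in> M" "h \<in> M" for f h
    proof -
      have "(\<lambda>z. (f (act g z) - f z) + (h (act g z) - h z)) \<in> A" using that by (intro A_add) (auto simp: M_def)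
      moreover have "(\<lambda>z. (f (act g z) - f z) + (h (act g z) - h z)) =
          (\<lambda>z. f (act g z) + h (act g z) - (f z + h z))" by (simp add: algebra_simps)
      ultimately show ?thesis using that by (auto simp: M_def intro: germs_add)
    qed
    show "(\<lambda>z. r z * f z) \<in> M" if r: "r \<in> germs Y x" and f: "f \<in> M" for r f
    proof -
      have f': "f \<in> germs Y x" "f x = 0" "(\<lambda>z. f (act g z) - f z) \<in> A" using f by (auto simp: M_def)
      obtain c where c: "\<And>i. i < n \<Longrightarrow> c i \<in> germs Y x"
        "\<forall>\<^sub>F z in gen Y. r (act g z) - r z = (\<Sum>i<n. c i z * (coord l i (act g z) - coord l i z))"
        by (rule germ_difference[OF l r, of "act g"]) (use gx act_closed[OF gG] act_open[OF gG] g_germ in auto)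
      \<comment> \<open>Part of the twisted product rule \<open>(r f) \<circ> g - r f = (r \<circ>
        g) (f \<circ> g - f) + f (r \<circ> g - r)\<close>. The last term is in \<open>A\<close>
        because \<open>f\<close> vanishes at \<open>x\<close> and \<open>c\<close> expands
        \<open>r \<circ> g - r\<close> in the \<open>d i\<close>.\<close>
      have "(\<lambda>z. f z * (r (act g z) - r z)) \<in> A"
      proof (rule AI[of "\<lambda>z. f z * (r (act g z) - r z)" "\<lambda>i z. f z * c i z"])
        show "(\<lambda>z. f z * (r (act g z) - r z)) \<in> germs Y x" by (intro germs_mult germs_diff g_germ f'(1) r)
        show "\<forall>\<^sub>F z in gen Y. f z * (r (act g z) - r z) = (\<Sum>i<n. f z * c i z * d i z)"
          using c(2) by eventually_elim (simp add: sum_distrib_left mult.assoc d_def)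
      qed (use c(1) f' in \<open>auto intro: germs_mult\<close>)
      from A_add[OF A_mult[OF g_germ[OF r] f'(3)] this]
      have "(\<lambda>z. r (act g z) * (f (act g z) - f z) + f z * (r (act g z) - r z)) \<in> A" .
      moreover have "(\<lambda>z. r (act g z) * (f (act g z) - f z) + f z * (r (act g z) - r z)) =
          (\<lambda>z. r (act g z) * f (act g z) - r z * f z)" by (simp add: algebra_simps)
      ultimately show ?thesis using f' r by (auto simp: M_def intro: germs_mult)
    qed
  qed
  moreover have "pullback Y q ` normalized_local_ring C (q x) \<inter> max_ideal Y x \<subseteq> cls Y ` M"
  proof
    fix u assume u: "u \<in> pullback Y q ` normalized_local_ring C (q x) \<inter> max_ideal Y x"
    then obtain \<zeta> where \<zeta>: "\<zeta> \<in> rationals C" "u = cls Y (\<lambda>z. \<zeta> (q z))"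
      unfolding normalized_local_ring_def C.carrier_function_field by (auto simp: pullback_cls)
    obtain f where f: "f \<in> germs Y x" "f x = 0" "u = cls Y f" using u by (auto simp: max_ideal_eq)
    have eq: "\<forall>\<^sub>F z in gen Y. f z = \<zeta> (q z)"
      using cls_eq_iff[OF germs_rationals[OF f(1)] rationals_pullback[OF \<zeta>(1)]] f(3) \<zeta>(2) by simp
    \<comment> \<open>A pullback from \<open>C\<close> is constant on orbits, so this difference
      vanishes generically.\<close>
    have "(\<lambda>z. f (act g z) - f z) \<in> A"
    proof (rule A_cong[OF _ A_0])
      show "(\<lambda>z. f (act g z) - f z) \<in> germs Y x" by (intro germs_diff g_germ f(1))
      show "\<forall>\<^sub>F z in gen Y. f (act g z) - f z = 0"
        using eq gen_act[OF gG eq] eventually_pts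
      proof eventually_elim
        case (elim z)
        have "z \<in> D" using elim(3) unfolding pts_Y .
        thus ?case using elim(1,2) q_act[OF gG] by simp
      qed
    qed
    thus "u \<in> cls Y ` M" using f by (auto simp: M_def)
  qed
  ultimately have "local_ideal x \<subseteq> cls Y ` M" by (rule O.genideal_minimal)
  hence max_M: "max_ideal Y x \<subseteq> cls Y ` M" using gen by blast
  \<comment> \<open>Applied to the coordinates centred at \<open>x\<close>, the inclusion puts every
    \<open>d i\<close> into the maximal ideal times the ideal of all \<open>d j\<close>.\<close>
  have "d i \<in> A" if i: "i < n" for i
  proof -
    let ?y = "\<lambda>z. coord l i z - coord l i x"
    have y: "?y \<in> germs Y x" by (intro germs_diff c_germ germs_const xp i)
    hence "cls Y ?y \<in> cls Y ` M" using max_M unfolding max_ideal_eq by auto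
    then obtain f where f: "f \<in> M" "cls Y ?y = cls Y f" by blast
    have fx: "f \<in> germs Y x" using f(1) by (simp add: M_def)
    have "\<forall>\<^sub>F z in gen Y. ?y z = f z"
      using cls_eq_iff[OF germs_rationals[OF y] germs_rationals[OF fx]] f(2) by simp
    from M_cong[OF y f(1) this] show ?thesis by (simp add: M_def d_def[abs_def])
  qed
  hence "\<forall>i. \<exists>k. i < n \<longrightarrow> (\<forall>j<n. k j \<in> germs Y x \<and> k j x = 0) \<and> (\<forall>\<^sub>F z in gen Y. d i z = (\<Sum>j<n. k j z * d j z))"
    unfolding A_def by blast
  from choice[OF this] obtain k where k': "\<forall>i. i < n \<longrightarrow> (\<forall>j<n. k i j \<in> germs Y x \<and> k i j x = 0) \<and>
      (\<forall>\<^sub>F z in gen Y. d i z = (\<Sum>j<n. k i j z * d j z))" by (elim exE)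
  have k: "k i j \<in> germs Y x \<and> k i j x = 0" if "i < n" "j < n" for i j using k' that by simp
  have k2: "\<forall>\<^sub>F z in gen Y. d i z = (\<Sum>j<n. k i j z * d j z)" if "i < n" for i using k' that by simp
  \<comment> \<open>The zero ideal up to generic equality; Nakayama's lemma is applied with
    inhomogeneous terms 0.\<close>
  define J where "J = {f \<in> germs Y x. \<forall>\<^sub>F z in gen Y. f z = 0}"
  have "d i \<in> J" if "i < n" for i
  proof (rule nakayama[where J = J and x = x and n = n and e = "\<lambda>_ _. 0" and m = k, OF _ _ _ _ _ _ _ that])
    show "(\<lambda>z. f z + h z) \<in> J" if "f \<in> J" "h \<in> J" for f h
    proof -
      have "\<forall>\<^sub>F z in gen Y. f z = 0" "\<forall>\<^sub>F z in gen Y. h z = 0" using that by (auto simp: J_def)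
      hence "\<forall>\<^sub>F z in gen Y. f z + h z = 0" by eventually_elim simp
      thus ?thesis using that germs_add by (auto simp: J_def)
    qed
    show "(\<lambda>z. f z * h z) \<in> J" if "f \<in> germs Y x" "h \<in> J" for f h
    proof -
      have "\<forall>\<^sub>F z in gen Y. h z = 0" using that by (auto simp: J_def)
      hence "\<forall>\<^sub>F z in gen Y. f z * h z = 0" by eventually_elim simp
      thus ?thesis using that germs_mult by (auto simp: J_def)
    qed
    show "f \<in> J" if "f \<in> germs Y x" "h \<in> J" "\<forall>\<^sub>F z in gen Y. f z = h z" for f h
    proof -
      have "\<forall>\<^sub>F z in gen Y. h z = 0" using that by (auto simp: J_def)
      with that(3) have "\<forall>\<^sub>F z in gen Y. f z = 0" by eventually_elim simp
      thus ?thesis using that(1) by (simp add: J_def)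
    qed
    show "d i \<in> germs Y x" if "i < n" for i by (rule d_germ[OF that])
    show "(\<lambda>_. 0) \<in> J" by (simp add: J_def germs_const[OF xp])
    show "k i j \<in> germs Y x \<and> k i j x = 0" if "i < n" "j < n" for i j by (rule k[OF that])
    show "\<forall>\<^sub>F z in gen Y. d i z = 0 + (\<Sum>j<n. k i j z * d j z)" if "i < n" for i
      using k2[OF that] by simp
  qed
  hence "\<forall>\<^sub>F z in gen Y. \<forall>i\<in>{..<n}. d i z = 0"
    by (intro eventually_ball_finite) (auto simp: J_def)
  moreover have nz: "\<forall>\<^sub>F z in gen Y. l (lift z) \<noteq> 0"
    using openin_form_nonzero[OF l(1)] x l(2) by (intro eventually_genI[of "{z \<in> D. l (lift z) \<noteq> 0}"]) auto
  \<comment> \<open>Equal coordinates mean equal points wherever \<open>l\<close> is nonzero at both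
    \<open>z\<close> and its image.\<close>
  ultimately have fixed: "\<forall>\<^sub>F z in gen Y. act g z = z"
    using gen_act[OF gG nz] eventually_pts
  proof eventually_elim
    case (elim z)
    have z: "z \<in> D" using elim(4) unfolding pts_Y .
    show ?case
    proof (rule coord_inject[where l = l and n = n])
      show "act g z \<in> proj_points n" "z \<in> proj_points n" using z act_closed[OF gG] subset by auto
      show "coord l i (act g z) = coord l i z" if "i < n" for i using elim(1) that by (auto simp: d_def)
    qed (use elim in auto)
  qed
  \<comment> \<open>Triviality passes from generic points to all of \<open>D\<close>, because the
    moved points form an open set.\<close>
  have "{z \<in> D. act g z \<noteq> z} = {}"
  proof (rule ccontr)
    assume "\<not> ?thesis"
    hence "\<forall>\<^sub>F z in gen Y. act g z \<noteq> z" using moved_open[OF gG] by (intro eventually_genI[of "{z \<in> D. act g z \<noteq> z}"]) auto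
    with fixed have "\<forall>\<^sub>F z in gen Y. False" by eventually_elim simp
    thus False by simp
  qed
  thus ?thesis using gG by (auto simp: Ker_def)
qed

text \<open>\<open>Ker\<close> has order \<open>h\<close> and lies in every stabilizer, so a larger
  order means exactly that \<open>Stab x\<close> differs from \<open>Ker\<close>.\<close>

theorem ramified_iff:
  assumes "prevariety C" "separated C" "complete_space Y" and x: "x \<in> D"
  shows "ramified_at Y C q x \<longleftrightarrow> h < card (Stab x)"
proof -
  have fin: "finite (Stab x)" using finite_G by (simp add: Stab_def)
  note sub = Ker_subset_Stab[OF x]
  have "h < card (Stab x) \<longleftrightarrow> Stab x \<noteq> Ker"
    using psubset_card_mono[OF fin, of Ker] sub card_Ker by auto
  moreover have "local_ideal x = max_ideal Y x \<longleftrightarrow> Stab x = Ker"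
  proof
    assume "local_ideal x = max_ideal Y x"
    thus "Stab x = Ker" using stabilizer_trivial[OF x] sub by blast
  next
    assume "Stab x = Ker"
    hence "x \<in> Free" using x by (simp add: Free_def)
    thus "local_ideal x = max_ideal Y x"
      using max_ideal_generated assms(1-3) local_ideal_generators(3)[OF x] by blast
  qed
  ultimately show ?thesis by (simp add: ramified_at_def)
qed

end

section \<open>Linear actions on projective space\<close>

lemma group_GL: "group (GL r :: 'k::field mat monoid)"
proof (rule groupI)
  fix x y z :: "'k mat" assume x: "x \<in> carrier (GL r)"
  show "\<one>\<^bsub>GL r\<^esub> \<otimes>\<^bsub>GL r\<^esub> x = x" using x by (auto simp: GL_def)
  show "\<exists>y\<in>carrier (GL r). y \<otimes>\<^bsub>GL r\<^esub> x = \<one>\<^bsub>GL r\<^esub>"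
  proof -
    have "x \<in> carrier_mat r r" "det x \<noteq> 0" using x by (auto simp: GL_def)
    from det_non_zero_imp_unit[OF this]
    obtain y where y: "y \<in> carrier_mat r r" "y * x = 1\<^sub>m r" by (auto simp: Units_def ring_mat_def)
    have "det y * det x = 1" using y x det_mult[of y r x] by (auto simp: GL_def)
    hence "det y \<noteq> 0" by auto
    thus ?thesis using y by (intro bexI[of _ y]) (auto simp: GL_def)
  qed
  assume y: "y \<in> carrier (GL r)"
  show "x \<otimes>\<^bsub>GL r\<^esub> y \<in> carrier (GL r)" using x y by (auto simp: GL_def det_mult)
  assume "z \<in> carrier (GL r)"
  thus "x \<otimes>\<^bsub>GL r\<^esub> y \<otimes>\<^bsub>GL r\<^esub> z = x \<otimes>\<^bsub>GL r\<^esub> (y \<otimes>\<^bsub>GL r\<^esub> z)" using x y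
    by (auto simp: GL_def intro: assoc_mult_mat)
qed (simp add: GL_def)

lemma mult_mat_vec_index:
  assumes "A \<in> carrier_mat n n" "v \<in> carrier_vec n" "i < n"
  shows "(A *\<^sub>v v) $ i = (\<Sum>j<n. A $$ (i, j) * v $ j)"
  using assms by (auto simp: scalar_prod_def atLeast0LessThan intro!: sum.cong)

text \<open>Inserting linear forms keeps the degree. Agreement is claimed only on
  \<open>carrier_vec n\<close>, where the entries of \<open>A *\<^sub>v v\<close> are given by
  linear forms.\<close>

lemma hom_poly_substitution:
  assumes A: "A \<in> carrier_mat n n"
  shows "hom_poly n d f \<Longrightarrow> \<exists>f'. hom_poly n d f' \<and> (\<forall>v\<in>carrier_vec n. f' v = f (A *\<^sub>v v))"
proof (induction rule: hom_poly.induct)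
  case (const c)
  show ?case by (intro exI[of _ "\<lambda>_. c"]) (auto intro: hom_poly.const)
next
  case (zero d)
  show ?case by (intro exI[of _ "\<lambda>_. 0"]) (auto intro: hom_poly.zero)
next
  case (coord_mult i d f)
  then obtain f' where f': "hom_poly n d f'" "\<And>v. v \<in> carrier_vec n \<Longrightarrow> f' v = f (A *\<^sub>v v)" by blast
  have "hom_poly n (Suc d) (\<lambda>v. (\<Sum>j<n. A $$ (i, j) * v $ j) * f' v)"
    using hom_poly_mult[OF hom_poly_linear f'(1)] by simp
  thus ?case using f'(2) mult_mat_vec_index[OF A _ coord_mult.hyps(1)]
    by (intro exI[of _ "\<lambda>v. (\<Sum>j<n. A $$ (i, j) * v $ j) * f' v"]) simp
next
  case (add d f g)
  then obtain f' g' where f': "hom_poly n d f'" "\<And>v. v \<in> carrier_vec n \<Longrightarrow> f' v = f (A *\<^sub>v v)"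
    and g': "hom_poly n d g'" "\<And>v. v \<in> carrier_vec n \<Longrightarrow> g' v = g (A *\<^sub>v v)" by blast
  thus ?case by (intro exI[of _ "\<lambda>v. f' v + g' v"]) (auto intro: hom_poly.add)
qed

locale linear_automorphism =
  fixes n :: nat and A :: "'k::field mat"
  assumes A: "A \<in> carrier_mat n n" and det: "det A \<noteq> 0"
begin

definition move :: "'k vec set \<Rightarrow> 'k vec set" where "move p = (\<lambda>v. A *\<^sub>v v) ` p"

lemma move_proj_points: "p \<in> proj_points n \<Longrightarrow> move p \<in> proj_points n"
proof -
  assume p: "p \<in> proj_points n"
  then obtain v where vp: "v \<in> p" using proj_point_nonempty by blast
  note v = proj_pointE[OF p vp]
  have Av: "A *\<^sub>v v \<in> carrier_vec n" using A v(1) by simp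
  have "A *\<^sub>v v \<noteq> 0\<^sub>v n" using det_0_iff_vec_prod_zero[OF A] det v(1,2) by blast
  moreover have "move p = {c \<cdot>\<^sub>v (A *\<^sub>v v) | c. c \<noteq> 0}"
  proof -
    have "move p = {A *\<^sub>v (c \<cdot>\<^sub>v v) | c. c \<noteq> 0}" unfolding move_def by (subst v(3)) blast
    thus ?thesis using mult_mat_vec[OF A v(1)] by simp
  qed
  ultimately show ?thesis using Av unfolding proj_points_def by blast
qed

lemma move_nonzero:
  assumes "hom_poly n d f" "\<And>v. v \<in> carrier_vec n \<Longrightarrow> f' v = f (A *\<^sub>v v)" "p \<in> proj_points n"
  shows "(\<forall>v\<in>move p. f v \<noteq> 0) \<longleftrightarrow> (\<forall>v\<in>p. f' v \<noteq> 0)"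
  using assms(2) proj_pointE(1)[OF assms(3)] by (auto simp: move_def)

lemma move_morphism: "fs_morphism (proj_space n) (proj_space n) move"
proof -
  let ?T = "fs_top (proj_space n) :: 'k vec set topology"
  let ?S = "{{p \<in> proj_points n. \<forall>v\<in>p. f v \<noteq> (0::'k)} | d f. hom_poly n d f}"
  have T: "?T = topology_generated_by ?S" by (simp add: proj_space_def Let_def)
  have union: "\<Union>?S = proj_points n"
  proof -
    have "topspace ?T = proj_points n" by (rule pts_proj_space)
    thus ?thesis unfolding T topology_generated_by_topspace .
  qed
  have "continuous_map ?T (topology_generated_by ?S) move"
    unfolding continuous_on_generated_topo_iff
  proof (intro conjI allI impI)
    fix U assume "U \<in> ?S"
    then obtain d f where f: "hom_poly n d f" "U = {p \<in> proj_points n. \<forall>v\<in>p. f v \<noteq> 0}" by blast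
    obtain f' where f': "hom_poly n d f'" "\<And>v. v \<in> carrier_vec n \<Longrightarrow> f' v = f (A *\<^sub>v v)"
      using hom_poly_substitution[OF A f(1)] by blast
    have "move -` U \<inter> topspace ?T = {p \<in> proj_points n. \<forall>v\<in>p. f' v \<noteq> 0}"
      unfolding pts_proj_space f(2) using move_nonzero[OF f(1) f'(2)] move_proj_points by auto
    thus "openin ?T (move -` U \<inter> topspace ?T)" using openin_proj_nonzero[OF f'(1)] by simp
  next
    show "move ` topspace ?T \<subseteq> \<Union>?S" unfolding pts_proj_space union using move_proj_points by auto
  qed
  hence cont: "continuous_map ?T ?T move" unfolding T[symmetric] .
  show ?thesis
    unfolding fs_morphism_def
  proof (intro conjI allI impI ballI cont)
    fix V and \<phi> :: "'k vec set \<Rightarrow> 'k" assume V: "openin ?T V" and \<phi>: "\<phi> \<in> fs_reg (proj_space n) V"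
    show "\<phi> \<circ> move \<in> fs_reg (proj_space n) {x \<in> pts (proj_space n). move x \<in> V}"
      unfolding reg_proj_space
    proof
      fix p assume p: "p \<in> {x \<in> pts (proj_space n). move x \<in> V}"
      obtain W d f g where W: "openin ?T W" "move p \<in> W" "W \<subseteq> V" "hom_poly n d f" "hom_poly n d g"
        "\<And>q v. q \<in> W \<Longrightarrow> v \<in> q \<Longrightarrow> g v \<noteq> 0 \<and> \<phi> q = f v / g v"
        by (rule reg_proj_spaceE[OF \<phi>, of "move p"], use p in blast, rule that)
      obtain f' where f': "hom_poly n d f'" "\<And>v. v \<in> carrier_vec n \<Longrightarrow> f' v = f (A *\<^sub>v v)"
        using hom_poly_substitution[OF A W(4)] by blast
      obtain g' where g': "hom_poly n d g'" "\<And>v. v \<in> carrier_vec n \<Longrightarrow> g' v = g (A *\<^sub>v v)"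
        using hom_poly_substitution[OF A W(5)] by blast
      let ?W = "{x \<in> pts (proj_space n). move x \<in> W}"
      have "openin ?T ?W" using cont W(1) by (auto simp: continuous_map_def)
      moreover have "g' v \<noteq> 0 \<and> (\<phi> \<circ> move) q = f' v / g' v" if q: "q \<in> ?W" and v: "v \<in> q" for q v
      proof -
        have "v \<in> carrier_vec n" using q v proj_pointE(1) by (auto simp: pts_proj_space)
        moreover have "A *\<^sub>v v \<in> move q" using v by (auto simp: move_def)
        ultimately show ?thesis using W(6)[of "move q" "A *\<^sub>v v"] q f'(2) g'(2) by simp
      qed
      moreover have "p \<in> ?W" "?W \<subseteq> {x \<in> pts (proj_space n). move x \<in> V}" using p W(2,3) by auto
      ultimately show "\<exists>W. openin ?T W \<and> p \<in> W \<and> W \<subseteq> {x \<in> pts (proj_space n). move x \<in> V} \<and>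
          (\<exists>d f g. hom_poly n d f \<and> hom_poly n d g \<and> (\<forall>q\<in>W. \<forall>v\<in>q. g v \<noteq> 0 \<and> (\<phi> \<circ> move) q = f v / g v))"
        using f'(1) g'(1) by (intro exI[of _ ?W] conjI exI[of _ d] exI[of _ f'] exI[of _ g']) auto
    qed
  qed
qed

end

text \<open>A point with lift \<open>v\<close> is fixed iff \<open>A v\<close> is proportional to
  \<open>v\<close>, that is, iff all minors of the pair \<open>A v\<close>, \<open>v\<close> vanish.
  These are the quadratic forms \<open>F i j\<close>.\<close>

lemma moved_points_open:
  fixes A :: "'k::field mat"
  assumes "projective_subspace n D" "linear_automorphism n A"
  shows "openin (fs_top (induced (proj_space n) D)) {z \<in> D. linear_automorphism.move A z \<noteq> z}"
proof -
  interpret projective_subspace n D by fact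
  interpret linear_automorphism n A by fact
  define F where "F i j v = (\<Sum>k<n. A $$ (i, k) * v $ k) * v $ j + (-1) * ((\<Sum>k<n. A $$ (j, k) * v $ k) * v $ i)"
    for i j and v :: "'k vec"
  have F: "hom_poly n (1 + 1) (F i j)" if "i < n" "j < n" for i j
    unfolding F_def[abs_def] using that
    by (intro hom_poly.add hom_poly_cmult hom_poly_mult hom_poly_linear hom_poly_coord)
  have "move z \<noteq> z \<longleftrightarrow> (\<exists>i<n. \<exists>j<n. F i j (lift z) \<noteq> 0)" if z: "z \<in> D" for z
  proof -
    have zp: "z \<in> proj_points n" using z subset by blast
    let ?v = "lift z" and ?u = "A *\<^sub>v lift z"
    have v: "?v \<in> z" "?v \<in> carrier_vec n" using lift_in[OF zp] lift_carrier[OF zp] .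
    have u: "?u \<in> move z" "?u \<in> carrier_vec n" using v A by (auto simp: move_def)
    have Fv: "F i j ?v = ?u $ i * ?v $ j - ?u $ j * ?v $ i" if "i < n" "j < n" for i j
      using mult_mat_vec_index[OF A v(2)] that by (simp add: F_def)
    show ?thesis
    proof
      assume "\<exists>i<n. \<exists>j<n. F i j ?v \<noteq> 0"
      then obtain i j where ij: "i < n" "j < n" "F i j ?v \<noteq> 0" by blast
      show "move z \<noteq> z"
      proof
        assume "move z = z"
        hence "?u \<in> {c \<cdot>\<^sub>v ?v | c. c \<noteq> 0}" using u(1) proj_pointE(3)[OF zp v(1)] by simp
        then obtain c where "?u = c \<cdot>\<^sub>v ?v" by blast
        thus False using ij v(2) by (simp add: Fv)
      qed
    next
      assume neq: "move z \<noteq> z"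
      show "\<exists>i<n. \<exists>j<n. F i j ?v \<noteq> 0"
      proof (rule ccontr)
        assume "\<not> ?thesis"
        hence eq: "?u $ i * ?v $ j = ?u $ j * ?v $ i" if "i < n" "j < n" for i j using Fv that by auto
        obtain j where j: "j < n" "?v $ j \<noteq> 0" using lift_nonzero[OF zp] by blast
        have uv: "?u = (?u $ j / ?v $ j) \<cdot>\<^sub>v ?v"
        proof (rule eq_vecI)
          fix i assume "i < dim_vec ((?u $ j / ?v $ j) \<cdot>\<^sub>v ?v)"
          hence "i < n" using v(2) by simp
          thus "?u $ i = ((?u $ j / ?v $ j) \<cdot>\<^sub>v ?v) $ i" using eq[OF _ j(1), of i] j(2) v(2) by (simp add: field_simps)
        qed (use A v in auto)
        have "?u $ j / ?v $ j \<noteq> 0"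
        proof
          assume "?u $ j / ?v $ j = 0"
          hence "?u = 0 \<cdot>\<^sub>v ?v" using uv by metis
          hence "?u = 0\<^sub>v n" using v(2) by (intro eq_vecI) auto
          thus False using proj_pointE(2)[OF move_proj_points[OF zp] u(1)] by simp
        qed
        hence "?u \<in> {c \<cdot>\<^sub>v ?v | c. c \<noteq> 0}" using uv by blast
        hence "?u \<in> z" using proj_pointE(3)[OF zp v(1)] by simp
        thus False using proj_point_eqI[OF move_proj_points[OF zp] zp u(1)] neq by blast
      qed
    qed
  qed
  hence "{z \<in> D. move z \<noteq> z} = (\<Union>(i, j)\<in>{..<n} \<times> {..<n}. {z \<in> D. F i j (lift z) \<noteq> 0})" by auto
  moreover have "openin (fs_top Y) (\<Union>(i, j)\<in>{..<n} \<times> {..<n}. {z \<in> D. F i j (lift z) \<noteq> 0})"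
    by (rule openin_Union) (auto intro: openin_form_nonzero[OF F] simp del: fs_top_induced)
  ultimately show ?thesis by simp
qed

text \<open>Functions on a subspace extend to \<open>Y\<close> only locally, so the sheaf property
  of \<open>X\<close> is what glues their pullbacks.\<close>

lemma (in function_sheaf) fs_morphism_into_induced:
  assumes f: "fs_morphism X Y f" and fZ: "\<And>x. x \<in> pts X \<Longrightarrow> f x \<in> Z"
  shows "fs_morphism X (induced Y Z) f"
proof -
  have cont: "continuous_map (fs_top X) (fs_top Y) f" using f by (simp add: fs_morphism_def)
  have cont': "continuous_map (fs_top X) (fs_top (induced Y Z)) f"
    using cont fZ by (auto simp: continuous_map_in_subtopology)
  show ?thesis
    unfolding fs_morphism_def
  proof (intro conjI allI impI ballI cont')
    fix V \<phi> assume V: "openin (fs_top (induced Y Z)) V" and \<phi>: "\<phi> \<in> fs_reg (induced Y Z) V"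
    show "\<phi> \<circ> f \<in> fs_reg X {x \<in> pts X. f x \<in> V}"
    proof (rule reg_local)
      show "openin (fs_top X) {x \<in> pts X. f x \<in> V}" using cont' V by (auto simp: continuous_map_def)
      fix x assume x: "x \<in> {x \<in> pts X. f x \<in> V}"
      then obtain U g where U: "openin (fs_top Y) U" "f x \<in> U" "g \<in> fs_reg Y U"
        "\<And>z. z \<in> U \<Longrightarrow> z \<in> V \<Longrightarrow> \<phi> z = g z" using reg_inducedE[OF \<phi>, of "f x"] by blast
      have "openin (fs_top X) {x \<in> pts X. f x \<in> U}" using cont U(1) by (auto simp: continuous_map_def)
      moreover have "g \<circ> f \<in> fs_reg X {x \<in> pts X. f x \<in> U}" using f U by (auto simp: fs_morphism_def)
      moreover have "\<forall>z\<in>{x \<in> pts X. f x \<in> U} \<inter> {x \<in> pts X. f x \<in> V}. (\<phi> \<circ> f) z = (g \<circ> f) z" using U(4) by simp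
      moreover have "x \<in> {x \<in> pts X. f x \<in> U}" using x U(2) by simp
      ultimately show "\<exists>W g. openin (fs_top X) W \<and> x \<in> W \<and> g \<in> fs_reg X W \<and>
          (\<forall>z\<in>W \<inter> {x \<in> pts X. f x \<in> V}. (\<phi> \<circ> f) z = g z)"
        by (intro exI[of _ "{x \<in> pts X. f x \<in> U}"] exI[of _ "g \<circ> f"] conjI)
    qed
  qed
qed

lemma fs_morphism_quotient: "fs_morphism X (quotient_space X q) q"
  unfolding fs_morphism_def continuous_map_def pts_quotient_space
  by (auto simp: openin_quotient_space reg_quotient_space)

lemma fs_morphism_id: "fs_morphism X X (\<lambda>x. x)"
proof -
  have "{x \<in> pts X. x \<in> V} = V" if "openin (fs_top X) V" for V using openin_subset[OF that] by auto
  thus ?thesis by (auto simp: fs_morphism_def comp_def continuous_map_def)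
qed

theorem corollary1p10:
  fixes r n m h :: nat
    and G S :: "'k::alg_closed_field mat set"
    and \<rho> :: "'k mat \<Rightarrow> 'k mat"
    and X Xs D :: "'k vec set set"
    and C :: "'k vec set set set"
    and D_curve :: "('k vec set, 'k) fun_space"
    and C_curve :: "('k vec set set, 'k) fun_space"
  assumes "linear_algebraic_group r G"
    and "geometrically_reductive r G"
    and "projective_variety n X"
    and "rational_rep r G n \<rho>"
    and "\<forall>g\<in>G. \<forall>x\<in>X. act \<rho> g x \<in> X"
    and "Xs = stable_locus r G n \<rho> X"
    and "closedin (fs_top (induced (proj_space n) Xs)) D"
    and "C = orbit G \<rho> ` D"
    and "D_curve = induced (proj_space n) D"
    and "C_curve = induced (stable_quotient r G n \<rho> X) C"
    and "complete_curve D_curve"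
    and "complete_curve C_curve"
    and "map_has_degree D_curve C_curve (orbit G \<rho>) m"
    and "generically D_curve (\<lambda>x. finite (stabilizer G \<rho> x) \<and> card (stabilizer G \<rho> x) = h)"
    and "normal_variety D_curve \<or> normal_variety C_curve"
    and "subgroup S (GL r)" and "S \<subseteq> G" and "finite S" and "card S = m * h"
    and "\<forall>x\<in>D. \<forall>g\<in>G. act \<rho> g x \<in> D \<longleftrightarrow> g \<in> S"
  shows "\<forall>x\<in>D. ramified_at D_curve C_curve (orbit G \<rho>) x \<longleftrightarrow>
           h < card (stabilizer G \<rho> x) \<and>
           generically D_curve
             (\<lambda>z. card (stabilizer G \<rho> z \<inter> S) < card (stabilizer G \<rho> x \<inter> S))"
proof
  fix x assume x: "x \<in> D"
  let ?Y = "induced (proj_space n) D" and ?X = "induced (proj_space n) Xs" and ?q = "orbit G \<rho>"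
  let ?H = "(GL r)\<lparr>carrier := S\<rparr>"
  have sub_G: "subgroup G (GL r)" using assms(1) by (simp add: linear_algebraic_group_def)
  interpret GLr: group "GL r :: 'k mat monoid" by (rule group_GL)
  interpret GLn: group "GL n :: 'k mat monoid" by (rule group_GL)
  interpret GG: group "(GL r)\<lparr>carrier := G\<rparr>" by (rule subgroup.subgroup_is_group[OF sub_G GLr.is_group])
  interpret GS: group ?H by (rule subgroup.subgroup_is_group[OF assms(16) GLr.is_group])
  have hom: "\<rho> \<in> hom ((GL r)\<lparr>carrier := G\<rparr>) (GL n)" using assms(4) by (simp add: rational_rep_def)
  interpret \<rho>: group_hom "(GL r)\<lparr>carrier := G\<rparr>" "GL n" \<rho>
    by (rule group_hom.intro[OF GG.is_group GLn.is_group]) (simp add: group_hom_axioms_def hom)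
  have \<rho>_mat: "\<rho> g \<in> carrier_mat n n" "det (\<rho> g) \<noteq> 0" if "g \<in> G" for g
    using \<rho>.hom_closed[of g] that by (auto simp: GL_def)
  have \<rho>_lin: "linear_automorphism n (\<rho> g)" if "g \<in> G" for g
    using \<rho>_mat[OF that] by unfold_locales
  have act_move: "act \<rho> g = linear_automorphism.move (\<rho> g)" if "g \<in> G" for g
    by (rule ext) (simp add: act_def linear_automorphism.move_def[OF \<rho>_lin[OF that]])
  have D_Xs: "D \<subseteq> Xs" and D_proj: "D \<subseteq> proj_points n"
    using closedin_subset[OF assms(7)] by (auto simp: pts_proj_space)
  have act_one: "act \<rho> (1\<^sub>m r) z = z" if z: "z \<in> proj_points n" for z
  proof -
    have "\<rho> (1\<^sub>m r) = 1\<^sub>m n" using \<rho>.hom_one by (simp add: GL_def)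
    moreover have "1\<^sub>m n *\<^sub>v v = v" if "v \<in> z" for v using proj_pointE(1)[OF z that] by simp
    ultimately show ?thesis by (simp add: act_def)
  qed
  have act_mult: "act \<rho> (g * k) z = act \<rho> g (act \<rho> k z)" if gk: "g \<in> G" "k \<in> G" and z: "z \<in> proj_points n" for g k z
  proof -
    have eq: "\<rho> (g * k) = \<rho> g * \<rho> k" using \<rho>.hom_mult[of g k] gk by (simp add: GL_def)
    have "\<rho> (g * k) *\<^sub>v v = \<rho> g *\<^sub>v (\<rho> k *\<^sub>v v)" if "v \<in> z" for v
      unfolding eq by (rule assoc_mult_mat_vec[OF \<rho>_mat(1)[OF gk(1)] \<rho>_mat(1)[OF gk(2)] proj_pointE(1)[OF z that]])
    thus ?thesis by (simp add: act_def image_image)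
  qed
  have act_proj: "act \<rho> g z \<in> proj_points n" if "g \<in> G" "z \<in> proj_points n" for g z
    using linear_automorphism.move_proj_points[OF \<rho>_lin] act_move that by simp
  have S_iff: "act \<rho> g z \<in> D \<longleftrightarrow> g \<in> S" if "z \<in> D" "g \<in> G" for g z using assms(20) that by blast
  have SG: "g \<in> G" if "g \<in> S" for g using assms(17) that by blast
  have varieties: "variety ?Y" "variety (induced (stable_quotient r G n \<rho> X) C)" "complete_space ?Y"
    using assms(9-12) by (auto simp: complete_curve_def)
  have C_eq: "C_curve = induced (quotient_space ?X ?q) C" using assms(6,10) by (simp add: stable_quotient_def)
  interpret Y: projective_subspace n D
  proof (intro projective_subspace.intro irreducible_sheaf.intro)
    show "function_sheaf ?Y" by (intro function_sheaf_induced function_sheaf_proj_space)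
    show "irreducible_sheaf_axioms ?Y" using varieties(1) by unfold_locales (simp add: variety_def)
    show "projective_subspace_axioms n D" by unfold_locales (rule D_proj)
  qed
  interpret C: irreducible_sheaf C_curve
  proof (intro irreducible_sheaf.intro)
    show "function_sheaf C_curve" unfolding C_eq
      by (intro function_sheaf_induced function_sheaf_quotient_space function_sheaf_proj_space)
    show "irreducible_sheaf_axioms C_curve" using assms(12) by unfold_locales (simp add: complete_curve_def variety_def)
  qed
  have pts_X: "pts ?X = Xs"
  proof -
    have "Xs \<subseteq> X" using assms(6) by (auto simp: stable_locus_def)
    moreover have "closedin (fs_top (proj_space n)) X" using assms(3) by (simp add: projective_variety_def)
    hence "X \<subseteq> proj_points n" unfolding pts_proj_space[symmetric] by (rule closedin_subset)
    ultimately show ?thesis by (auto simp: pts_proj_space)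
  qed
  interpret dominant_map ?Y C_curve ?q
  proof
    \<comment> \<open>The map to \<open>C\<close> is the quotient map of the stable locus,
      restricted to \<open>D\<close> in the source and to \<open>C\<close> in the target.\<close>
    have "fs_morphism ?Y ?X (\<lambda>x. x)" by (rule fs_morphism_induced[OF fs_morphism_id]) (use D_Xs in blast)
    hence "fs_morphism ?Y (quotient_space ?X ?q) (\<lambda>x. ?q x)" by (rule fs_morphism_compose[OF _ fs_morphism_quotient])
    thus "fs_morphism ?Y C_curve ?q" unfolding C_eq
      by (rule Y.fs_morphism_into_induced) (use assms(8) Y.pts_Y in auto)
    have "pts C_curve = pts (quotient_space ?X ?q) \<inter> C" unfolding C_eq by simp
    also have "\<dots> = ?q ` Xs \<inter> C" by (simp only: pts_quotient_space pts_X)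
    finally have "pts C_curve = ?q ` Xs \<inter> C" .
    thus "?q ` pts ?Y = pts C_curve" unfolding Y.pts_Y assms(8) using D_Xs by blast
  qed
  \<comment> \<open>An element fixing a point of \<open>D\<close> keeps that point in
    \<open>D\<close>, so it belongs to \<open>S\<close>.\<close>
  have stab: "stabilizer G \<rho> z = {g \<in> S. act \<rho> g z = z}" if "z \<in> D" for z
    using S_iff[OF that] that SG unfolding stabilizer_def by fastforce
  have act_S: "act \<rho> g z \<in> D" if "g \<in> S" "z \<in> D" for g z using S_iff[OF that(2) SG[OF that(1)]] that(1) by blast
  have act_morph: "fs_morphism ?Y ?Y (act \<rho> g)" if g: "g \<in> S" for g
    unfolding act_move[OF SG[OF g]]
    by (rule fs_morphism_induced[OF linear_automorphism.move_morphism[OF \<rho>_lin[OF SG[OF g]]]])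
      (use act_S[OF g] act_move[OF SG[OF g]] in simp)
  have act_open: "openin (fs_top ?Y) {z \<in> D. act \<rho> g z \<in> U}" if "g \<in> S" "openin (fs_top ?Y) U" for g U
    using act_morph[OF that(1)] that(2) unfolding fs_morphism_def continuous_map_def Y.pts_Y by blast
  have act_germ: "(\<lambda>z. f (act \<rho> g z)) \<in> germs ?Y z" if g: "g \<in> S" and z: "z \<in> D" and f: "f \<in> germs ?Y (act \<rho> g z)" for f g z
  proof -
    obtain U where U: "openin (fs_top ?Y) U" "act \<rho> g z \<in> U" "f \<in> fs_reg ?Y U" using f unfolding germs_def by blast
    have "f \<circ> act \<rho> g \<in> fs_reg ?Y {z \<in> D. act \<rho> g z \<in> U}"
      using act_morph[OF g] U(1,3) unfolding fs_morphism_def Y.pts_Y by blast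
    thus ?thesis using act_open[OF g U(1)] U(2) z unfolding germs_def comp_def by blast
  qed
  have orbit_act: "?q (act \<rho> g z) = ?q z" if g: "g \<in> G" and z: "z \<in> proj_points n" for g z
  proof
    show "?q (act \<rho> g z) \<subseteq> ?q z"
    proof
      fix w assume "w \<in> ?q (act \<rho> g z)"
      then obtain k where k: "k \<in> G" "w = act \<rho> k (act \<rho> g z)" by (auto simp: orbit_def)
      have "k * g \<in> G" using GG.m_closed[of k g] k(1) g by (simp add: GL_def)
      thus "w \<in> ?q z" using k act_mult[OF k(1) g z] by (auto simp: orbit_def)
    qed
    show "?q z \<subseteq> ?q (act \<rho> g z)"
    proof
      fix w assume "w \<in> ?q z"
      then obtain k where k: "k \<in> G" "w = act \<rho> k z" by (auto simp: orbit_def)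
      let ?i = "inv\<^bsub>(GL r)\<lparr>carrier := G\<rparr>\<^esub> g"
      have i: "?i \<in> G" "?i * g = 1\<^sub>m r" using GG.inv_closed[of g] GG.l_inv[of g] g by (simp_all add: GL_def)
      have ki: "k * ?i \<in> G" using GG.m_closed[of k ?i] k(1) i(1) by (simp add: GL_def)
      have "act \<rho> (k * ?i) (act \<rho> g z) = act \<rho> k (act \<rho> ?i (act \<rho> g z))"
        by (rule act_mult[OF k(1) i(1) act_proj[OF g z]])
      also have "\<dots> = act \<rho> k z" using act_mult[OF i(1) g z] act_one[OF z] i(2) by simp
      finally show "w \<in> ?q (act \<rho> g z)" using k(2) ki by (auto simp: orbit_def)
    qed
  qed
  have "finite_group_quotient n D C_curve ?q ?H (act \<rho>) m h"
  proof (intro finite_group_quotient.intro finite_group_quotient_axioms.intro)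
    show "projective_subspace n D" by unfold_locales
    show "dominant_map ?Y C_curve ?q" by unfold_locales
    show "group ?H" by unfold_locales
    show "finite (carrier ?H)" "card (carrier ?H) = m * h" using assms(18,19) by simp_all
    show "act \<rho> g z \<in> D" if "g \<in> carrier ?H" "z \<in> D" for g z using act_S that by simp
    show "act \<rho> \<one>\<^bsub>?H\<^esub> z = z" if "z \<in> D" for z using act_one that D_proj by (auto simp: GL_def)
    show "act \<rho> (g \<otimes>\<^bsub>?H\<^esub> k) z = act \<rho> g (act \<rho> k z)" if "g \<in> carrier ?H" "k \<in> carrier ?H" "z \<in> D" for g k z
      using act_mult[OF SG SG] that D_proj by (auto simp: GL_def)
    show "openin (fs_top ?Y) {z \<in> D. act \<rho> g z \<in> U}" if "g \<in> carrier ?H" "openin (fs_top ?Y) U" for g U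
      using act_open that by simp
    show "(\<lambda>z. f (act \<rho> g z)) \<in> germs ?Y z" if "g \<in> carrier ?H" "z \<in> D" "f \<in> germs ?Y (act \<rho> g z)" for f g z
      using act_germ that by simp
    show "openin (fs_top ?Y) {z \<in> D. act \<rho> g z \<noteq> z}" if "g \<in> carrier ?H" for g
      using moved_points_open[OF Y.projective_subspace_axioms \<rho>_lin, of g] act_move[of g] SG that by simp
    show "?q z = ?q w \<longleftrightarrow> (\<exists>g\<in>carrier ?H. w = act \<rho> g z)" if z: "z \<in> D" and w: "w \<in> D" for z w
    proof
      assume eq: "?q z = ?q w"
      have "1\<^sub>m r \<in> G" using GG.one_closed by (simp add: GL_def)
      hence "w \<in> ?q w" using act_one[of w] w D_proj unfolding orbit_def by force
      \<comment> \<open>Both \<open>z\<close> and its image \<open>w\<close> lie in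
        \<open>D\<close>, so the characterization of \<open>S\<close> moves \<open>g\<close> from
        \<open>G\<close> into \<open>S\<close>; fibres of the quotient map on \<open>D\<close> are
        orbits of \<open>S\<close>.\<close>
      then obtain g where g: "g \<in> G" "w = act \<rho> g z" unfolding eq[symmetric] by (auto simp: orbit_def)
      thus "\<exists>g\<in>carrier ?H. w = act \<rho> g z" using S_iff[OF z g(1)] w by auto
    next
      assume "\<exists>g\<in>carrier ?H. w = act \<rho> g z"
      then obtain g where "g \<in> S" "w = act \<rho> g z" by auto
      thus "?q z = ?q w" using orbit_act[of g z] SG z D_proj by auto
    qed
    show "ring.dimension (function_field ?Y) m (pullback ?Y ?q ` carrier (function_field C_curve)) (carrier (function_field ?Y))"
      using assms(13) unfolding assms(9) map_has_degree_def .
    have "\<forall>\<^sub>F z in gen ?Y. finite (stabilizer G \<rho> z) \<and> card (stabilizer G \<rho> z) = h"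
      using assms(14) unfolding assms(9) Y.eventually_gen .
    with Y.eventually_pts show "\<forall>\<^sub>F z in gen ?Y. card {g \<in> carrier ?H. act \<rho> g z = z} = h"
      by eventually_elim (use stab Y.pts_Y in auto)
  qed
  then interpret Q: finite_group_quotient n D C_curve ?q ?H "act \<rho>" m h .
  have Stab: "Q.Stab z = stabilizer G \<rho> z" if "z \<in> D" for z using stab[OF that] by (simp add: Q.Stab_def)
  have ram: "ramified_at D_curve C_curve ?q x \<longleftrightarrow> h < card (stabilizer G \<rho> x)"
    using Q.ramified_iff[OF _ _ varieties(3) x] varieties(2) assms(10) unfolding assms(9) Stab[OF x]
    by (auto simp: variety_def)
  \<comment> \<open>On \<open>D\<close> the generic intersection with \<open>S\<close> therefore has
    order \<open>h\<close>, and the comparison with \<open>h\<close> becomes the comparison with the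
    generic point.\<close>
  have int: "stabilizer G \<rho> z \<inter> S = stabilizer G \<rho> z" if "z \<in> D" for z using stab[OF that] by auto
  have "generically D_curve (\<lambda>z. card (stabilizer G \<rho> z \<inter> S) < card (stabilizer G \<rho> x \<inter> S))"
    if lt: "h < card (stabilizer G \<rho> x)"
  proof -
    have "\<forall>\<^sub>F z in gen ?Y. finite (stabilizer G \<rho> z) \<and> card (stabilizer G \<rho> z) = h"
      using assms(14) unfolding assms(9) Y.eventually_gen .
    with Y.eventually_pts have "\<forall>\<^sub>F z in gen ?Y. card (stabilizer G \<rho> z \<inter> S) < card (stabilizer G \<rho> x \<inter> S)"
      by eventually_elim (use int[OF x] int Y.pts_Y lt in auto)
    thus ?thesis unfolding assms(9) Y.eventually_gen .
  qed
  thus "ramified_at D_curve C_curve ?q x \<longleftrightarrow> h < card (stabilizer G \<rho> x) \<and>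
      generically D_curve (\<lambda>z. card (stabilizer G \<rho> z \<inter> S) < card (stabilizer G \<rho> x \<inter> S))"
    using ram by blast
qed

end
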